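(* For any $\lambda\in[0.4,0.5]$ and $\sigma\in[0.4,0.6]$, there is a Monte Carlo algorithm that, given $\mathcal{A}\subseteq\binom{[d]}{\sigma\lambda d}$ and $\mathcal{B}\subseteq\binom{[d]}{(1-\sigma)\lambda d}$, detects whether there exist $A\in\mathcal{A}$ and $B\in\mathcal{B}$ with $A\cap B=\emptyset$, in time $$\widetilde{\mathcal{O}}\left((|\mathcal{A}|+|\mathcal{B}|)\,2^{d(1/2+\lambda-h(\lambda/2))}\right)$$ and space $\widetilde{\mathcal{O}}(|\mathcal{A}|+|\mathcal{B}|+2^d)$.
   Context: $\binom{[d]}{k}$ is the family of $k$-element subsets of $[d]$ (the quantities $\sigma\lambda d$ and $(1-\sigma)\lambda d$ are assumed to be integers). $h(p)=-p\log_2p-(1-p)\log_2(1-p)$ is the binary entropy function. $\widetilde{\mathcal{O}}$ hides factors polylogarithmic in the input size (polynomial in $d$ and $\log(|\mathcal{A}|+|\mathcal{B}|)$). Monte Carlo means constant success probability. *)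

theory Defs
  imports
    "HOL-Probability.Probability"
    "HOL-Library.Ramsey"
    "HOL-Library.Nat_Bijection"
begin

text \<open>
  The model of computation is a randomized word RAM. A machine word consists of \<open>w\<close> bits and is
  represented by a natural number below \<open>2 ^ w\<close>. A program is a structured command over finitely
  many word registers and a word-addressable memory. Each small step costs one unit of time and
  executes one instruction, one test, or one rearrangement of the control structure. The only
  source of randomness is the instruction \<open>Flip\<close>, which stores one uniformly random bit.
\<close>

datatype operand = Reg nat | Imm nat

datatype binop = Add | Sub | Mul | Div | Mod | And | Or | Xor | Shl | Shr | Equal | Less

datatype com =
    Skip
  | Bin nat binop operand operand
  | Load nat operand
  | Store operand operand
  | Flip nat
  | Seq com com
  | Cond nat com com
  | Loop nat com

text \<open>
  The field \<open>space_used\<close> is a strict upper bound on all memory addresses used so far. The number of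
  registers is a constant of the program and is not counted.
\<close>

record state =
  regs :: "nat \<Rightarrow> nat"
  mem :: "nat \<Rightarrow> nat"
  space_used :: nat

fun operand_val :: "nat \<Rightarrow> state \<Rightarrow> operand \<Rightarrow> nat" where
  "operand_val w s (Reg r) = regs s r"
| "operand_val w s (Imm n) = n mod 2 ^ w"

text \<open>Subtraction is truncated at zero; division by zero yields \<open>0\<close>, and \<open>x mod 0 = x\<close>.\<close>

fun binop_val :: "binop \<Rightarrow> nat \<Rightarrow> nat \<Rightarrow> nat" where
  "binop_val Add x y = x + y"
| "binop_val Sub x y = x - y"
| "binop_val Mul x y = x * y"
| "binop_val Div x y = x div y"
| "binop_val Mod x y = x mod y"
| "binop_val And x y = semiring_bit_operations_class.and x y"
| "binop_val Or x y = semiring_bit_operations_class.or x y"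
| "binop_val Xor x y = semiring_bit_operations_class.xor x y"
| "binop_val Shl x y = push_bit y x"
| "binop_val Shr x y = drop_bit y x"
| "binop_val Equal x y = of_bool (x = y)"
| "binop_val Less x y = of_bool (x < y)"

definition set_reg :: "nat \<Rightarrow> nat \<Rightarrow> state \<Rightarrow> state" where
  "set_reg r v s = s\<lparr>regs := (regs s)(r := v)\<rparr>"

definition touch :: "nat \<Rightarrow> state \<Rightarrow> state" where
  "touch a s = s\<lparr>space_used := max (space_used s) (Suc a)\<rparr>"

text \<open>\<open>Skip\<close> is the halted program; halted configurations stay unchanged.\<close>

fun step :: "nat \<Rightarrow> com \<times> state \<Rightarrow> (com \<times> state) pmf" where
  "step w (Skip, s) = return_pmf (Skip, s)"
| "step w (Bin r f a b, s) =
     return_pmf (Skip,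
       set_reg r (binop_val f (operand_val w s a) (operand_val w s b) mod 2 ^ w) s)"
| "step w (Load r a, s) =
     (let i = operand_val w s a in return_pmf (Skip, touch i (set_reg r (mem s i) s)))"
| "step w (Store a b, s) =
     (let i = operand_val w s a
      in return_pmf (Skip, touch i (s\<lparr>mem := (mem s)(i := operand_val w s b)\<rparr>)))"
| "step w (Flip r, s) =
     map_pmf (\<lambda>b. (Skip, set_reg r (of_bool b mod 2 ^ w) s)) (bernoulli_pmf (1 / 2))"
| "step w (Seq c1 c2, s) =
     (if c1 = Skip then return_pmf (c2, s)
      else map_pmf (\<lambda>(c, t). (Seq c c2, t)) (step w (c1, s)))"
| "step w (Cond r c1 c2, s) = return_pmf (if regs s r \<noteq> 0 then c1 else c2, s)"
| "step w (Loop r c, s) =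
     return_pmf (if regs s r \<noteq> 0 then Seq c (Loop r c) else Skip, s)"

primrec run :: "nat \<Rightarrow> nat \<Rightarrow> com \<times> state \<Rightarrow> (com \<times> state) pmf" where
  "run w 0 cfg = return_pmf cfg"
| "run w (Suc n) cfg = bind_pmf (step w cfg) (run w n)"

text \<open>The input occupies the first memory cells; everything else is initially zero.\<close>

definition init_state :: "nat list \<Rightarrow> state" where
  "init_state inp =
     \<lparr>regs = (\<lambda>_. 0),
      mem = (\<lambda>i. if i < length inp then inp ! i else 0),
      space_used = length inp\<rparr>"

text \<open>
  The time and space bounds hold for every outcome of the coin flips; the answer is read off
  register \<open>0\<close> and is correct with probability at least \<open>2 / 3\<close>. Space is measured in words and
  includes the input.
\<close>

definition monte_carlo_decides ::
    "nat \<Rightarrow> com \<Rightarrow> nat list \<Rightarrow> bool \<Rightarrow> real \<Rightarrow> real \<Rightarrow> bool" where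
  "monte_carlo_decides w P inp answer time_bound space_bound \<longleftrightarrow>
     (\<exists>T. real T \<le> time_bound \<and>
        (\<forall>(c, s) \<in> set_pmf (run w T (P, init_state inp)).
           c = Skip \<and> real (space_used s) \<le> space_bound) \<and>
        measure_pmf.prob (run w T (P, init_state inp))
          {(c, s). (regs s 0 \<noteq> 0) = answer} \<ge> 2 / 3)"

text \<open>
  A set \<open>A \<subseteq> {1..d}\<close> is stored as the single word whose bit \<open>i\<close> is set iff \<open>i \<in> A\<close>.
\<close>

definition families_input :: "nat \<Rightarrow> nat set list \<Rightarrow> nat set list \<Rightarrow> nat list" where
  "families_input d As Bs =
     [d, length As, length Bs] @ map set_encode As @ map set_encode Bs"

definition binary_entropy :: "real \<Rightarrow> real" where
  "binary_entropy p = - p * log 2 p - (1 - p) * log 2 (1 - p)"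

text \<open>
  \<open>polylog_factor C c d n\<close> with constants \<open>C\<close>, \<open>c\<close> is the factor hidden by the soft-O notation for
  \<open>n\<close> sets over a universe of size \<open>d\<close>. The shift by \<open>2\<close> keeps it meaningful for \<open>n = 0\<close> and \<open>d = 0\<close>.
\<close>

definition polylog_factor :: "real \<Rightarrow> nat \<Rightarrow> nat \<Rightarrow> nat \<Rightarrow> real" where
  "polylog_factor C c d n = C * (real d + log 2 (real n + 2)) ^ c"

end

theory Submission
  imports Defs
begin

text \<open>
  Call \<open>F\<close> a cover of \<open>(A, B)\<close> if \<open>A \<subseteq> F\<close> and \<open>F \<inter> B = {}\<close>. The universe is cut into \<open>K = 10\<close> consecutive blocks of
  \<open>m\<close> elements, so that looping over all \<open>2 ^ m\<close> subsets of a block is affordable. If \<open>A\<close> and \<open>B\<close> are disjoint and have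
  \<open>a\<close> and \<open>b\<close> elements in a block, put \<open>c = m - a - b\<close> and keep every subset of size \<open>a + y\<close> of the block
  independently with probability about \<open>1 / (c choose y)\<close>. Then with constant probability a kept set covers
  the pair in this block, while only about \<open>(b + c choose y) / (c choose y)\<close> kept sets contain the part of \<open>A\<close>, and
  about \<open>(a + c choose c - y) / (c choose y)\<close> avoid the part of \<open>B\<close>. The algorithm marks all unions of kept sets that contain a
  given \<open>A\<close> and looks up all unions that avoid a given \<open>B\<close>, cutting off each enumeration at a cap. The sizes and
  densities for all blocks are guessed by polynomially many rounds; since the product over the blocks is bounded for every
  distribution of \<open>A\<close> and \<open>B\<close> over the blocks, no balancing is needed. Marks are never erased: a marked set always
  contains some member of the first family.

  Let \<open>y = \<rho> * c\<close>. For \<open>\<sigma> = 1/2\<close> the choice \<open>\<rho> = 1/2\<close> gives the claimed exponent because the entropy of \<open>\<lambda>\<close> is at most \<open>1\<close>.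
  In general the total size of the \<open>y\<close> is moved linearly with \<open>\<sigma> - 1/2\<close>, with the slope for which the exponents of both sides are
  stationary at \<open>\<sigma> = 1/2\<close>; along this line both exponents are concave, hence maximal at \<open>\<sigma> = 1/2\<close>.
  The cap is computed exactly as a quotient of \<open>2 ^ (d div 2 + \<lambda> d)\<close> by a binomial coefficient, which is
  possible because \<open>\<lambda>\<close> is rational whenever an input with \<open>d > 0\<close> exists.
\<close>

section \<open>A program logic for the randomized word RAM\<close>

text \<open>The time bound must hold for every outcome of the coins, hence the cap on each
  enumeration; randomness can lose a pair but never invent one. Leaving the marks in place also
  saves time: clearing them would cost \<open>2 ^ d\<close> steps per round, which the bound does
  not allow for small families. Balancing is avoided because each binomial coefficient is estimated
  by one term of a binomial distribution whose parameter is the same in all blocks. Such estimates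
  are geometric in the block data, so their product sees only the totals, and these are fixed by
  \<lambda> and \<sigma>. The number 10 of blocks reflects that the claimed exponent is at least
  1/10. Even with the right guesses a round is only guaranteed to succeed with probability
  \<open>(1 / 4) ^ K\<close>. The round number therefore has more digits than the guesses use: every
  guess recurs in polynomially many rounds, each with its own random words. All random words are
  drawn before the search starts. The search is then a function of the table of random words, so
  that the verification of the code and the probability estimates do not interact.\<close>

lemma run_add: "run w (a + b) cfg = bind_pmf (run w a cfg) (run w b)"
  by (induction a arbitrary: cfg) (simp_all add: bind_return_pmf bind_assoc_pmf cong: bind_pmf_cong)

lemma run_Skip: "run w n (Skip, s) = return_pmf (Skip, s)"
  by (induction n) (auto simp: bind_return_pmf)

definition halts :: "nat \<Rightarrow> nat \<Rightarrow> com \<times> state \<Rightarrow> bool" where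
  "halts w T cfg \<longleftrightarrow> (\<forall>x\<in>set_pmf (run w T cfg). fst x = Skip)"

text \<open>A halted configuration stays put. This turns the time in a triple into an upper bound
  and lets outcomes that halt at different moments share one \<open>T\<close>.\<close>

lemma run_pad:
  assumes "halts w T cfg"
  shows "run w (T + n) cfg = run w T cfg"
proof -
  have "run w (T + n) cfg = bind_pmf (run w T cfg) return_pmf"
    unfolding run_add
  proof (rule bind_pmf_cong)
    fix x assume "x \<in> set_pmf (run w T cfg)"
    then have "fst x = Skip" using assms by (auto simp: halts_def)
    then show "run w n x = return_pmf x" by (cases x) (simp add: run_Skip)
  qed simp
  then show ?thesis by (simp add: bind_return_pmf')
qed

text \<open>\<open>c1\<close> may halt at different times on different outcomes; the steps saved are
  absorbed because \<open>c2\<close> stays halted. The extra step is the one that replaces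
  \<open>Seq Skip c2\<close> by \<open>c2\<close>.\<close>

lemma run_Seq:
  assumes "halts w T1 (c1, s)"
    and "\<And>x. x \<in> set_pmf (run w T1 (c1, s)) \<Longrightarrow> halts w T2 (c2, snd x)"
  shows "run w (T1 + T2 + 1) (Seq c1 c2, s) =
         bind_pmf (run w T1 (c1, s)) (\<lambda>x. run w T2 (c2, snd x))"
  using assms
proof (induction T1 arbitrary: c1 s)
  case 0
  then show ?case by (auto simp: halts_def bind_return_pmf)
next
  case (Suc T1)
  show ?case
  proof (cases "c1 = Skip")
    case True
    have "halts w T2 (c2, s)" using Suc.prems(2)[of "(Skip, s)"] True
      by (simp add: run_Skip del: run.simps)
    then have "run w (T2 + Suc T1) (c2, s) = run w T2 (c2, s)" by (rule run_pad)
    moreover have "run w (Suc T1 + T2 + 1) (Seq c1 c2, s) = run w (T2 + Suc T1) (c2, s)"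
      using True by (simp add: bind_return_pmf add.commute)
    ultimately show ?thesis using True by (simp add: run_Skip bind_return_pmf del: run.simps)
  next
    case False
    have *: "run w (T1 + T2 + 1) (Seq c c2, t) = bind_pmf (run w T1 (c, t)) (\<lambda>x. run w T2 (c2, snd x))"
      if "(c, t) \<in> set_pmf (step w (c1, s))" for c t
    proof (rule Suc.IH)
      show "halts w T1 (c, t)" using Suc.prems(1) that by (auto simp: halts_def)
      show "\<And>x. x \<in> set_pmf (run w T1 (c, t)) \<Longrightarrow> halts w T2 (c2, snd x)"
        using Suc.prems(2) that by (auto simp del: step.simps)
    qed
    have "run w (Suc T1 + T2 + 1) (Seq c1 c2, s) =
        bind_pmf (step w (c1, s)) (\<lambda>x. run w (T1 + T2 + 1) (Seq (fst x) c2, snd x))"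
      using False by (simp add: bind_map_pmf case_prod_unfold)
    also have "\<dots> = bind_pmf (step w (c1, s)) (\<lambda>x. bind_pmf (run w T1 x) (\<lambda>x. run w T2 (c2, snd x)))"
    proof (rule bind_pmf_cong)
      fix x assume "x \<in> set_pmf (step w (c1, s))"
      then show "run w (T1 + T2 + 1) (Seq (fst x) c2, snd x) = bind_pmf (run w T1 x) (\<lambda>x. run w T2 (c2, snd x))"
        using *[of "fst x" "snd x"] by simp
    qed simp
    finally show ?thesis by (simp add: bind_assoc_pmf)
  qed
qed

text \<open>
  The joint distribution \<open>p\<close> couples the final state with a logical value of distribution \<open>D\<close>, so that
  \<open>Q\<close> can describe the final state deterministically from the random choices.
\<close>

definition triple :: "nat \<Rightarrow> (state \<Rightarrow> bool) \<Rightarrow> com \<Rightarrow> nat \<Rightarrow> 'z pmf \<Rightarrow> ('z \<Rightarrow> state \<Rightarrow> bool) \<Rightarrow> bool" where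
  "triple w P c T D Q \<longleftrightarrow> (\<forall>s. P s \<longrightarrow> (\<exists>p. map_pmf fst p = D \<and>
      (\<forall>x\<in>set_pmf p. Q (fst x) (snd x)) \<and> run w T (c, s) = map_pmf (\<lambda>x. (Skip, snd x)) p))"

lemma triple_conseq:
  assumes "triple w P c T D Q" "\<And>s. P' s \<Longrightarrow> P s" "\<And>z s. z \<in> set_pmf D \<Longrightarrow> Q z s \<Longrightarrow> Q' z s" "T \<le> T'"
  shows "triple w P' c T' D Q'"
  unfolding triple_def
proof (intro allI impI)
  fix s assume "P' s"
  then obtain p where p: "map_pmf fst p = D" "\<forall>x\<in>set_pmf p. Q (fst x) (snd x)"
    "run w T (c, s) = map_pmf (\<lambda>x. (Skip, snd x)) p"
    using assms(1,2) unfolding triple_def by blast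
  have "halts w T (c, s)" using p(3) by (auto simp: halts_def)
  from run_pad[OF this, of "T' - T"] have "run w T' (c, s) = map_pmf (\<lambda>x. (Skip, snd x)) p"
    using p(3) assms(4) by simp
  moreover have "\<forall>x\<in>set_pmf p. Q' (fst x) (snd x)"
    using p(1,2) assms(3) by (metis image_eqI set_map_pmf)
  ultimately show "\<exists>p. map_pmf fst p = D \<and>
      (\<forall>x\<in>set_pmf p. Q' (fst x) (snd x)) \<and> run w T' (c, s) = map_pmf (\<lambda>x. (Skip, snd x)) p"
    using p(1) by blast
qed

text \<open>The couplings of the second command, one for each outcome of the first, are glued by
  \<open>bind_pmf\<close>. The value \<open>z\<close> becomes a parameter of the middle assertion,
  so assertions about random data remain ordinary predicates on states.\<close>

lemma triple_Seq:
  assumes "triple w P c1 T1 D Q" "\<And>z. z \<in> set_pmf D \<Longrightarrow> triple w (Q z) c2 T2 (E z) R"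
  shows "triple w P (Seq c1 c2) (T1 + T2 + 1) (bind_pmf D E) R"
  unfolding triple_def
proof (intro allI impI)
  fix s assume "P s"
  then obtain p where p: "map_pmf fst p = D" "\<forall>x\<in>set_pmf p. Q (fst x) (snd x)"
    "run w T1 (c1, s) = map_pmf (\<lambda>x. (Skip, snd x)) p"
    using assms(1) unfolding triple_def by blast
  have "\<forall>x\<in>set_pmf p. \<exists>q. map_pmf fst q = E (fst x) \<and> (\<forall>y\<in>set_pmf q. R (fst y) (snd y)) \<and>
     run w T2 (c2, snd x) = map_pmf (\<lambda>x. (Skip, snd x)) q"
    using p(1,2) assms(2) unfolding triple_def by fastforce
  then obtain q where q: "\<And>x. x \<in> set_pmf p \<Longrightarrow> map_pmf fst (q x) = E (fst x)"
     "\<And>x y. x \<in> set_pmf p \<Longrightarrow> y \<in> set_pmf (q x) \<Longrightarrow> R (fst y) (snd y)"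
     "\<And>x. x \<in> set_pmf p \<Longrightarrow> run w T2 (c2, snd x) = map_pmf (\<lambda>x. (Skip, snd x)) (q x)"
    by metis
  have "halts w T1 (c1, s)" using p(3) by (auto simp: halts_def)
  then have "run w (T1 + T2 + 1) (Seq c1 c2, s) =
         bind_pmf (run w T1 (c1, s)) (\<lambda>x. run w T2 (c2, snd x))"
    by (rule run_Seq) (use p(3) q(3) in \<open>auto simp: halts_def\<close>)
  also have "\<dots> = bind_pmf p (\<lambda>x. map_pmf (\<lambda>x. (Skip, snd x)) (q x))"
    unfolding p(3) bind_map_pmf by (intro bind_pmf_cong) (auto simp: q(3))
  also have "\<dots> = map_pmf (\<lambda>x. (Skip, snd x)) (bind_pmf p q)"
    by (simp add: map_bind_pmf)
  finally have r: "run w (T1 + T2 + 1) (Seq c1 c2, s) = map_pmf (\<lambda>x. (Skip, snd x)) (bind_pmf p q)" .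
  have "map_pmf fst (bind_pmf p q) = bind_pmf p (\<lambda>x. E (fst x))"
    unfolding map_bind_pmf by (intro bind_pmf_cong) (auto simp: q(1))
  also have "\<dots> = bind_pmf D E" unfolding p(1)[symmetric] bind_map_pmf ..
  finally show "\<exists>p. map_pmf fst p = bind_pmf D E \<and> (\<forall>x\<in>set_pmf p. R (fst x) (snd x)) \<and>
      run w (T1 + T2 + 1) (Seq c1 c2, s) = map_pmf (\<lambda>x. (Skip, snd x)) p"
    using r q(2) by (intro exI[of _ "bind_pmf p q"]) auto
qed

abbreviation hoare :: "nat \<Rightarrow> (state \<Rightarrow> bool) \<Rightarrow> com \<Rightarrow> nat \<Rightarrow> (state \<Rightarrow> bool) \<Rightarrow> bool" where
  "hoare w P c T Q \<equiv> triple w P c T (return_pmf ()) (\<lambda>_. Q)"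

lemma hoare_Seq:
  "hoare w P c1 T1 Q \<Longrightarrow> hoare w Q c2 T2 R \<Longrightarrow> hoare w P (Seq c1 c2) (T1 + T2 + 1) R"
  using triple_Seq[of w P c1 T1 "return_pmf ()" "\<lambda>_. Q" c2 T2 "\<lambda>_. return_pmf ()" "\<lambda>_. R"]
  by (simp add: bind_return_pmf)

lemma hoare_conseq:
  "hoare w P c T Q \<Longrightarrow> (\<And>s. P' s \<Longrightarrow> P s) \<Longrightarrow> (\<And>s. Q s \<Longrightarrow> Q' s) \<Longrightarrow> T \<le> T' \<Longrightarrow> hoare w P' c T' Q'"
  by (erule triple_conseq)

section \<open>Straight-line code and coin flips\<close>

fun straight :: "com \<Rightarrow> bool" where
  "straight (Bin r f a b) = True"
| "straight (Load r a) = True"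
| "straight (Store a b) = True"
| "straight (Seq c1 c2) = (straight c1 \<and> straight c2)"
| "straight _ = False"

fun eval_straight :: "nat \<Rightarrow> com \<Rightarrow> state \<Rightarrow> state" where
  "eval_straight w (Bin r f a b) s =
     set_reg r (binop_val f (operand_val w s a) (operand_val w s b) mod 2 ^ w) s"
| "eval_straight w (Load r a) s =
     touch (operand_val w s a) (set_reg r (mem s (operand_val w s a)) s)"
| "eval_straight w (Store a b) s =
     touch (operand_val w s a) (s\<lparr>mem := (mem s)(operand_val w s a := operand_val w s b)\<rparr>)"
| "eval_straight w (Seq c1 c2) s = eval_straight w c2 (eval_straight w c1 s)"
| "eval_straight w _ s = s"

fun straight_time :: "com \<Rightarrow> nat" where
  "straight_time (Seq c1 c2) = straight_time c1 + straight_time c2 + 1"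
| "straight_time _ = 1"

lemma hoare_exact:
  assumes "\<And>s. P s \<Longrightarrow> run w T (c, s) = return_pmf (Skip, f s)" "\<And>s. P s \<Longrightarrow> Q (f s)"
  shows "hoare w P c T Q"
  unfolding triple_def
proof (intro allI impI)
  fix s assume "P s"
  then show "\<exists>p. map_pmf fst p = return_pmf () \<and> (\<forall>x\<in>set_pmf p. Q (snd x)) \<and>
       run w T (c, s) = map_pmf (\<lambda>x. (Skip, snd x)) p"
    using assms by (intro exI[of _ "return_pmf ((), f s)"]) auto
qed

text \<open>Code without loops, tests and flips acts as a function on states, so the simplifier
  verifies such blocks by evaluating \<open>eval_straight\<close>.\<close>

lemma run_straight:
  "straight c \<Longrightarrow> run w (straight_time c) (c, s) = return_pmf (Skip, eval_straight w c s)"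
proof (induction c arbitrary: s)
  case (Seq c1 c2)
  then have 1: "run w (straight_time c1) (c1, s) = return_pmf (Skip, eval_straight w c1 s)"
    and 2: "run w (straight_time c2) (c2, t) = return_pmf (Skip, eval_straight w c2 t)" for t by auto
  have "run w (straight_time c1 + straight_time c2 + 1) (Seq c1 c2, s) =
         bind_pmf (run w (straight_time c1) (c1, s)) (\<lambda>x. run w (straight_time c2) (c2, snd x))"
    by (rule run_Seq) (auto simp: halts_def 1 2)
  then show ?case by (simp add: 1 2 bind_return_pmf)
qed (auto simp: bind_return_pmf Let_def)

lemma hoare_straight:
  assumes "straight c" "\<And>s. P s \<Longrightarrow> Q (eval_straight w c s)"
  shows "hoare w P c (straight_time c) Q"
  by (rule hoare_exact[where f = "eval_straight w c"]) (use assms run_straight in auto)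

text \<open>A point mass carries no information, so a deterministic command may be labelled with any
  value, for instance the random data of earlier flips.\<close>

lemma triple_return:
  assumes "hoare w P c T Q"
  shows "triple w P c T (return_pmf z) (\<lambda>_. Q)"
  unfolding triple_def
proof (intro allI impI)
  fix s assume "P s"
  then obtain p :: "(unit \<times> state) pmf" where p: "\<forall>x\<in>set_pmf p. Q (snd x)" "run w T (c, s) = map_pmf (\<lambda>x. (Skip, snd x)) p"
    using assms unfolding triple_def by blast
  show "\<exists>p. map_pmf fst p = return_pmf z \<and> (\<forall>x\<in>set_pmf p. Q (snd x)) \<and>
     run w T (c, s) = map_pmf (\<lambda>x. (Skip, snd x)) p"
    using p by (intro exI[of _ "map_pmf (\<lambda>x. (z, snd x)) p"]) (auto simp: pmf.map_comp o_def)
qed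

lemma triple_Flip:
  assumes "\<And>s b. P s \<Longrightarrow> Q b (set_reg r (of_bool b mod 2 ^ w) s)"
  shows "triple w P (Flip r) 1 (bernoulli_pmf (1/2)) Q"
  unfolding triple_def
proof (intro allI impI)
  fix s assume "P s"
  then show "\<exists>p. map_pmf fst p = bernoulli_pmf (1/2) \<and> (\<forall>x\<in>set_pmf p. Q (fst x) (snd x)) \<and>
     run w 1 (Flip r, s) = map_pmf (\<lambda>x. (Skip, snd x)) p"
    using assms by (intro exI[of _ "map_pmf (\<lambda>b. (b, set_reg r (of_bool b mod 2 ^ w) s)) (bernoulli_pmf (1/2))"])
      (auto simp: pmf.map_comp o_def bind_return_pmf' map_pmf_def bind_assoc_pmf bind_return_pmf)
qed

section \<open>Counted loops\<close>

primrec iterate_pmf :: "(nat \<Rightarrow> 'z \<Rightarrow> 'z pmf) \<Rightarrow> 'z \<Rightarrow> nat \<Rightarrow> 'z pmf" where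
  "iterate_pmf D z 0 = return_pmf z"
| "iterate_pmf D z (Suc n) = bind_pmf (iterate_pmf D z n) (D n)"

text \<open>Register \<open>i\<close> is the loop counter, register \<open>n\<close> holds the bound, and register \<open>c\<close> the test.\<close>

definition For :: "nat \<Rightarrow> nat \<Rightarrow> nat \<Rightarrow> com \<Rightarrow> com" where
  "For i c n body =
     Seq (Seq (Bin i Add (Imm 0) (Imm 0)) (Bin c Less (Reg i) (Reg n)))
       (Loop c (Seq body (Seq (Bin i Add (Reg i) (Imm 1)) (Bin c Less (Reg i) (Reg n)))))"

lemma triple_Loop_exit:
  assumes "\<And>s. P s \<Longrightarrow> regs s c = 0" "\<And>s. P s \<Longrightarrow> Q z s"
  shows "triple w P (Loop c body) 1 (return_pmf z) Q"
  unfolding triple_def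
proof (intro allI impI)
  fix s assume "P s"
  then show "\<exists>p. map_pmf fst p = return_pmf z \<and> (\<forall>x\<in>set_pmf p. Q (fst x) (snd x)) \<and>
     run w 1 (Loop c body, s) = map_pmf (\<lambda>x. (Skip, snd x)) p"
    using assms by (intro exI[of _ "return_pmf (z, s)"]) (auto simp: bind_return_pmf)
qed

lemma triple_Loop_unfold:
  assumes "\<And>s. P s \<Longrightarrow> regs s c \<noteq> 0" "triple w P (Seq body (Loop c body)) T D Q"
  shows "triple w P (Loop c body) (Suc T) D Q"
  using assms unfolding triple_def by (auto simp: bind_return_pmf)

text \<open>One iteration costs \<open>T + 6\<close>: three steps to advance and test the counter,
  one for unfolding the loop and one for each of two sequential compositions.\<close>

lemma triple_For:
  fixes I :: "nat \<Rightarrow> 'z \<Rightarrow> state \<Rightarrow> bool"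
  assumes body: "\<And>i z. i < N \<Longrightarrow>
      triple w (\<lambda>s. I i z s \<and> regs s ri = i \<and> regs s rn = N) body T (D i z)
        (\<lambda>z' s. I (Suc i) z' s \<and> regs s ri = i \<and> regs s rn = N)"
    and inv: "\<And>i z s v. I i z s \<Longrightarrow> I i z (set_reg ri v s) \<and> I i z (set_reg rc v s)"
    and N: "N < 2 ^ w" and "ri \<noteq> rn" "rc \<noteq> rn" "ri \<noteq> rc"
  shows "triple w (\<lambda>s. I 0 z s \<and> regs s rn = N) (For ri rc rn body) (N * (T + 6) + 6)
     (iterate_pmf D z N) (\<lambda>z s. I N z s \<and> regs s rn = N)"
proof -
  let ?J = "\<lambda>i z s. I i z s \<and> regs s ri = i \<and> regs s rn = N \<and> regs s rc = of_bool (i < N)"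
  let ?upd = "Seq (Bin ri Add (Reg ri) (Imm 1)) (Bin rc Less (Reg ri) (Reg rn))"
  \<comment> \<open>For \<open>N = 0\<close> the word length may be 0, so facts about the constant 1
    are available only for a positive bound.\<close>
  have w: "(1::nat) < 2 ^ w" if "0 < N" using N that by linarith
  have one: "1 mod 2 ^ w = (1::nat)" if "0 < N" using w[OF that] by (rule mod_less)
  have mod1: "of_bool b mod (2::nat) ^ w = of_bool b" if "b \<Longrightarrow> 0 < N" for b
    using one that by (cases b) simp_all
  have upd: "triple w (\<lambda>s. I (Suc i) z s \<and> regs s ri = i \<and> regs s rn = N) ?upd 3 (return_pmf z)
     (?J (Suc i))" if "i < N" for i z
  proof -
    have m: "Suc i mod 2 ^ w = Suc i" using N that by simp
    have o: "1 mod 2 ^ w = (1::nat)" using one that by simp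
    have b: "of_bool (Suc i < N) mod 2 ^ w = (of_bool (Suc i < N) :: nat)" using mod1 by simp
    have *: "hoare w (\<lambda>s. I (Suc i) z s \<and> regs s ri = i \<and> regs s rn = N) ?upd (straight_time ?upd)
     (?J (Suc i) z)"
    proof (rule hoare_straight)
      fix s assume a: "I (Suc i) z s \<and> regs s ri = i \<and> regs s rn = N"
      then have "I (Suc i) z (eval_straight w ?upd s)" using inv by simp
      moreover have "regs (eval_straight w ?upd s) ri = Suc i" "regs (eval_straight w ?upd s) rn = N"
          "regs (eval_straight w ?upd s) rc = of_bool (Suc i < N)"
        using a assms(4-6) m o b by (simp_all add: set_reg_def)
      ultimately show "?J (Suc i) z (eval_straight w ?upd s)" by blast
    qed simp
    show ?thesis 
      by (rule triple_conseq[OF triple_return[OF *, of z]]) auto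
  qed
  have step: "triple w (?J i z) (Seq body ?upd) (T + 3 + 1) (D i z) (?J (Suc i))" if "i < N" for i z
  proof -
    have "triple w (?J i z) (Seq body ?upd) (T + 3 + 1) (bind_pmf (D i z) return_pmf) (?J (Suc i))"
      by (rule triple_Seq[OF triple_conseq[OF body[OF that]] upd[OF that]]) auto
    then show ?thesis by (simp add: bind_return_pmf')
  qed
  \<comment> \<open>\<open>?D k\<close> is the continuation formed by the last \<open>k\<close>
    iterations. The loop unfolds at the front while \<open>iterate_pmf\<close> grows at the end; the
    fact \<open>D\<close> below reconciles the two by associativity of
    \<open>bind_pmf\<close>.\<close>
  let ?D = "\<lambda>k. rec_nat return_pmf (\<lambda>k f z. bind_pmf (D (N - Suc k) z) f) k"
  have loop: "triple w (?J (N - k) z) (Loop rc (Seq body ?upd)) (k * (T + 6) + 1) (?D k z) (?J N)"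
    if "k \<le> N" for k z using that
  proof (induction k arbitrary: z)
    case 0
    have "triple w (?J N z) (Loop rc (Seq body ?upd)) 1 (return_pmf z) (?J N)"
      by (rule triple_Loop_exit) auto
    then show ?case by simp
  next
    case (Suc k)
    have lt: "N - Suc k < N" "Suc (N - Suc k) = N - k" using Suc.prems by auto
    have IH: "triple w (?J (N - k) z) (Loop rc (Seq body ?upd)) (k * (T + 6) + 1) (?D k z) (?J N)" for z
      using Suc by simp
    have "triple w (?J (N - Suc k) z) (Seq (Seq body ?upd) (Loop rc (Seq body ?upd)))
       ((T + 3 + 1) + (k * (T + 6) + 1) + 1) (?D (Suc k) z) (?J N)"
      using triple_Seq[OF step[OF lt(1)] IH[folded lt(2)]] by simp
    then have "triple w (?J (N - Suc k) z) (Loop rc (Seq body ?upd))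
       (Suc ((T + 3 + 1) + (k * (T + 6) + 1) + 1)) (?D (Suc k) z) (?J N)"
      by (rule triple_Loop_unfold[rotated]) (use lt in auto)
    then show ?case by (rule triple_conseq) auto
  qed
  have init: "hoare w (\<lambda>s. I 0 z s \<and> regs s rn = N) (Seq (Bin ri Add (Imm 0) (Imm 0)) (Bin rc Less (Reg ri) (Reg rn)))
      3 (?J 0 z)"
  proof -
    let ?c = "Seq (Bin ri Add (Imm 0) (Imm 0)) (Bin rc Less (Reg ri) (Reg rn))"
    have "hoare w (\<lambda>s. I 0 z s \<and> regs s rn = N) ?c (straight_time ?c) (?J 0 z)"
    proof (rule hoare_straight)
      fix s assume a: "I 0 z s \<and> regs s rn = N"
      then have "I 0 z (eval_straight w ?c s)" using inv by simp
      moreover have "regs (eval_straight w ?c s) ri = 0" "regs (eval_straight w ?c s) rn = N"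
          "regs (eval_straight w ?c s) rc = of_bool (0 < N)"
        using a assms(4-6) mod1[of "0 < N"] by (simp_all add: set_reg_def)
      ultimately show "?J 0 z (eval_straight w ?c s)" by blast
    qed simp
    then show ?thesis by (rule hoare_conseq) auto
  qed
  have D: "bind_pmf (iterate_pmf D z (N - k)) (?D k) = iterate_pmf D z N" if "k \<le> N" for k
    using that
  proof (induction k)
    case 0
    then show ?case by (simp add: bind_return_pmf')
  next
    case (Suc k)
    have lt: "N - k = Suc (N - Suc k)" using Suc.prems by auto
    show ?case using Suc by (simp add: lt bind_assoc_pmf)
  qed
  have "triple w (\<lambda>s. I 0 z s \<and> regs s rn = N) (For ri rc rn body) (3 + (N * (T + 6) + 1) + 1)
     (bind_pmf (return_pmf ()) (\<lambda>_. ?D N z)) (?J N)"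
    unfolding For_def by (rule triple_Seq[OF init]) (use loop[of N] in simp)
  moreover have "bind_pmf (return_pmf ()) (\<lambda>_. ?D N z) = iterate_pmf D z N"
    using D[of N] by (simp add: bind_return_pmf)
  ultimately have "triple w (\<lambda>s. I 0 z s \<and> regs s rn = N) (For ri rc rn body) (3 + (N * (T + 6) + 1) + 1)
     (iterate_pmf D z N) (?J N)" by simp
  then show ?thesis by (rule triple_conseq) auto
qed

lemma hoare_For:
  assumes "\<And>i. i < N \<Longrightarrow>
      hoare w (\<lambda>s. I i s \<and> regs s ri = i \<and> regs s rn = N) body T
        (\<lambda>s. I (Suc i) s \<and> regs s ri = i \<and> regs s rn = N)"
    and "\<And>i s v. I i s \<Longrightarrow> I i (set_reg ri v s) \<and> I i (set_reg rc v s)"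
    and "N < 2 ^ w" and "ri \<noteq> rn" "rc \<noteq> rn" "ri \<noteq> rc"
  shows "hoare w (\<lambda>s. I 0 s \<and> regs s rn = N) (For ri rc rn body) (N * (T + 6) + 6)
     (\<lambda>s. I N s \<and> regs s rn = N)"
proof -
  have "iterate_pmf (\<lambda>_ _. return_pmf ()) () n = return_pmf ()" for n
    by (induction n) (auto simp: bind_return_pmf)
  then show ?thesis
    using triple_For[where N = N and w = w and I = "\<lambda>i _ s. I i s" and D = "\<lambda>_ _. return_pmf ()" and
      ri = ri and rn = rn and rc = rc and body = body and T = T and z = "()"] assms by simp
qed

section \<open>The program\<close>

notation Seq (infixr ";;" 60)

lemma regs_set_reg [simp]: "regs (set_reg r v s) r' = (if r' = r then v else regs s r')"
  by (simp add: set_reg_def)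

lemma mem_set_reg [simp]: "mem (set_reg r v s) = mem s"
  by (simp add: set_reg_def)

lemma space_used_set_reg [simp]: "space_used (set_reg r v s) = space_used s"
  by (simp add: set_reg_def)

lemma regs_touch [simp]: "regs (touch a s) = regs s"
  by (simp add: touch_def)

lemma mem_touch [simp]: "mem (touch a s) = mem s"
  by (simp add: touch_def)

lemma space_used_touch [simp]: "space_used (touch a s) = max (space_used s) (Suc a)"
  by (simp add: touch_def)

text \<open>Gives a name to the memory at entry, so that later assertions can compare the current
  memory with it.\<close>

lemma hoare_fix_mem:
  assumes "\<And>g. hoare w (\<lambda>s. P s \<and> mem s = g) c T Q"
  shows "hoare w P c T Q"
  using assms unfolding triple_def by blast

lemma hoare_straight_le:
  assumes "straight c" "\<And>s. P s \<Longrightarrow> Q (eval_straight w c s)" "straight_time c \<le> T"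
  shows "hoare w P c T Q"
proof -
  have "hoare w P c (straight_time c) Q" using assms(1,2) by (rule hoare_straight)
  then show ?thesis by (rule hoare_conseq) (use assms(3) in auto)
qed

lemma and_mod_word:
  fixes x :: nat
  assumes "x < 2 ^ w"
  shows "semiring_bit_operations_class.and x y mod 2 ^ w = semiring_bit_operations_class.and x y"
proof -
  have "semiring_bit_operations_class.and x y mod 2 ^ w = take_bit w (semiring_bit_operations_class.and x y)"
    by (simp add: take_bit_eq_mod)
  also have "\<dots> = semiring_bit_operations_class.and (take_bit w x) y"
    by (auto simp: bit_eq_iff bit_take_bit_iff bit_and_iff)
  also have "take_bit w x = x" using assms by (simp add: take_bit_nat_eq_self)
  finally show ?thesis .
qed

abbreviation "land \<equiv> (semiring_bit_operations_class.and :: nat \<Rightarrow> nat \<Rightarrow> nat)"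

lemma land_of_bool [simp]: "land (of_bool a) (of_bool b) = of_bool (a \<and> b)"
  by (cases a; cases b) auto

lemma lor_of_bool [simp]: "semiring_bit_operations_class.or (of_bool a :: nat) (of_bool b) = of_bool (a \<or> b)"
  by (cases a; cases b) auto

text \<open>
  Register conventions: 0 answer; 10 \<open>d\<close>; 11 \<open>|A|\<close>; 12 \<open>|A| + |B|\<close>; 13 block length \<open>m\<close>; 14 \<open>2 ^ m\<close>;
  15 number of rounds; 16 \<open>d + 2\<close>, the base of the guessed digits; 17 cap on the covers enumerated per set;
  18 to 22 base addresses of the population counts, the marks, the random words, the candidate lists and
  the list lengths; 23 number of blocks; 24 number of random words; 30 to 39 and 78 loop counters;
  40 to 49 and 79 loop tests; all others are temporaries.
\<close>

definition select_body :: com where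
  "select_body =
    Bin 64 And (Reg 61) (Reg 33);; Bin 64 Equal (Reg 64) (Reg 62);;
    Bin 65 Add (Reg 18) (Reg 33);; Load 65 (Reg 65);; Bin 65 Equal (Reg 65) (Reg 59);;
    Bin 64 Mul (Reg 64) (Reg 65);;
    Bin 66 Add (Reg 57) (Reg 33);; Load 66 (Reg 66);; Bin 66 Less (Reg 66) (Reg 60);;
    Bin 64 Mul (Reg 64) (Reg 66);;
    Bin 67 Add (Reg 58) (Reg 63);; Store (Reg 67) (Reg 33);; Bin 63 Add (Reg 63) (Reg 64)"

text \<open>Register 62 receives the part of the set for the first family and 0 for the second.
  Comparing the bitwise conjunction with it then tests containment for the first family and
  disjointness for the second, without a branch.\<close>

definition block_head :: com where
  "block_head =
    Bin 59 Mod (Reg 55) (Reg 16);; Bin 55 Div (Reg 55) (Reg 16);;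
    Bin 60 Mod (Reg 55) (Reg 16);; Bin 55 Div (Reg 55) (Reg 16);; Bin 60 Shl (Imm 1) (Reg 60);;
    Bin 61 Mod (Reg 54) (Reg 14);; Bin 54 Div (Reg 54) (Reg 14);;
    Bin 62 Mul (Reg 61) (Reg 53);; Bin 63 Add (Imm 0) (Imm 0)"

definition block_tail :: com where
  "block_tail =
    Bin 67 Add (Reg 22) (Reg 32);; Store (Reg 67) (Reg 63);; Bin 56 Mul (Reg 56) (Reg 63);;
    Bin 57 Add (Reg 57) (Reg 14);; Bin 58 Add (Reg 58) (Reg 14)"

definition set_head :: com where
  "set_head =
    Bin 51 Add (Reg 31) (Imm 3);; Load 54 (Reg 51);; Bin 53 Less (Reg 31) (Reg 11);;
    Bin 55 Add (Reg 30) (Imm 0);; Bin 56 Add (Imm 1) (Imm 0);;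
    Bin 57 Mul (Reg 30) (Reg 23);; Bin 57 Mul (Reg 57) (Reg 14);; Bin 57 Add (Reg 57) (Reg 20);;
    Bin 58 Add (Reg 21) (Imm 0)"

text \<open>The minimum of registers 56 and 17, formed by multiplying with the outcome of the
  comparison so that the code stays straight.\<close>

definition limit_code :: com where
  "limit_code =
    Bin 68 Less (Reg 56) (Reg 17);; Bin 69 Sub (Imm 1) (Reg 68);;
    Bin 68 Mul (Reg 68) (Reg 56);; Bin 69 Mul (Reg 69) (Reg 17);; Bin 68 Add (Reg 68) (Reg 69)"

definition cover_head :: com where
  "cover_head =
    Bin 70 Add (Reg 34) (Imm 0);; Bin 71 Add (Imm 0) (Imm 0);; Bin 72 Add (Imm 1) (Imm 0);;
    Bin 58 Add (Reg 21) (Imm 0)"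

definition cover_body :: com where
  "cover_body =
    Bin 67 Add (Reg 22) (Reg 35);; Load 73 (Reg 67);;
    Bin 74 Mod (Reg 70) (Reg 73);; Bin 70 Div (Reg 70) (Reg 73);;
    Bin 74 Add (Reg 74) (Reg 58);; Load 74 (Reg 74);; Bin 74 Mul (Reg 74) (Reg 72);;
    Bin 71 Add (Reg 71) (Reg 74);; Bin 72 Mul (Reg 72) (Reg 14);; Bin 58 Add (Reg 58) (Reg 14)"

text \<open>Register 53 is 1 for the first family and 0 for the second. The first family sets the
  mark and leaves the answer alone; the second adds the mark to the answer and writes it back
  unchanged.\<close>

definition cover_tail :: com where
  "cover_tail =
    Bin 75 Add (Reg 19) (Reg 71);; Load 76 (Reg 75);;
    Bin 77 Sub (Imm 1) (Reg 53);; Bin 77 And (Reg 77) (Reg 76);; Bin 0 Or (Reg 0) (Reg 77);;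
    Bin 76 Or (Reg 76) (Reg 53);; Store (Reg 75) (Reg 76)"

definition block_code :: com where
  "block_code = block_head;; For 33 43 14 select_body;; block_tail"

definition cover_code :: com where
  "cover_code = cover_head;; For 35 45 23 cover_body;; cover_tail"

definition set_code :: com where
  "set_code = set_head;; For 32 42 23 block_code;; limit_code;; For 34 44 68 cover_code"

definition search_code :: com where
  "search_code = For 30 40 15 (For 31 41 12 set_code)"

section \<open>Memory layout and the enumerated objects\<close>

definition popcount :: "nat \<Rightarrow> nat" where
  "popcount u = card (set_decode u)"

text \<open>The memory consists of six regions of \<open>Big\<close> cells, each large enough for
  any of the tables. This wastes a constant factor but reduces questions of overlap and overflow to
  linear inequalities in \<open>Big\<close>.\<close>

locale layout =
  fixes w d na n m M pw cap Big K :: nat and xs :: "nat list"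
  assumes M: "M = 2 ^ m" and K: "0 < K" and n: "na \<le> n" "length xs = n"
    and Big: "Big = M ^ K + pw * K * M + n + 3" and word: "8 * Big < 2 ^ w" "cap < 2 ^ w" "2 ^ (d + 2) < (2::nat) ^ w"
    and xs: "\<And>j. j < n \<Longrightarrow> xs ! j < M ^ K" and pw: "0 < pw"
begin

definition params :: "state \<Rightarrow> bool" where
  "params s \<longleftrightarrow> regs s 10 = d \<and> regs s 11 = na \<and> regs s 12 = n \<and> regs s 13 = m \<and> regs s 14 = M \<and>
     regs s 15 = pw \<and> regs s 16 = d + 2 \<and> regs s 17 = cap \<and> regs s 18 = Big \<and> regs s 19 = 2 * Big \<and>
     regs s 20 = 3 * Big \<and> regs s 21 = 4 * Big \<and> regs s 22 = 5 * Big \<and> regs s 23 = K \<and>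
     space_used s \<le> 6 * Big"

lemma params_set_reg [simp]: "r \<ge> 30 \<or> r = 0 \<Longrightarrow> params (set_reg r v s) = params s"
  by (auto simp: params_def)

lemma Mpos: "0 < M" using M by simp

lemma M_le: "M \<le> M ^ K" using K Mpos by (metis One_nat_def Suc_leI power_increasing power_one_right)

lemma small: "M < 2 ^ w" "K < 2 ^ w" "n < 2 ^ w" "pw < 2 ^ w" "Big < 2 ^ w" "pw * K < 2 ^ w" "pw * K * M < 2 ^ w"
  "Suc 0 < 2 ^ w" "2 < (2::nat) ^ w" "3 < (2::nat) ^ w" "M ^ K < 2 ^ w" "d + 2 < 2 ^ w"
proof -
  have "pw * K \<le> pw * K * M" using Mpos by simp
  moreover have "K \<le> pw * K" "pw \<le> pw * K" using K pw by simp_all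
  moreover have "d + 2 < 2 ^ (d + 2)" by (rule less_exp)
  ultimately show "M < 2 ^ w" "K < 2 ^ w" "n < 2 ^ w" "pw < 2 ^ w" "Big < 2 ^ w" "pw * K < 2 ^ w" "pw * K * M < 2 ^ w"
    "Suc 0 < 2 ^ w" "2 < (2::nat) ^ w" "3 < (2::nat) ^ w" "M ^ K < 2 ^ w" "d + 2 < 2 ^ w"
    using M_le word Big by linarith+
qed

lemma of_bool_mod: "of_bool b mod 2 ^ w = (of_bool b :: nat)"
  using mod_less[OF small(8)] by (cases b) simp_all

lemma one_mod: "1 mod 2 ^ w = (1::nat)" "Suc 0 mod 2 ^ w = Suc 0"
  using mod_less[OF small(8)] by simp_all

lemma wpos [simp]: "0 < w"
  using small(8) by (cases w) simp_all

lemma index_bounds: "K * M \<le> pw * K * M" "pw * K * M + 3 \<le> Big" "M ^ K + 3 \<le> Big" "M + 3 \<le> Big" "K + 3 \<le> Big" "n + 3 \<le> Big"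
proof -
  show 1: "K * M \<le> pw * K * M" using pw by simp
  have "K \<le> K * M" using Mpos by simp
  then show "pw * K * M + 3 \<le> Big" "M ^ K + 3 \<le> Big" "M + 3 \<le> Big" "K + 3 \<le> Big" "n + 3 \<le> Big"
    using 1 Big M_le by linarith+
qed

definition part :: "nat \<Rightarrow> nat \<Rightarrow> nat" where
  "part j i = (xs ! j div M ^ i) mod M"

definition digit :: "nat \<Rightarrow> nat \<Rightarrow> nat" where
  "digit it i = (it div (d + 2) ^ i) mod (d + 2)"

text \<open>
  Digits \<open>2 * i\<close> and \<open>2 * i + 1\<close> of the round number are the guesses for the size of the cover in block \<open>i\<close>
  and for the (logarithm of the) density of the random family there.
\<close>

definition sel :: "(nat \<Rightarrow> nat) \<Rightarrow> nat \<Rightarrow> nat \<Rightarrow> nat \<Rightarrow> nat \<Rightarrow> bool" where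
  "sel Z it j i u \<longleftrightarrow> land (part j i) u = part j i * of_bool (j < na) \<and>
     popcount u = digit it (2 * i) \<and> Z ((it * K + i) * M + u) < 2 ^ digit it (2 * i + 1)"

definition cands :: "(nat \<Rightarrow> nat) \<Rightarrow> nat \<Rightarrow> nat \<Rightarrow> nat \<Rightarrow> nat list" where
  "cands Z it j i = filter (sel Z it j i) [0..<M]"

definition tuples :: "(nat \<Rightarrow> nat) \<Rightarrow> nat \<Rightarrow> nat \<Rightarrow> nat \<Rightarrow> nat" where
  "tuples Z it j i = (\<Prod>k<i. length (cands Z it j k))"

text \<open>\<open>t\<close> is read in mixed radix: digit \<open>k\<close> has base
  \<open>length (cands Z it j k)\<close> and place value \<open>tuples Z it j k\<close>. Thus a
  single counter runs through all combinations of candidates.\<close>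

definition cover :: "(nat \<Rightarrow> nat) \<Rightarrow> nat \<Rightarrow> nat \<Rightarrow> nat \<Rightarrow> nat \<Rightarrow> nat" where
  "cover Z it j t i = (\<Sum>k<i. cands Z it j k ! ((t div tuples Z it j k) mod length (cands Z it j k)) * M ^ k)"

definition limit :: "(nat \<Rightarrow> nat) \<Rightarrow> nat \<Rightarrow> nat \<Rightarrow> nat" where
  "limit Z it j = min (tuples Z it j K) cap"

lemma length_cands_le: "length (cands Z it j i) \<le> M"
  unfolding cands_def by (metis length_filter_le length_upt minus_nat.diff_0)

lemma cands_less: "p < length (cands Z it j i) \<Longrightarrow> cands Z it j i ! p < M"
  unfolding cands_def by (metis atLeastLessThan_iff filter_is_subset nth_mem set_upt subsetD)

lemma tuples_le: "tuples Z it j i \<le> M ^ i"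
proof -
  have "tuples Z it j i \<le> (\<Prod>k<i. M)" unfolding tuples_def by (intro prod_mono) (simp add: length_cands_le)
  then show ?thesis by simp
qed

definition tables :: "(nat \<Rightarrow> nat) \<Rightarrow> (nat \<Rightarrow> nat) \<Rightarrow> bool" where
  "tables Z g \<longleftrightarrow> (\<forall>j<n. g (3 + j) = xs ! j) \<and> (\<forall>u<M. g (Big + u) = popcount u) \<and>
     (\<forall>x<pw * K * M. g (3 * Big + x) = Z x)"

definition lists :: "(nat \<Rightarrow> nat) \<Rightarrow> nat \<Rightarrow> nat \<Rightarrow> nat \<Rightarrow> (nat \<Rightarrow> nat) \<Rightarrow> bool" where
  "lists Z it j i g \<longleftrightarrow> (\<forall>k<i. g (5 * Big + k) = length (cands Z it j k) \<and>
     (\<forall>p<length (cands Z it j k). g (4 * Big + (k * M + p)) = cands Z it j k ! p))"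

text \<open>Only the cells below \<open>4 * Big\<close> are frozen: the candidate lists and their
  lengths lie above and are rewritten for every set.\<close>

definition ctx :: "nat \<Rightarrow> nat \<Rightarrow> nat \<Rightarrow> (nat \<Rightarrow> nat) \<Rightarrow> state \<Rightarrow> bool" where
  "ctx it j f g s \<longleftrightarrow> params s \<and> regs s 30 = it \<and> regs s 31 = j \<and> regs s 0 = f \<and> regs s 53 = of_bool (j < na) \<and>
     (\<forall>a<4 * Big. mem s a = g a)"

lemma ctx_set_reg [simp]: "r \<ge> 32 \<and> r \<noteq> 53 \<Longrightarrow> ctx it j f g (set_reg r v s) = ctx it j f g s"
  by (auto simp: ctx_def)

text \<open>Registers 54 and 55 have already moved past block \<open>i\<close>; what belongs to this
  block sits in registers 59 to 62.\<close>

definition select_inv where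
  "select_inv Z it j f g i u s \<longleftrightarrow> ctx it j f g s \<and> lists Z it j i (mem s) \<and> regs s 32 = i \<and>
     regs s 54 = xs ! j div M ^ Suc i \<and> regs s 55 = it div (d + 2) ^ (2 * Suc i) \<and> regs s 56 = tuples Z it j i \<and>
     regs s 57 = 3 * Big + (it * K + i) * M \<and> regs s 58 = 4 * Big + i * M \<and>
     regs s 59 = digit it (2 * i) \<and> regs s 60 = 2 ^ digit it (2 * i + 1) \<and> regs s 61 = part j i \<and>
     regs s 62 = part j i * of_bool (j < na) \<and>
     regs s 63 = length (filter (sel Z it j i) [0..<u]) \<and>
     (\<forall>p<length (filter (sel Z it j i) [0..<u]). mem s (4 * Big + (i * M + p)) = filter (sel Z it j i) [0..<u] ! p)"

lemma cell_index:
  assumes "i < k" "p < M"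
  shows "i * M + p < k * M"
proof -
  have "i * M + p < Suc i * M" using assms by simp
  also have "\<dots> \<le> k * M" using assms by (intro mult_right_mono) auto
  finally show ?thesis .
qed

lemma random_index:
  assumes "it < pw" "i < K" "u < M"
  shows "(it * K + i) * M + u < pw * K * M"
proof -
  have "it * K + i < Suc it * K" using assms by simp
  also have "\<dots> \<le> pw * K" using assms by (intro mult_right_mono) auto
  finally show ?thesis by (rule cell_index) (use assms in auto)
qed

lemma select_step:
  assumes it: "it < pw" and j: "j < n" and i: "i < K" and u: "u < M" and g: "tables Z g"
  shows "hoare w (\<lambda>s. select_inv Z it j f g i u s \<and> regs s 33 = u \<and> regs s 14 = M) select_body 25
     (\<lambda>s. select_inv Z it j f g i (Suc u) s \<and> regs s 33 = u \<and> regs s 14 = M)"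
proof (rule hoare_straight_le)
  show "straight select_body" "straight_time select_body \<le> 25" by (simp_all add: select_body_def)
next
  fix s
  let ?L = "filter (sel Z it j i) [0..<u]"
  assume a: "select_inv Z it j f g i u s \<and> regs s 33 = u \<and> regs s 14 = M"
  have len: "length ?L \<le> u" by (metis length_filter_le length_upt minus_nat.diff_0)
  define s' where "s' = eval_straight w select_body s"
  have pM: "part j i < M" using Mpos by (simp add: part_def)
  have idx: "i * M + length ?L < K * M" using i u len by (intro cell_index) auto
  note B = index_bounds word small
  have addr: "3 * Big + (it * K + i) * M + u < 4 * Big"
    using random_index[OF it i u] B by linarith
  have r: "regs s 18 = Big" "regs s 61 = part j i" "regs s 33 = u" "regs s 62 = part j i * of_bool (j < na)"
    "regs s 59 = digit it (2 * i)" "regs s 60 = 2 ^ digit it (2 * i + 1)" "regs s 63 = length ?L"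
    "regs s 57 = 3 * Big + (it * K + i) * M" "regs s 58 = 4 * Big + i * M"
    and sp: "space_used s \<le> 6 * Big"
    and frame: "\<forall>a<4 * Big. mem s a = g a" and prev: "lists Z it j i (mem s)"
    and cur: "\<forall>p<length ?L. mem s (4 * Big + (i * M + p)) = ?L ! p"
    using a by (auto simp: select_inv_def ctx_def params_def)
  have top: "4 * Big + i * M + length ?L < 2 ^ w" using idx B by linarith
  have mods: "(Big + u) mod 2 ^ w = Big + u" "(3 * Big + (it * K + i) * M + u) mod 2 ^ w = 3 * Big + (it * K + i) * M + u"
    "(4 * Big + i * M + length ?L) mod 2 ^ w = 4 * Big + i * M + length ?L"
    "land (part j i) u mod 2 ^ w = land (part j i) u"
    using u addr top pM B by (auto intro!: mod_less and_mod_word)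
  note bmod = of_bool_mod
  have lmod: "(length ?L + of_bool b) mod 2 ^ w = length ?L + of_bool b" for b
    using len u B by (intro mod_less) (cases b; simp)
  have vals: "mem s (Big + u) = popcount u" "mem s (3 * Big + (it * K + i) * M + u) = Z ((it * K + i) * M + u)"
    using frame g u addr random_index[OF it i u] B by (auto simp: tables_def add.assoc)
  let ?b = "sel Z it j i u"
  have regs': "regs s' r = (if r = 63 then length ?L + of_bool ?b else regs s r)"
      if "r \<notin> {64, 65, 66, 67}" for r
    unfolding s'_def select_body_def using that
    by (simp add: r mods vals bmod lmod sel_def flip: of_bool_conj)
  \<comment> \<open>The word \<open>u\<close> is stored behind the list unconditionally. It becomes
    an entry only if the length in register 63 grows.\<close>
  have mem': "mem s' = (mem s)(4 * Big + (i * M + length ?L) := u)"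
    unfolding s'_def select_body_def by (simp add: r mods mods(3)[unfolded add.assoc] vals bmod lmod add.assoc)
  have "i * M + length ?L < Big" using idx B by linarith
  then have sp': "space_used s' \<le> 6 * Big"
    unfolding s'_def select_body_def using sp addr u index_bounds
    by (simp add: r mods vals bmod lmod)
  have "params s'" using a sp' by (simp add: regs' params_def select_inv_def ctx_def)
  moreover have "\<forall>a<4 * Big. mem s' a = g a" using frame by (simp add: mem')
  ultimately have "ctx it j f g s'" using a by (simp add: regs' ctx_def select_inv_def)
  moreover have "lists Z it j i (mem s')"
    unfolding lists_def
  proof (intro allI impI conjI)
    fix k assume k: "k < i"
    have "i * M + length ?L < Big" using idx B by linarith
    then show "mem s' (5 * Big + k) = length (cands Z it j k)"
      using prev k by (simp add: mem' lists_def)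
    fix p assume p: "p < length (cands Z it j k)"
    then have "k * M + p < i * M" using k length_cands_le[of Z it j k] by (intro cell_index) auto
    then show "mem s' (4 * Big + (k * M + p)) = cands Z it j k ! p"
      using prev k p by (simp add: mem' lists_def)
  qed
  moreover have "filter (sel Z it j i) [0..<Suc u] = ?L @ (if ?b then [u] else [])" by simp
  then have "length (filter (sel Z it j i) [0..<Suc u]) = length ?L + of_bool ?b"
    "\<forall>p<length (filter (sel Z it j i) [0..<Suc u]). mem s' (4 * Big + (i * M + p)) = filter (sel Z it j i) [0..<Suc u] ! p"
    using cur by (auto simp: mem' nth_append less_Suc_eq)
  ultimately show "select_inv Z it j f g i (Suc u) s' \<and> regs s' 33 = u \<and> regs s' 14 = M"
    using a by (simp add: regs' select_inv_def del: filter.simps upt_Suc)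
qed

definition block_inv where
  "block_inv Z it j f g i s \<longleftrightarrow> ctx it j f g s \<and> lists Z it j i (mem s) \<and>
     regs s 54 = xs ! j div M ^ i \<and> regs s 55 = it div (d + 2) ^ (2 * i) \<and> regs s 56 = tuples Z it j i \<and>
     regs s 57 = 3 * Big + (it * K + i) * M \<and> regs s 58 = 4 * Big + i * M"

lemma select_inv_set_reg:
  "r = 33 \<or> r = 43 \<Longrightarrow> select_inv Z it j f g i u (set_reg r v s) = select_inv Z it j f g i u s"
  unfolding select_inv_def by (elim disjE) simp_all

lemma block_inv_set_reg:
  "r = 32 \<or> r = 42 \<Longrightarrow> block_inv Z it j f g i (set_reg r v s) = block_inv Z it j f g i s"
  unfolding block_inv_def by (elim disjE) simp_all

lemma digit_less: "digit it i < d + 2"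
  by (simp add: digit_def)

lemma part_less: "part j i < M"
  using Mpos by (simp add: part_def)

lemma set_less: "j < n \<Longrightarrow> xs ! j < 2 ^ w"
  using xs[of j] small by simp

lemma block_step:
  assumes it: "it < pw" and j: "j < n" and i: "i < K" and g: "tables Z g"
  shows "hoare w (\<lambda>s. block_inv Z it j f g i s \<and> regs s 32 = i \<and> regs s 23 = K) block_code (M * 31 + 34)
     (\<lambda>s. block_inv Z it j f g (Suc i) s \<and> regs s 32 = i \<and> regs s 23 = K)"
proof -
  note B = index_bounds word small
  have head: "hoare w (\<lambda>s. block_inv Z it j f g i s \<and> regs s 32 = i \<and> regs s 23 = K) block_head 17
      (\<lambda>s. select_inv Z it j f g i 0 s \<and> regs s 14 = M)"
  proof (rule hoare_straight_le)
    show "straight block_head" "straight_time block_head \<le> 17" by (simp_all add: block_head_def)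
  next
    fix s assume a: "block_inv Z it j f g i s \<and> regs s 32 = i \<and> regs s 23 = K"
    define s' where "s' = eval_straight w block_head s"
    have r: "regs s 54 = xs ! j div M ^ i" "regs s 55 = it div (d + 2) ^ (2 * i)" "regs s 16 = d + 2"
        "regs s 14 = M" "regs s 53 = of_bool (j < na)"
      using a by (auto simp: block_inv_def ctx_def params_def)
    have q: "2 ^ digit it k < (2::nat) ^ w" "digit it k < 2 ^ w" for k
    proof -
      have "(2::nat) ^ digit it k \<le> 2 ^ (d + 2)" using digit_less[of it k] by (intro power_increasing) auto
      then show *: "2 ^ digit it k < (2::nat) ^ w" using word by linarith
      have "digit it k < 2 ^ digit it k" by (rule less_exp)
      then show "digit it k < 2 ^ w" using * by linarith
    qed
    have lt: "x div y < 2 ^ w" if "x < 2 ^ w" for x y :: nat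
      using that div_le_dividend[of x y] by linarith
    have itw: "it < 2 ^ w" using it small by linarith
    have divs: "it div (d + 2) ^ (2 * i) mod (d + 2) mod 2 ^ w = digit it (2 * i)"
      "it div (d + 2) ^ (2 * i) div (d + 2) mod 2 ^ w = it div (d + 2) ^ (2 * i + 1)"
      "it div (d + 2) ^ (2 * i + 1) mod (d + 2) mod 2 ^ w = digit it (2 * i + 1)"
      "it div (d + 2) ^ (2 * i + 1) div (d + 2) mod 2 ^ w = it div (d + 2) ^ (2 * Suc i)"
      "xs ! j div M ^ i mod M mod 2 ^ w = part j i"
      "xs ! j div M ^ i div M mod 2 ^ w = xs ! j div M ^ Suc i"
      "2 ^ digit it (2 * i + 1) mod 2 ^ w = (2::nat) ^ digit it (2 * i + 1)"
      "part j i * of_bool (j < na) mod 2 ^ w = part j i * of_bool (j < na)"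
    proof -
      have e: "x div y ^ k div y = x div y ^ Suc k" for x y k :: nat
        by (simp only: power_Suc2 div_mult2_eq)
      have o: "2 * i + 1 = Suc (2 * i)" "2 * Suc i = Suc (Suc (2 * i))" by simp_all
      show "it div (d + 2) ^ (2 * i) mod (d + 2) mod 2 ^ w = digit it (2 * i)"
        "it div (d + 2) ^ (2 * i + 1) mod (d + 2) mod 2 ^ w = digit it (2 * i + 1)"
        "2 ^ digit it (2 * i + 1) mod 2 ^ w = (2::nat) ^ digit it (2 * i + 1)"
        unfolding digit_def[symmetric] using q by (simp_all only: mod_less)
      show "it div (d + 2) ^ (2 * i) div (d + 2) mod 2 ^ w = it div (d + 2) ^ (2 * i + 1)"
        "it div (d + 2) ^ (2 * i + 1) div (d + 2) mod 2 ^ w = it div (d + 2) ^ (2 * Suc i)"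
        "xs ! j div M ^ i div M mod 2 ^ w = xs ! j div M ^ Suc i"
        unfolding o e using lt[OF itw] lt[OF set_less[OF j]] by (simp_all only: mod_less)
      have p: "part j i < 2 ^ w" using part_less[of j i] small by linarith
      then show "xs ! j div M ^ i mod M mod 2 ^ w = part j i" unfolding part_def by (rule mod_less)
      show "part j i * of_bool (j < na) mod 2 ^ w = part j i * of_bool (j < na)"
        using p by (cases "j < na") simp_all
    qed
    have regs': "regs s' 59 = digit it (2 * i)" "regs s' 60 = 2 ^ digit it (2 * i + 1)" "regs s' 61 = part j i"
      "regs s' 54 = xs ! j div M ^ Suc i" "regs s' 55 = it div (d + 2) ^ (2 * Suc i)"
      "regs s' 62 = part j i * of_bool (j < na)" "regs s' 63 = 0"
      "\<And>r. r \<notin> {54, 55, 59, 60, 61, 62, 63} \<Longrightarrow> regs s' r = regs s r"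
      and mem': "mem s' = mem s" and sp': "space_used s' = space_used s"
      unfolding s'_def block_head_def
      by (simp_all add: r divs[simplified] one_mod push_bit_eq_mult)
    have "ctx it j f g s'" using a by (simp add: ctx_def params_def regs' mem' sp' block_inv_def)
    then show "select_inv Z it j f g i 0 s' \<and> regs s' 14 = M"
      using a by (simp add: select_inv_def block_inv_def regs' mem' r)
  qed
  have loop: "hoare w (\<lambda>s. select_inv Z it j f g i 0 s \<and> regs s 14 = M) (For 33 43 14 select_body) (M * (25 + 6) + 6)
      (\<lambda>s. select_inv Z it j f g i M s \<and> regs s 14 = M)"
    by (rule hoare_For) (use select_step[OF it j i _ g] small in \<open>auto simp: select_inv_set_reg\<close>)
  have tail: "hoare w (\<lambda>s. select_inv Z it j f g i M s \<and> regs s 14 = M) block_tail 9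
      (\<lambda>s. block_inv Z it j f g (Suc i) s \<and> regs s 32 = i \<and> regs s 23 = K)"
  proof (rule hoare_straight_le)
    show "straight block_tail" "straight_time block_tail \<le> 9" by (simp_all add: block_tail_def)
  next
    fix s assume a: "select_inv Z it j f g i M s \<and> regs s 14 = M"
    define s' where "s' = eval_straight w block_tail s"
    let ?l = "length (cands Z it j i)"
    have r: "regs s 22 = 5 * Big" "regs s 32 = i" "regs s 63 = ?l" "regs s 56 = tuples Z it j i"
        "regs s 57 = 3 * Big + (it * K + i) * M" "regs s 58 = 4 * Big + i * M" "regs s 14 = M"
        and sp: "space_used s \<le> 6 * Big"
        and cur: "\<forall>p<?l. mem s (4 * Big + (i * M + p)) = cands Z it j i ! p"
      using a by (auto simp: select_inv_def ctx_def params_def cands_def)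
    have t: "tuples Z it j i * ?l = tuples Z it j (Suc i)" by (simp add: tuples_def)
    \<comment> \<open>The cap is applied only after all blocks, so the uncapped product has to fit
      into a word.\<close>
    have "tuples Z it j (Suc i) \<le> M ^ K"
    proof -
      have "M ^ Suc i \<le> M ^ K" using i Mpos by (intro power_increasing) auto
      then show ?thesis using tuples_le[of Z it j "Suc i"] by linarith
    qed
    then have m1: "tuples Z it j (Suc i) mod 2 ^ w = tuples Z it j (Suc i)" using small(11) by (intro mod_less) linarith
    have "(it * K + i) * M + M \<le> pw * K * M"
    proof -
      have "it * K + Suc i \<le> Suc it * K" using i by simp
      also have "\<dots> \<le> pw * K" using it by (intro mult_right_mono) auto
      finally show ?thesis using mult_right_mono[of "it * K + Suc i" "pw * K" M] by (simp add: algebra_simps)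
    qed
    then have m2: "(3 * Big + (it * K + i) * M + M) mod 2 ^ w = 3 * Big + (it * K + i) * M + M"
      using B(2,7) by (intro mod_less) linarith
    have "i * M + M \<le> K * M" using i mult_right_mono[of "Suc i" K M] by simp
    then have m3: "(4 * Big + i * M + M) mod 2 ^ w = 4 * Big + i * M + M"
      using B(1,2,7) by (intro mod_less) linarith
    have m4: "(5 * Big + i) mod 2 ^ w = 5 * Big + i" using i B(5,7) by (intro mod_less) linarith
    note mods = m1 m2 m3 m4
    have regs': "regs s' 56 = tuples Z it j (Suc i)" "regs s' 57 = 3 * Big + (it * K + i) * M + M"
      "regs s' 58 = 4 * Big + i * M + M" "\<And>r. r \<notin> {56, 57, 58, 67} \<Longrightarrow> regs s' r = regs s r"
      and mem': "mem s' = (mem s)(5 * Big + i := ?l)"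
      unfolding s'_def block_tail_def by (simp_all add: r mods t)
    have sp': "space_used s' \<le> 6 * Big"
      unfolding s'_def block_tail_def using sp i B by (simp add: r mods t)
    have C: "ctx it j f g s'" using a sp' by (simp add: ctx_def params_def regs' mem' select_inv_def)
    have L: "lists Z it j (Suc i) (mem s')"
      unfolding lists_def
    proof (intro allI impI conjI)
      fix k assume k: "k < Suc i"
      show "mem s' (5 * Big + k) = length (cands Z it j k)"
        using a k by (auto simp: mem' lists_def select_inv_def less_Suc_eq)
      fix p assume p: "p < length (cands Z it j k)"
      then have "k * M + p < K * M" using k i length_cands_le[of Z it j k] by (intro cell_index) auto
      then have "4 * Big + (k * M + p) < 5 * Big" using B by linarith
      then show "mem s' (4 * Big + (k * M + p)) = cands Z it j k ! p"
        using a cur k p by (auto simp: mem' lists_def select_inv_def less_Suc_eq)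
    qed
    show "block_inv Z it j f g (Suc i) s' \<and> regs s' 32 = i \<and> regs s' 23 = K"
    proof -
      have "3 * Big + (it * K + i) * M + M = 3 * Big + (it * K + Suc i) * M" "4 * Big + i * M + M = 4 * Big + Suc i * M"
        by simp_all
      note e = this
      have k: "regs s' 54 = regs s 54" "regs s' 55 = regs s 55" "regs s' 32 = regs s 32" "regs s' 23 = regs s 23"
        by (simp_all add: regs'(4))
      have b: "regs s 54 = xs ! j div M ^ Suc i" "regs s 55 = it div (d + 2) ^ (2 * Suc i)" "regs s 32 = i" "regs s 23 = K"
        using a unfolding select_inv_def ctx_def params_def by blast+
      show ?thesis unfolding block_inv_def k b regs'(1-3) e using C L by blast
    qed
  qed
  show ?thesis unfolding block_code_def
    by (rule hoare_conseq[OF hoare_Seq[OF head hoare_Seq[OF loop tail]]]) auto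
qed

end

section \<open>Enumeration of covers and the search loop\<close>

context layout begin

text \<open>One empty list makes the product zero and hence the enumeration empty, so the decoding
  of \<open>t\<close> never divides by a list length 0.\<close>

lemma cands_nonempty: "t < tuples Z it j K \<Longrightarrow> i < K \<Longrightarrow> length (cands Z it j i) \<noteq> 0"
proof
  assume "t < tuples Z it j K" "i < K" "length (cands Z it j i) = 0"
  moreover from this have "tuples Z it j K = 0" unfolding tuples_def by (intro prod_zero) auto
  ultimately show False by simp
qed

lemma cover_less:
  assumes "t < tuples Z it j K" "i \<le> K"
  shows "cover Z it j t i < M ^ i"
  using assms(2)
proof (induction i)
  case 0
  then show ?case by (simp add: cover_def)
next
  case (Suc i)
  have "length (cands Z it j i) \<noteq> 0"
    using cands_nonempty[OF assms(1)] Suc.prems by simp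
  then have "cands Z it j i ! ((t div tuples Z it j i) mod length (cands Z it j i)) < M"
    by (intro cands_less) simp
  then have "cands Z it j i ! ((t div tuples Z it j i) mod length (cands Z it j i)) * M ^ i \<le> (M - 1) * M ^ i"
    by (intro mult_right_mono) auto
  moreover have "cover Z it j t i < M ^ i" using Suc by simp
  moreover have "(M - 1) * M ^ i + M ^ i = M ^ Suc i" using Mpos by (cases M) auto
  moreover have "cover Z it j t (Suc i) = cover Z it j t i +
      cands Z it j i ! ((t div tuples Z it j i) mod length (cands Z it j i)) * M ^ i"
    by (simp add: cover_def)
  ultimately show ?case by linarith
qed

definition marks :: "nat set \<Rightarrow> (nat \<Rightarrow> nat) \<Rightarrow> bool" where
  "marks S g \<longleftrightarrow> (\<forall>F<M ^ K. g (2 * Big + F) = of_bool (F \<in> S))"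

definition covers :: "(nat \<Rightarrow> nat) \<Rightarrow> nat \<Rightarrow> nat \<Rightarrow> nat \<Rightarrow> nat set" where
  "covers Z it j t = (\<lambda>t. cover Z it j t K) ` {..<t}"

text \<open>The frame leaves out exactly the region of the marks. A set of the first family enlarges
  the marks; for one of the second they stay fixed while register 0 collects the hits.\<close>

definition cover_inv where
  "cover_inv Z it j h S f t s \<longleftrightarrow> params s \<and> regs s 30 = it \<and> regs s 31 = j \<and> regs s 53 = of_bool (j < na) \<and>
     (\<forall>a. a < 2 * Big \<or> 3 * Big \<le> a \<longrightarrow> mem s a = h a) \<and>
     marks (if j < na then S \<union> covers Z it j t else S) (mem s) \<and>
     regs s 0 = of_bool (f \<or> \<not> j < na \<and> S \<inter> covers Z it j t \<noteq> {})"

definition decode_inv where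
  "decode_inv Z it j h S f t N i s \<longleftrightarrow> cover_inv Z it j h S f t s \<and> regs s 34 = t \<and> regs s 68 = N \<and>
     regs s 70 = t div tuples Z it j i \<and> regs s 71 = cover Z it j t i \<and> regs s 72 = M ^ i \<and> regs s 58 = 4 * Big + i * M"

lemma cover_inv_set_reg:
  "r \<ge> 32 \<and> r \<noteq> 53 \<Longrightarrow> cover_inv Z it j h S f t (set_reg r v s) = cover_inv Z it j h S f t s"
  by (auto simp: cover_inv_def)

lemma decode_inv_set_reg:
  "r = 35 \<or> r = 45 \<Longrightarrow> decode_inv Z it j h S f t N i (set_reg r v s) = decode_inv Z it j h S f t N i s"
  by (auto simp: decode_inv_def cover_inv_set_reg)

lemma decode_step:
  assumes i: "i < K" and t: "t < tuples Z it j K" "t < cap" and h: "lists Z it j K h"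
  shows "hoare w (\<lambda>s. decode_inv Z it j h S f t N i s \<and> regs s 35 = i \<and> regs s 23 = K) cover_body 19
    (\<lambda>s. decode_inv Z it j h S f t N (Suc i) s \<and> regs s 35 = i \<and> regs s 23 = K)"
proof (rule hoare_straight_le)
  show "straight cover_body" "straight_time cover_body \<le> 19" by (simp_all add: cover_body_def)
next
  fix s
  let ?l = "length (cands Z it j i)"
  let ?T = "tuples Z it j i"
  let ?p = "(t div ?T) mod ?l"
  let ?e = "cands Z it j i ! ?p"
  assume a: "decode_inv Z it j h S f t N i s \<and> regs s 35 = i \<and> regs s 23 = K"
  define s' where "s' = eval_straight w cover_body s"
  have r: "regs s 22 = 5 * Big" "regs s 35 = i" "regs s 70 = t div ?T" "regs s 71 = cover Z it j t i" "regs s 72 = M ^ i"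
    "regs s 58 = 4 * Big + i * M" "regs s 14 = M"
    and sp: "space_used s \<le> 6 * Big" and fr: "\<forall>a. a < 2 * Big \<or> 3 * Big \<le> a \<longrightarrow> mem s a = h a"
    using a by (auto simp: decode_inv_def cover_inv_def params_def)
  have "?l \<noteq> 0"
    by (rule cands_nonempty[OF t(1) i])
  then have p: "?p < ?l" by simp
  then have e: "?e < M" by (rule cands_less)
  have pM: "?p < M" using p length_cands_le[of Z it j i] by linarith
  have idx: "i * M + ?p < K * M" by (rule cell_index[OF i pM])
  have next_idx: "i * M + M \<le> K * M" using i mult_right_mono[of "Suc i" K M] by simp
  have cov: "cover Z it j t (Suc i) < M ^ Suc i" by (rule cover_less[OF t(1)]) (use i in simp)
  have MK: "M ^ Suc i \<le> M ^ K" using i Mpos by (intro power_increasing) auto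
  have cs: "cover Z it j t (Suc i) = cover Z it j t i + ?e * M ^ i" by (simp add: cover_def)
  have tw: "t div ?T < 2 ^ w" using t(2) word(2) div_le_dividend[of t ?T] by linarith
  have Td: "t div ?T div ?l = t div tuples Z it j (Suc i)"
    by (simp add: tuples_def div_mult2_eq)
  note B = index_bounds word(1)
  have mods: "(5 * Big + i) mod 2 ^ w = 5 * Big + i" "?p mod 2 ^ w = ?p" "t div tuples Z it j (Suc i) mod 2 ^ w = t div tuples Z it j (Suc i)"
    "(?p + (4 * Big + i * M)) mod 2 ^ w = ?p + (4 * Big + i * M)"
    "(?e * M ^ i) mod 2 ^ w = ?e * M ^ i" "(cover Z it j t i + ?e * M ^ i) mod 2 ^ w = cover Z it j t (Suc i)"
    "(M ^ i * M) mod 2 ^ w = M ^ Suc i" "(4 * Big + i * M + M) mod 2 ^ w = 4 * Big + i * M + M"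
  proof -
    have lt: "M ^ Suc i < 2 ^ w" using MK small(11) by linarith
    show "(5 * Big + i) mod 2 ^ w = 5 * Big + i" using i B by (intro mod_less) linarith
    show "?p mod 2 ^ w = ?p" using pM small(1) by (intro mod_less) linarith
    show "t div tuples Z it j (Suc i) mod 2 ^ w = t div tuples Z it j (Suc i)"
      using t(2) word(2) div_le_dividend[of t "tuples Z it j (Suc i)"] by (intro mod_less) linarith
    show "(?p + (4 * Big + i * M)) mod 2 ^ w = ?p + (4 * Big + i * M)" using idx B by (intro mod_less) linarith
    show "(?e * M ^ i) mod 2 ^ w = ?e * M ^ i" using cs cov lt by (intro mod_less) linarith
    show "(cover Z it j t i + ?e * M ^ i) mod 2 ^ w = cover Z it j t (Suc i)"
      unfolding cs[symmetric] using cov lt by (intro mod_less) linarith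
    show "(M ^ i * M) mod 2 ^ w = M ^ Suc i" using lt by (simp only: power_Suc2 mod_less)
    show "(4 * Big + i * M + M) mod 2 ^ w = 4 * Big + i * M + M" using next_idx B by (intro mod_less) linarith
  qed
  have m1: "mem s (5 * Big + i) = ?l" using fr h i by (simp add: lists_def)
  have m2: "mem s (?p + (4 * Big + i * M)) = ?e"
  proof -
    have "?p + (4 * Big + i * M) = 4 * Big + (i * M + ?p)" by simp
    then have "mem s (?p + (4 * Big + i * M)) = h (4 * Big + (i * M + ?p))"
      using fr by (simp only:) simp
    then show ?thesis using h i p by (simp add: lists_def)
  qed
  have regs': "regs s' 70 = t div tuples Z it j (Suc i)" "regs s' 71 = cover Z it j t (Suc i)"
     "regs s' 72 = M ^ Suc i" "regs s' 58 = 4 * Big + i * M + M"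
     "\<And>r. r \<notin> {58, 67, 70, 71, 72, 73, 74} \<Longrightarrow> regs s' r = regs s r"
    and mem': "mem s' = mem s"
    unfolding s'_def cover_body_def by (simp_all add: r mods m1 m2 Td del: power_Suc)
  have sp': "space_used s' \<le> 6 * Big"
  proof -
    have "Suc (?p + (4 * Big + i * M)) \<le> 6 * Big" "Suc (5 * Big + i) \<le> 6 * Big" using idx i B by linarith+
    then show ?thesis
      unfolding s'_def cover_body_def using sp by (simp add: r mods m1 m2 Td del: power_Suc)
  qed
  have "cover_inv Z it j h S f t s'"
    using a sp' by (simp add: decode_inv_def cover_inv_def params_def regs' mem')
  then show "decode_inv Z it j h S f t N (Suc i) s' \<and> regs s' 35 = i \<and> regs s' 23 = K"
    using a by (simp add: decode_inv_def regs' algebra_simps del: power_Suc)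
qed

lemma cover_step:
  assumes t: "t < limit Z it j" and h: "lists Z it j K h"
  shows "hoare w (\<lambda>s. cover_inv Z it j h S f t s \<and> regs s 34 = t \<and> regs s 68 = limit Z it j) cover_code (K * 25 + 28)
    (\<lambda>s. cover_inv Z it j h S f (Suc t) s \<and> regs s 34 = t \<and> regs s 68 = limit Z it j)"
proof -
  let ?N = "limit Z it j"
  have t': "t < tuples Z it j K" "t < cap" using t by (auto simp: limit_def)
  note B = index_bounds word(1)
  have head: "hoare w (\<lambda>s. cover_inv Z it j h S f t s \<and> regs s 34 = t \<and> regs s 68 = ?N) cover_head 7
     (\<lambda>s. decode_inv Z it j h S f t ?N 0 s \<and> regs s 23 = K)"
  proof (rule hoare_straight_le)
    show "straight cover_head" "straight_time cover_head \<le> 7" by (simp_all add: cover_head_def)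
  next
    fix s assume a: "cover_inv Z it j h S f t s \<and> regs s 34 = t \<and> regs s 68 = ?N"
    then have r: "regs s 21 = 4 * Big" "regs s 34 = t" "regs s 23 = K" by (auto simp: cover_inv_def params_def)
    have m: "t mod 2 ^ w = t" "(4 * Big) mod 2 ^ w = 4 * Big" using t'(2) word B by (auto intro!: mod_less)
    have "cover_inv Z it j h S f t (eval_straight w cover_head s)"
      using a unfolding cover_head_def by (simp add: cover_inv_set_reg)
    then show "decode_inv Z it j h S f t ?N 0 (eval_straight w cover_head s) \<and> regs (eval_straight w cover_head s) 23 = K"
      using a by (simp add: decode_inv_def cover_head_def r m one_mod cover_def tuples_def)
  qed
  have loop: "hoare w (\<lambda>s. decode_inv Z it j h S f t ?N 0 s \<and> regs s 23 = K) (For 35 45 23 cover_body) (K * (19 + 6) + 6)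
     (\<lambda>s. decode_inv Z it j h S f t ?N K s \<and> regs s 23 = K)"
    by (rule hoare_For) (use decode_step[OF _ t' h] small in \<open>auto simp: decode_inv_set_reg\<close>)
  have tail: "hoare w (\<lambda>s. decode_inv Z it j h S f t ?N K s \<and> regs s 23 = K) cover_tail 13
    (\<lambda>s. cover_inv Z it j h S f (Suc t) s \<and> regs s 34 = t \<and> regs s 68 = ?N)"
  proof (rule hoare_straight_le)
    show "straight cover_tail" "straight_time cover_tail \<le> 13" by (simp_all add: cover_tail_def)
  next
    fix s assume a: "decode_inv Z it j h S f t ?N K s \<and> regs s 23 = K"
    define s' where "s' = eval_straight w cover_tail s"
    define F where "F = cover Z it j t K"
    define S' where "S' = (if j < na then S \<union> covers Z it j t else S)"
    define f' where "f' = (f \<or> \<not> j < na \<and> S \<inter> covers Z it j t \<noteq> {})"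
    have r: "regs s 19 = 2 * Big" "regs s 71 = F" "regs s 53 = of_bool (j < na)" "regs s 0 = of_bool f'"
      and mk: "marks S' (mem s)" and sp: "space_used s \<le> 6 * Big"
      using a by (auto simp: decode_inv_def cover_inv_def params_def S'_def F_def f'_def)
    have F: "F < M ^ K" unfolding F_def by (rule cover_less[OF t'(1)]) simp
    have m: "mem s (2 * Big + F) = of_bool (F \<in> S')" using mk F by (simp add: marks_def)
    have mods: "(2 * Big + F) mod 2 ^ w = 2 * Big + F" using F B by (intro mod_less) linarith
    have nb: "(Suc 0 - of_bool (j < na)) = (of_bool (\<not> j < na) :: nat)" by simp
    have regs': "regs s' 0 = of_bool (f' \<or> \<not> j < na \<and> F \<in> S')" "\<And>r. r \<notin> {0, 75, 76, 77} \<Longrightarrow> regs s' r = regs s r"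
      and mem': "mem s' = (mem s)(2 * Big + F := of_bool (F \<in> S' \<or> j < na))"
      unfolding s'_def cover_tail_def
      by (cases "j < na"; cases "F \<in> S'"; cases f'; simp add: r mods m one_mod)+
    have sp': "space_used s' \<le> 6 * Big"
      unfolding s'_def cover_tail_def using sp F B by (simp add: r mods m)
    have cv: "covers Z it j (Suc t) = insert F (covers Z it j t)"
      by (simp add: covers_def lessThan_Suc F_def)
    have "marks (if j < na then S \<union> covers Z it j (Suc t) else S) (mem s')"
      using mk unfolding marks_def mem' cv by (auto simp: S'_def)
    moreover have "(f' \<or> \<not> j < na \<and> F \<in> S') = (f \<or> \<not> j < na \<and> S \<inter> covers Z it j (Suc t) \<noteq> {})"
      unfolding cv f'_def S'_def by auto
    moreover have "\<forall>a. a < 2 * Big \<or> 3 * Big \<le> a \<longrightarrow> mem s' a = h a"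
      using a F B by (auto simp: mem' decode_inv_def cover_inv_def)
    ultimately show "cover_inv Z it j h S f (Suc t) s' \<and> regs s' 34 = t \<and> regs s' 68 = ?N"
      using a sp' by (simp add: cover_inv_def decode_inv_def params_def regs')
  qed
  show ?thesis unfolding cover_code_def
    by (rule hoare_conseq[OF hoare_Seq[OF head hoare_Seq[OF loop tail]]]) auto
qed

text \<open>The state of the search: the set of marked covers and whether a disjoint pair was found.\<close>

definition visit :: "(nat \<Rightarrow> nat) \<Rightarrow> nat \<Rightarrow> nat \<Rightarrow> nat set \<times> bool \<Rightarrow> nat set \<times> bool" where
  "visit Z it j = (\<lambda>(S, f). let C = covers Z it j (limit Z it j) in
     if j < na then (S \<union> C, f) else (S, f \<or> S \<inter> C \<noteq> {}))"

text \<open>Candidate lists and the registers from 30 on are scratch, so they do not occur in the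
  invariant between two sets.\<close>

definition search_inv :: "(nat \<Rightarrow> nat) \<Rightarrow> nat set \<times> bool \<Rightarrow> state \<Rightarrow> bool" where
  "search_inv Z Sf s \<longleftrightarrow> params s \<and> tables Z (mem s) \<and> marks (fst Sf) (mem s) \<and> regs s 0 = of_bool (snd Sf)"

lemma search_inv_set_reg: "r \<ge> 30 \<Longrightarrow> search_inv Z Sf (set_reg r v s) = search_inv Z Sf s"
  by (auto simp: search_inv_def)

definition set_time :: nat where
  "set_time = K * (M * 31 + 40) + cap * (K * 25 + 34) + 41"

lemma set_step:
  assumes it: "it < pw" and j: "j < n"
  shows "hoare w (\<lambda>s. (search_inv Z Sf s \<and> regs s 30 = it) \<and> regs s 31 = j \<and> regs s 12 = n) set_code set_time
    (\<lambda>s. (search_inv Z (visit Z it j Sf) s \<and> regs s 30 = it) \<and> regs s 31 = j \<and> regs s 12 = n)"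
proof (rule hoare_fix_mem)
  fix g
  note B = index_bounds word(1)
  obtain S f where Sf: "Sf = (S, f)" by (cases Sf)
  show "hoare w (\<lambda>s. ((search_inv Z Sf s \<and> regs s 30 = it) \<and> regs s 31 = j \<and> regs s 12 = n) \<and> mem s = g) set_code set_time
    (\<lambda>s. (search_inv Z (visit Z it j Sf) s \<and> regs s 30 = it) \<and> regs s 31 = j \<and> regs s 12 = n)"
  proof (cases "tables Z g \<and> marks S g")
    case False
    \<comment> \<open>For such a \<open>g\<close> the precondition is unsatisfiable and the triple
      vacuous.\<close>
    then show ?thesis unfolding triple_def by (auto simp: search_inv_def Sf)
  next
    case True
    then have g: "tables Z g" "marks S g" by auto
    let ?f = "of_bool f :: nat"
    have head: "hoare w (\<lambda>s. ((search_inv Z Sf s \<and> regs s 30 = it) \<and> regs s 31 = j \<and> regs s 12 = n) \<and> mem s = g) set_head 17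
        (\<lambda>s. block_inv Z it j ?f g 0 s \<and> regs s 23 = K)"
    proof (rule hoare_straight_le)
      show "straight set_head" "straight_time set_head \<le> 17" by (simp_all add: set_head_def)
    next
      fix s assume a: "((search_inv Z Sf s \<and> regs s 30 = it) \<and> regs s 31 = j \<and> regs s 12 = n) \<and> mem s = g"
      define s' where "s' = eval_straight w set_head s"
      have r: "regs s 30 = it" "regs s 31 = j" "regs s 11 = na" "regs s 23 = K" "regs s 14 = M" "regs s 20 = 3 * Big"
        "regs s 21 = 4 * Big" and g3: "g (j + 3) = xs ! j" and sp: "space_used s \<le> 6 * Big"
        using a j g(1) by (auto simp: search_inv_def params_def tables_def add.commute)
      have "it * K \<le> pw * K" using it by simp
      moreover have "it * K * M \<le> pw * K * M" using it by (intro mult_right_mono) auto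
      ultimately have "it * K < 2 ^ w" "it * K * M < 2 ^ w" "it * K * M + 3 * Big < 2 ^ w" "it < 2 ^ w" "j + 3 < 2 ^ w"
        using it j B small by linarith+
      then have mods: "(j + 3) mod 2 ^ w = j + 3" "it mod 2 ^ w = it" "(it * K) mod 2 ^ w = it * K"
        "(it * K * M) mod 2 ^ w = it * K * M" "(it * K * M + 3 * Big) mod 2 ^ w = it * K * M + 3 * Big"
        "(4 * Big) mod 2 ^ w = 4 * Big" "3 mod 2 ^ w = (3::nat)"
        using small(10) B(7) by (simp_all only: mod_less)
      have regs': "regs s' 54 = xs ! j" "regs s' 53 = of_bool (j < na)" "regs s' 55 = it" "regs s' 56 = 1"
        "regs s' 57 = it * K * M + 3 * Big" "regs s' 58 = 4 * Big"
        "\<And>r. r \<notin> {51, 53, 54, 55, 56, 57, 58} \<Longrightarrow> regs s' r = regs s r"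
        and mem': "mem s' = g"
        unfolding s'_def set_head_def using a g3 by (simp_all add: r mods of_bool_mod one_mod)
      have sp': "space_used s' \<le> 6 * Big"
        unfolding s'_def set_head_def using sp j B by (simp add: r mods of_bool_mod one_mod)
      have "ctx it j ?f g s'" using a sp' by (simp add: ctx_def params_def regs' mem' search_inv_def Sf)
      then show "block_inv Z it j ?f g 0 s' \<and> regs s' 23 = K"
        by (simp add: block_inv_def regs' lists_def tuples_def r)
    qed
    have loop: "hoare w (\<lambda>s. block_inv Z it j ?f g 0 s \<and> regs s 23 = K) (For 32 42 23 block_code)
        (K * ((M * 31 + 34) + 6) + 6) (\<lambda>s. block_inv Z it j ?f g K s \<and> regs s 23 = K)"
      by (rule hoare_For) (use block_step[OF it j _ g(1)] small in \<open>auto simp: block_inv_set_reg\<close>)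
    let ?Q = "\<lambda>s. (search_inv Z (visit Z it j Sf) s \<and> regs s 30 = it) \<and> regs s 31 = j \<and> regs s 12 = n"
    have rest: "hoare w (\<lambda>s. block_inv Z it j ?f g K s \<and> regs s 23 = K) (limit_code;; For 34 44 68 cover_code)
        (9 + (cap * ((K * 25 + 28) + 6) + 6) + 1) ?Q"
    \<comment> \<open>The memory is fixed a second time, now with the finished candidate lists,
      which the enumeration of covers only reads.\<close>
    proof (rule hoare_fix_mem)
      fix h
      show "hoare w (\<lambda>s. (block_inv Z it j ?f g K s \<and> regs s 23 = K) \<and> mem s = h) (limit_code;; For 34 44 68 cover_code)
        (9 + (cap * ((K * 25 + 28) + 6) + 6) + 1) ?Q"
      proof (cases "lists Z it j K h \<and> (\<forall>a<4 * Big. h a = g a)")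
        case False
        then show ?thesis unfolding triple_def by (auto simp: block_inv_def ctx_def)
      next
        case True
        then have h: "lists Z it j K h" "\<forall>a<4 * Big. h a = g a" by auto
        have lim: "hoare w (\<lambda>s. (block_inv Z it j ?f g K s \<and> regs s 23 = K) \<and> mem s = h) limit_code 9
           (\<lambda>s. cover_inv Z it j h S f 0 s \<and> regs s 68 = limit Z it j)"
        proof (rule hoare_straight_le)
          show "straight limit_code" "straight_time limit_code \<le> 9" by (simp_all add: limit_code_def)
        next
          fix s assume a: "(block_inv Z it j ?f g K s \<and> regs s 23 = K) \<and> mem s = h"
          define s' where "s' = eval_straight w limit_code s"
          let ?P = "tuples Z it j K"
          have r: "regs s 56 = ?P" "regs s 17 = cap" using a by (auto simp: block_inv_def ctx_def params_def)
          have P: "?P < 2 ^ w" using tuples_le[of Z it j K] small(11) by linarith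
          have mods: "?P mod 2 ^ w = ?P" "cap mod 2 ^ w = cap" using P word(2) by simp_all
          have "regs s' 68 = limit Z it j"
            unfolding s'_def limit_code_def
            by (cases "?P < cap") (simp_all add: r mods limit_def one_mod)
          moreover have "\<And>r. r \<notin> {68, 69} \<Longrightarrow> regs s' r = regs s r" "mem s' = h" "space_used s' = space_used s"
            unfolding s'_def limit_code_def using a by simp_all
          moreover have "marks S h" using h(2) g(2) B unfolding marks_def by auto
          ultimately show "cover_inv Z it j h S f 0 s' \<and> regs s' 68 = limit Z it j"
            using a by (simp add: cover_inv_def params_def block_inv_def ctx_def covers_def)
        qed
        have loop2: "hoare w (\<lambda>s. cover_inv Z it j h S f 0 s \<and> regs s 68 = limit Z it j) (For 34 44 68 cover_code)
            (limit Z it j * ((K * 25 + 28) + 6) + 6) (\<lambda>s. cover_inv Z it j h S f (limit Z it j) s \<and> regs s 68 = limit Z it j)"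
          by (rule hoare_For) (use cover_step[OF _ h(1)] word(2) in \<open>auto simp: cover_inv_set_reg limit_def\<close>)
        have post: "?Q s" if "cover_inv Z it j h S f (limit Z it j) s" for s
        proof -
          have "tables Z (mem s)" unfolding tables_def
          proof (intro conjI allI impI)
            have eq: "mem s a = g a" if "a < 2 * Big \<or> 3 * Big \<le> a \<and> a < 4 * Big" for a
              using that \<open>cover_inv Z it j h S f (limit Z it j) s\<close> h(2) by (auto simp: cover_inv_def)
            show "mem s (3 + j) = xs ! j" if "j < n" for j
              using eq[of "3 + j"] g(1) that B by (simp add: tables_def)
            show "mem s (Big + u) = popcount u" if "u < M" for u
              using eq[of "Big + u"] g(1) that B by (simp add: tables_def)
            show "mem s (3 * Big + x) = Z x" if "x < pw * K * M" for x
              using eq[of "3 * Big + x"] g(1) that B by (simp add: tables_def)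
          qed
          then show ?thesis using that by (auto simp: cover_inv_def search_inv_def visit_def Let_def Sf params_def)
        qed
        have "limit Z it j * ((K * 25 + 28) + 6) \<le> cap * ((K * 25 + 28) + 6)"
          by (intro mult_right_mono) (auto simp: limit_def)
        then show ?thesis
          by (intro hoare_conseq[OF hoare_Seq[OF lim loop2]]) (use post in auto)
      qed
    qed
    show ?thesis unfolding set_code_def
      by (rule hoare_conseq[OF hoare_Seq[OF head hoare_Seq[OF loop rest]]]) (simp_all add: set_time_def algebra_simps)
  qed
qed

primrec visit_all :: "(nat \<Rightarrow> nat) \<Rightarrow> nat \<Rightarrow> nat set \<times> bool \<Rightarrow> nat \<Rightarrow> nat set \<times> bool" where
  "visit_all Z it Sf 0 = Sf"
| "visit_all Z it Sf (Suc j) = visit Z it j (visit_all Z it Sf j)"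

primrec search :: "(nat \<Rightarrow> nat) \<Rightarrow> nat \<Rightarrow> nat set \<times> bool" where
  "search Z 0 = ({}, False)"
| "search Z (Suc it) = visit_all Z it (search Z it) n"

lemma search_correct:
  "hoare w (\<lambda>s. search_inv Z ({}, False) s) search_code (pw * (n * (set_time + 6) + 12) + 6)
    (\<lambda>s. search_inv Z (search Z pw) s)"
proof -
  have "hoare w (\<lambda>s. search_inv Z (search Z it) s \<and> regs s 30 = it \<and> regs s 15 = pw) (For 31 41 12 set_code)
     (n * (set_time + 6) + 6) (\<lambda>s. search_inv Z (search Z (Suc it)) s \<and> regs s 30 = it \<and> regs s 15 = pw)"
    if it: "it < pw" for it
  proof -
    have "hoare w (\<lambda>s. (search_inv Z (visit_all Z it (search Z it) 0) s \<and> regs s 30 = it) \<and> regs s 12 = n) (For 31 41 12 set_code)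
       (n * (set_time + 6) + 6) (\<lambda>s. (search_inv Z (visit_all Z it (search Z it) n) s \<and> regs s 30 = it) \<and> regs s 12 = n)"
      by (rule hoare_For) (use set_step[OF it] small in \<open>auto simp: search_inv_set_reg\<close>)
    then show ?thesis
      by (rule hoare_conseq) (auto simp: search_inv_def params_def)
  qed
  then have "hoare w (\<lambda>s. search_inv Z (search Z 0) s \<and> regs s 15 = pw) search_code (pw * ((n * (set_time + 6) + 6) + 6) + 6)
    (\<lambda>s. search_inv Z (search Z pw) s \<and> regs s 15 = pw)"
    unfolding search_code_def by (intro hoare_For) (use small in \<open>auto simp: search_inv_set_reg\<close>)
  then show ?thesis by (rule hoare_conseq) (auto simp: search_inv_def params_def)
qed

end

section \<open>Distribution of the random table\<close>

lemma pair_pmf_of_set: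
  assumes "finite A" "A \<noteq> {}" "finite B" "B \<noteq> {}"
  shows "pair_pmf (pmf_of_set A) (pmf_of_set B) = pmf_of_set (A \<times> B)"
proof (rule pmf_eqI)
  fix x :: "'a \<times> 'b"
  show "pmf (pair_pmf (pmf_of_set A) (pmf_of_set B)) x = pmf (pmf_of_set (A \<times> B)) x"
    by (cases x) (simp add: assms pmf_pair card_cartesian_product indicator_def)
qed

text \<open>Halving and parity invert \<open>2 * v + b\<close>, so uniform pairs become uniform
  numbers.\<close>

lemma append_random_bit:
  "bind_pmf (pmf_of_set {..<N}) (\<lambda>v. map_pmf (\<lambda>b. 2 * v + of_bool b) (bernoulli_pmf (1 / 2))) = pmf_of_set {..<2 * N}"
  if "0 < N" for N :: nat
proof -
  have "bij_betw (\<lambda>x. 2 * fst x + of_bool (snd x)) ({..<N} \<times> UNIV) {..<2 * N}"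
  proof (intro bij_betwI[where g = "\<lambda>k. (k div 2, odd k)"])
    show "(\<lambda>x. 2 * fst x + of_bool (snd x)) \<in> {..<N} \<times> UNIV \<rightarrow> {..<2 * N}"
    proof
      fix x assume "x \<in> {..<N} \<times> (UNIV :: bool set)"
      then have "fst x < N" by auto
      moreover have "(of_bool (snd x) :: nat) \<le> 1" by simp
      ultimately show "2 * fst x + of_bool (snd x) \<in> {..<2 * N}" by simp
    qed
    show "(\<lambda>k. (k div 2, odd k)) \<in> {..<2 * N} \<rightarrow> {..<N} \<times> UNIV" by auto
    show "((2 * fst x + of_bool (snd x)) div 2, odd (2 * fst x + of_bool (snd x))) = x" for x :: "nat \<times> bool"
      by (cases x) auto
    show "2 * fst (k div 2, odd k) + of_bool (snd (k div 2, odd k)) = k" for k :: nat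
      by (cases "odd k") (auto elim!: oddE)
  qed
  then have "pmf_of_set {..<2 * N} = map_pmf (\<lambda>x. 2 * fst x + of_bool (snd x)) (pmf_of_set ({..<N} \<times> UNIV))"
    using that by (intro map_pmf_of_set_bij_betw[symmetric]) auto
  also have "pmf_of_set ({..<N} \<times> (UNIV :: bool set)) = pair_pmf (pmf_of_set {..<N}) (pmf_of_set UNIV)"
    using that by (intro pair_pmf_of_set[symmetric]) auto
  finally show ?thesis
    unfolding bernoulli_pmf_half_conv_pmf_of_set
    by (simp add: pair_pmf_def map_bind_pmf map_pmf_def bind_assoc_pmf bind_return_pmf)
qed

lemma iterate_random_bits:
  "iterate_pmf (\<lambda>_ v. map_pmf (\<lambda>b. 2 * v + of_bool b) (bernoulli_pmf (1 / 2))) (0::nat) k = pmf_of_set {..<2 ^ k}"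
proof (induction k)
  case 0
  have "{..<1::nat} = {0}" by auto
  then show ?case by (simp add: pmf_of_set_singleton)
next
  case (Suc k)
  then show ?case using append_random_bit[of "2 ^ k"] by simp
qed

text \<open>The program draws the last word last, \<open>Pi_pmf_insert'\<close> draws it first;
  independence allows the exchange.\<close>

lemma iterate_random_words:
  "iterate_pmf (\<lambda>x Z. map_pmf (\<lambda>v. Z(x := v)) p) (\<lambda>_. z) k = Pi_pmf {..<k} z (\<lambda>_. p)"
proof (induction k)
  case 0
  then show ?case by simp
next
  case (Suc k)
  have "Pi_pmf {..<Suc k} z (\<lambda>_. p) = bind_pmf p (\<lambda>y. bind_pmf (Pi_pmf {..<k} z (\<lambda>_. p)) (\<lambda>f. return_pmf (f(k := y))))"
    unfolding lessThan_Suc by (rule Pi_pmf_insert') auto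
  also have "\<dots> = bind_pmf (Pi_pmf {..<k} z (\<lambda>_. p)) (\<lambda>f. bind_pmf p (\<lambda>y. return_pmf (f(k := y))))"
    by (rule bind_commute_pmf)
  finally show ?case using Suc by (simp add: map_pmf_def fun_upd_def)
qed

text \<open>The recursion by which the program fills its table in increasing order of
  \<open>u\<close>.\<close>

lemma popcount_half: "popcount u = popcount (u div 2) + u mod 2"
proof -
  have "set_decode u = Suc ` set_decode (u div 2) \<union> (if odd u then {0} else {})"
  proof (intro set_eqI)
    fix x show "x \<in> set_decode u \<longleftrightarrow> x \<in> Suc ` set_decode (u div 2) \<union> (if odd u then {0} else {})"
      by (cases x) auto
  qed
  then have "popcount u = card (Suc ` set_decode (u div 2) \<union> (if odd u then {0} else {}))"
    unfolding popcount_def by simp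
  also have "\<dots> = card (Suc ` set_decode (u div 2)) + card (if odd u then {0::nat} else {})"
    by (intro card_Un_disjoint) auto
  also have "\<dots> = popcount (u div 2) + u mod 2"
    by (auto simp: popcount_def card_image odd_iff_mod_2_eq_one even_iff_mod_2_eq_zero)
  finally show ?thesis .
qed

lemma popcount_0 [simp]: "popcount 0 = 0"
  by (simp add: popcount_def)

lemma popcount_le: "popcount u \<le> u"
proof (induction u rule: less_induct)
  case (less u)
  show ?case
  proof (cases "u = 0")
    case False
    then have "popcount (u div 2) \<le> u div 2" using less by simp
    moreover have "u div 2 + u mod 2 \<le> u" by linarith
    ultimately show ?thesis using popcount_half[of u] by linarith
  qed simp
qed

section \<open>Initialisation: parameters, tables and random words\<close>

definition read_code :: "nat \<Rightarrow> nat \<Rightarrow> com" where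
  "read_code K e =
    Load 10 (Imm 0);; Load 11 (Imm 1);; Load 50 (Imm 2);; Bin 12 Add (Reg 11) (Reg 50);;
    Bin 23 Add (Imm K) (Imm 0);; Bin 13 Div (Reg 10) (Reg 23);; Bin 13 Add (Reg 13) (Imm 1);;
    Bin 14 Shl (Imm 1) (Reg 13);; Bin 16 Add (Reg 10) (Imm 2);;
    Bin 15 Add (Imm 1) (Imm 0);; Bin 51 Add (Imm e) (Imm 0)"

definition power_code :: com where
  "power_code = For 36 46 51 (Bin 15 Mul (Reg 15) (Reg 16))"

text \<open>The constants \<open>p\<close> and \<open>q\<close> of the program are chosen such that
  \<open>d * p div q\<close> is the total size of a pair, so this size is known without inspecting
  any set.\<close>

definition size_code :: "nat \<Rightarrow> nat \<Rightarrow> com" where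
  "size_code p q =
    Bin 52 Mul (Reg 10) (Imm p);; Bin 52 Div (Reg 52) (Imm q);; Bin 53 Div (Reg 52) (Imm 2);; Bin 54 Add (Imm 1) (Imm 0)"

definition binomial_code :: com where
  "binomial_code = For 37 47 53 (
    Bin 55 Sub (Reg 10) (Reg 37);; Bin 54 Mul (Reg 54) (Reg 55);; Bin 55 Add (Reg 37) (Imm 1);; Bin 54 Div (Reg 54) (Reg 55))"

text \<open>Register 17 receives the cap. Its factor from register 15 is a power of
  \<open>d + 2\<close> and absorbs the constants and polynomial losses of the size
  estimates.\<close>

definition layout_code :: com where
  "layout_code =
    Bin 55 Div (Reg 10) (Imm 2);; Bin 55 Add (Reg 55) (Reg 52);; Bin 55 Shl (Imm 1) (Reg 55);;
    Bin 55 Div (Reg 55) (Reg 54);; Bin 55 Add (Reg 55) (Imm 1);; Bin 17 Mul (Reg 55) (Reg 15);;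
    Bin 24 Mul (Reg 15) (Reg 23);; Bin 24 Mul (Reg 24) (Reg 14);;
    Bin 56 Mul (Reg 13) (Reg 23);; Bin 56 Shl (Imm 1) (Reg 56);; Bin 18 Add (Reg 56) (Reg 24);;
    Bin 18 Add (Reg 18) (Reg 12);; Bin 18 Add (Reg 18) (Imm 3);;
    Bin 19 Add (Reg 18) (Reg 18);; Bin 20 Add (Reg 19) (Reg 18);; Bin 21 Add (Reg 20) (Reg 18);; Bin 22 Add (Reg 21) (Reg 18)"

definition popcount_body :: com where
  "popcount_body =
    Bin 57 Div (Reg 38) (Imm 2);; Bin 57 Add (Reg 57) (Reg 18);; Load 58 (Reg 57);; Bin 59 Mod (Reg 38) (Imm 2);;
    Bin 58 Add (Reg 58) (Reg 59);; Bin 57 Add (Reg 38) (Reg 18);; Store (Reg 57) (Reg 58)"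

definition random_body :: com where
  "random_body = Bin 60 Add (Imm 0) (Imm 0);;
    For 78 79 13 (Flip 61;; Bin 60 Add (Reg 60) (Reg 60);; Bin 60 Add (Reg 60) (Reg 61));;
    Bin 62 Add (Reg 20) (Reg 39);; Store (Reg 62) (Reg 60)"

definition program :: "nat \<Rightarrow> nat \<Rightarrow> nat \<Rightarrow> nat \<Rightarrow> com" where
  "program K e p q = read_code K e;; power_code;; size_code p q;; binomial_code;; layout_code;;
     For 38 48 14 popcount_body;; For 39 49 24 random_body;; search_code"

text \<open>By the absorption identities the product is a multiple of \<open>i + 1\<close>, so the
  division in \<open>binomial_code\<close> is exact.\<close>

lemma choose_step: "(d choose i) * (d - i) div (i + 1) = d choose Suc i"
proof -
  have "(d choose Suc i) * Suc i = (d choose i) * (d - i)"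
    using binomial_absorption[of i d] binomial_absorb_comp[of d i] by (simp add: mult.commute)
  then show ?thesis by (metis Suc_eq_plus1 nonzero_mult_div_cancel_right nat.simps(3))
qed

text \<open>The bound on \<open>2 ^ (d + s) * (d + 1)\<close> serves twice: for the power in the
  cap, and for the products in the binomial recurrence, which are formed before the
  division.\<close>

locale program_layout = layout +
  fixes nb s e p q :: nat
  assumes n_eq: "n = na + nb" and m_eq: "m = d div K + 1" and pw_eq: "pw = (d + 2) ^ e"
    and s_eq: "s = d * p div q" and s_le: "s \<le> d"
    and cap_eq: "cap = (2 ^ (d div 2 + s) div (d choose (s div 2)) + 1) * pw"
    and word': "d * p < 2 ^ w" "e < 2 ^ w" "p < 2 ^ w" "q < 2 ^ w" "2 ^ (d + s) * (d + 1) < 2 ^ w"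
begin

definition inp :: "nat list" where
  "inp = [d, na, nb] @ xs"

lemma inp: "length inp = n + 3" "inp ! 0 = d" "inp ! Suc 0 = na" "inp ! 2 = nb" "j < n \<Longrightarrow> inp ! (3 + j) = xs ! j"
  using n by (simp_all add: inp_def nth_append)

definition start :: "state \<Rightarrow> bool" where
  "start t \<longleftrightarrow> regs t 0 = 0 \<and> mem t = mem (init_state inp) \<and> space_used t = n + 3 \<and> regs t 10 = d \<and> regs t 11 = na \<and>
     regs t 12 = n \<and> regs t 13 = m \<and> regs t 14 = M \<and> regs t 16 = d + 2 \<and> regs t 23 = K"

lemma start_set_reg: "r \<notin> {0, 10, 11, 12, 13, 14, 16, 23} \<Longrightarrow> start (set_reg r v t) = start t"
  by (auto simp: start_def)

lemma d_less: "d < 2 ^ w"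
  using small(12) by linarith

lemma read_correct: "hoare w (\<lambda>t. t = init_state inp) (read_code K e) 21
   (\<lambda>t. (start t \<and> regs t 15 = (d + 2) ^ 0) \<and> regs t 51 = e)"
proof (rule hoare_straight_le)
  show "straight (read_code K e)" "straight_time (read_code K e) \<le> 21" by (simp_all add: read_code_def)
next
  fix t assume t: "t = init_state inp"
  have r: "mem t 0 = d" "mem t (Suc 0) = na" "mem t 2 = nb" "space_used t = n + 3" "regs t = (\<lambda>_. 0)"
    using inp(1-4) by (simp_all add: t init_state_def)
  have md: "m < 2 ^ m" by (rule less_exp)
  have mods: "(na + nb) mod 2 ^ w = n" "K mod 2 ^ w = K" "d div K mod 2 ^ w = d div K" "Suc (d div K) mod 2 ^ w = m" "m mod 2 ^ w = m"
    "2 ^ m mod 2 ^ w = M" "(d + 2) mod 2 ^ w = d + 2" "e mod 2 ^ w = e" "2 mod 2 ^ w = (2::nat)"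
    using small word' n_eq M md m_eq d_less div_le_dividend[of d K] by (auto intro!: mod_less simp del: div_le_dividend)
  have m': "Suc (d div K) = m" using m_eq by simp
  define t' where "t' = eval_straight w (read_code K e) t"
  have regs': "regs t' 10 = d" "regs t' 11 = na" "regs t' 12 = n" "regs t' 13 = m" "regs t' 14 = M" "regs t' 15 = 1"
    "regs t' 16 = d + 2" "regs t' 23 = K" "regs t' 51 = e" "regs t' 0 = 0"
    and mem': "mem t' = mem (init_state inp)" and sp': "space_used t' = n + 3"
    unfolding t'_def read_code_def
    by (simp_all add: r mods[simplified] one_mod push_bit_eq_mult m') (simp add: t)
  then show "(start (eval_straight w (read_code K e) t) \<and> regs (eval_straight w (read_code K e) t) 15 = (d + 2) ^ 0) \<and>
      regs (eval_straight w (read_code K e) t) 51 = e"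
    unfolding t'_def[symmetric] start_def by simp
qed

lemma power_correct: "hoare w (\<lambda>t. (start t \<and> regs t 15 = (d + 2) ^ 0) \<and> regs t 51 = e) power_code (e * 7 + 6)
   (\<lambda>t. start t \<and> regs t 15 = pw)"
proof -
  have "hoare w (\<lambda>t. (start t \<and> regs t 15 = (d + 2) ^ 0) \<and> regs t 51 = e) power_code (e * (1 + 6) + 6)
     (\<lambda>t. (start t \<and> regs t 15 = (d + 2) ^ e) \<and> regs t 51 = e)"
    unfolding power_code_def
  proof (rule hoare_For)
    fix i assume i: "i < e"
    have "(d + 2) ^ Suc i \<le> pw" unfolding pw_eq using i by (intro power_increasing) auto
    then have "(d + 2) ^ i * (d + 2) mod 2 ^ w = (d + 2) ^ Suc i"
      using small(4) by (simp only: power_Suc2 mod_less)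
    then show "hoare w (\<lambda>t. (start t \<and> regs t 15 = (d + 2) ^ i) \<and> regs t 36 = i \<and> regs t 51 = e) (Bin 15 Mul (Reg 15) (Reg 16)) 1
          (\<lambda>t. (start t \<and> regs t 15 = (d + 2) ^ Suc i) \<and> regs t 36 = i \<and> regs t 51 = e)"
      by (intro hoare_straight_le) (auto simp: start_def simp del: power_Suc add_2_eq_Suc')
  qed (use word' in \<open>auto simp: start_set_reg\<close>)
  then show ?thesis by (rule hoare_conseq) (auto simp: pw_eq)
qed

lemma size_correct: "hoare w (\<lambda>t. start t \<and> regs t 15 = pw) (size_code p q) 7
   (\<lambda>t. (start t \<and> regs t 15 = pw \<and> regs t 52 = s \<and> regs t 54 = (d choose 0)) \<and> regs t 53 = s div 2)"
proof (rule hoare_straight_le)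
  show "straight (size_code p q)" "straight_time (size_code p q) \<le> 7" by (simp_all add: size_code_def)
next
  fix t assume t: "start t \<and> regs t 15 = pw"
  have sw: "s < 2 ^ w" using s_le d_less by linarith
  then have "s div 2 < 2 ^ w" by linarith
  then have mods: "d * p mod 2 ^ w = d * p" "p mod 2 ^ w = p" "q mod 2 ^ w = q" "d * p div q mod 2 ^ w = s" "s div 2 mod 2 ^ w = s div 2"
     "2 mod 2 ^ w = (2::nat)"
    using word' sw small(9) s_eq by (simp_all only: mod_less)
  have r: "regs t 10 = d" using t by (simp add: start_def)
  have "start (eval_straight w (size_code p q) t)" unfolding size_code_def using t by (simp add: start_set_reg)
  then show "(start (eval_straight w (size_code p q) t) \<and> regs (eval_straight w (size_code p q) t) 15 = pw \<and>
      regs (eval_straight w (size_code p q) t) 52 = s \<and> regs (eval_straight w (size_code p q) t) 54 = (d choose 0)) \<and>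
      regs (eval_straight w (size_code p q) t) 53 = s div 2"
    unfolding size_code_def using t by (simp add: r mods one_mod)
qed

lemma choose_word: "(d choose i) * (d + 1) < 2 ^ w" "(d choose i) < 2 ^ w"
proof -
  have "(d choose i) \<le> 2 ^ d"
  proof (cases "i \<le> d")
    case True
    then have "(d choose i) \<le> (\<Sum>k\<le>d. d choose k)" by (intro member_le_sum) auto
    then show ?thesis by (simp add: choose_row_sum)
  qed (simp add: binomial_eq_0)
  also have "(2::nat) ^ d \<le> 2 ^ (d + s)" by (intro power_increasing) auto
  finally have "(d choose i) * (d + 1) \<le> 2 ^ (d + s) * (d + 1)" by (intro mult_right_mono) auto
  then show *: "(d choose i) * (d + 1) < 2 ^ w" using word'(5) by linarith
  have "(d choose i) \<le> (d choose i) * (d + 1)" by simp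
  then show "(d choose i) < 2 ^ w" using * by linarith
qed

lemma binomial_correct:
  "hoare w (\<lambda>t. (start t \<and> regs t 15 = pw \<and> regs t 52 = s \<and> regs t 54 = (d choose 0)) \<and> regs t 53 = s div 2) binomial_code (d * 13 + 6)
   (\<lambda>t. start t \<and> regs t 15 = pw \<and> regs t 52 = s \<and> regs t 54 = (d choose (s div 2)))"
proof -
  have "hoare w (\<lambda>t. (start t \<and> regs t 15 = pw \<and> regs t 52 = s \<and> regs t 54 = (d choose 0)) \<and> regs t 53 = s div 2) binomial_code
     (s div 2 * (7 + 6) + 6)
     (\<lambda>t. (start t \<and> regs t 15 = pw \<and> regs t 52 = s \<and> regs t 54 = (d choose (s div 2))) \<and> regs t 53 = s div 2)"
    unfolding binomial_code_def
  proof (rule hoare_For)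
    fix i assume i: "i < s div 2"
    then have id: "i < d" using s_le by linarith
    let ?c = "Bin 55 Sub (Reg 10) (Reg 37);; Bin 54 Mul (Reg 54) (Reg 55);; Bin 55 Add (Reg 37) (Imm 1);; Bin 54 Div (Reg 54) (Reg 55)"
    show "hoare w (\<lambda>t. (start t \<and> regs t 15 = pw \<and> regs t 52 = s \<and> regs t 54 = (d choose i)) \<and> regs t 37 = i \<and> regs t 53 = s div 2) ?c 7
       (\<lambda>t. (start t \<and> regs t 15 = pw \<and> regs t 52 = s \<and> regs t 54 = (d choose Suc i)) \<and> regs t 37 = i \<and> regs t 53 = s div 2)"
    proof (rule hoare_straight_le)
      fix t assume t: "(start t \<and> regs t 15 = pw \<and> regs t 52 = s \<and> regs t 54 = (d choose i)) \<and> regs t 37 = i \<and> regs t 53 = s div 2"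
      have r: "regs t 10 = d" "regs t 37 = i" "regs t 54 = d choose i" using t by (simp_all add: start_def)
      have "(d choose i) * (d - i) \<le> (d choose i) * (d + 1)" by (intro mult_left_mono) auto
      then have lt: "(d choose i) * (d - i) < 2 ^ w" using choose_word[of i] by linarith
      have mods: "(d - i) mod 2 ^ w = d - i" "(d choose i) * (d - i) mod 2 ^ w = (d choose i) * (d - i)"
         "(i + 1) mod 2 ^ w = i + 1" "(d choose i) * (d - i) div (i + 1) mod 2 ^ w = d choose Suc i"
      proof -
        show "(d - i) mod 2 ^ w = d - i" using d_less by (intro mod_less) linarith
        show "(d choose i) * (d - i) mod 2 ^ w = (d choose i) * (d - i)" using lt by (rule mod_less)
        show "(i + 1) mod 2 ^ w = i + 1" using id d_less by (intro mod_less) linarith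
        show "(d choose i) * (d - i) div (i + 1) mod 2 ^ w = d choose Suc i"
          unfolding choose_step using choose_word by (intro mod_less)
      qed
      have "start (eval_straight w ?c t)" using t by (simp add: start_set_reg)
      then show "(start (eval_straight w ?c t) \<and> regs (eval_straight w ?c t) 15 = pw \<and> regs (eval_straight w ?c t) 52 = s \<and>
         regs (eval_straight w ?c t) 54 = (d choose Suc i)) \<and> regs (eval_straight w ?c t) 37 = i \<and> regs (eval_straight w ?c t) 53 = s div 2"
        using t by (simp add: r mods mods[simplified] one_mod del: binomial_Suc_Suc)
    qed simp_all
  next
    have "s div 2 \<le> d" using s_le by linarith
    then show "s div 2 < 2 ^ w" using d_less by linarith
  qed (auto simp: start_set_reg)
  then show ?thesis by (rule hoare_conseq) (use s_le in auto)
qed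

text \<open>Zero cells matter twice: zero marks represent the empty set, and entry 0 of the
  population counts is computed from its own initial value.\<close>

definition setup_inv :: "nat \<Rightarrow> state \<Rightarrow> bool" where
  "setup_inv u t \<longleftrightarrow> params t \<and> regs t 0 = 0 \<and> regs t 24 = pw * K * M \<and>
     (\<forall>j<n. mem t (3 + j) = xs ! j) \<and> (\<forall>F<Big. mem t (2 * Big + F) = 0) \<and>
     (\<forall>v<M. mem t (Big + v) = (if v < u then popcount v else 0))"

lemma layout_correct:
  "hoare w (\<lambda>t. start t \<and> regs t 15 = pw \<and> regs t 52 = s \<and> regs t 54 = (d choose (s div 2))) layout_code 33
   (\<lambda>t. setup_inv 0 t \<and> regs t 14 = M)"
proof (rule hoare_straight_le)
  show "straight layout_code" "straight_time layout_code \<le> 33" by (simp_all add: layout_code_def)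
next
  fix t assume t: "start t \<and> regs t 15 = pw \<and> regs t 52 = s \<and> regs t 54 = (d choose (s div 2))"
  define t' where "t' = eval_straight w layout_code t"
  let ?q = "2 ^ (d div 2 + s) div (d choose (s div 2))"
  have r: "regs t 10 = d" "regs t 15 = pw" "regs t 52 = s" "regs t 54 = (d choose (s div 2))" "regs t 23 = K" "regs t 14 = M"
     "regs t 13 = m" "regs t 12 = n" "regs t 16 = d + 2" "regs t 0 = 0" "regs t 11 = na" "space_used t = n + 3"
     and mt: "mem t = mem (init_state inp)"
    using t by (simp_all add: start_def)
  have ds: "d div 2 + s < 2 ^ (d div 2 + s)" by (rule less_exp)
  have pds: "(2::nat) ^ (d div 2 + s) < 2 ^ w"
  proof -
    have "(2::nat) ^ (d div 2 + s) \<le> 2 ^ (d + s)" by (intro power_increasing) auto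
    also have "\<dots> \<le> 2 ^ (d + s) * (d + 1)" by simp
    finally show ?thesis using word'(5) by linarith
  qed
  have q: "?q + 1 \<le> cap" unfolding cap_eq using mult_le_mono2[of 1 pw "?q + 1"] pw by simp
  have mK: "m * K < 2 ^ (m * K)" by (rule less_exp)
  have MK: "(2::nat) ^ (m * K) = M ^ K" by (simp add: M power_mult)
  note B = index_bounds word(1)
  have mods: "d div 2 mod 2 ^ w = d div 2" "(d div 2 + s) mod 2 ^ w = d div 2 + s" "2 ^ (d div 2 + s) mod 2 ^ w = (2::nat) ^ (d div 2 + s)"
    "?q mod 2 ^ w = ?q" "(?q + 1) mod 2 ^ w = ?q + 1" "(?q + 1) * pw mod 2 ^ w = cap"
    "pw * K mod 2 ^ w = pw * K" "pw * K * M mod 2 ^ w = pw * K * M" "m * K mod 2 ^ w = m * K" "2 ^ (m * K) mod 2 ^ w = M ^ K"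
    "(M ^ K + pw * K * M) mod 2 ^ w = M ^ K + pw * K * M" "(M ^ K + pw * K * M + n) mod 2 ^ w = M ^ K + pw * K * M + n"
    "(M ^ K + pw * K * M + n + 3) mod 2 ^ w = Big" "(Big + Big) mod 2 ^ w = 2 * Big" "(2 * Big + Big) mod 2 ^ w = 3 * Big"
    "(3 * Big + Big) mod 2 ^ w = 4 * Big" "(4 * Big + Big) mod 2 ^ w = 5 * Big" "2 mod 2 ^ w = (2::nat)" "3 mod 2 ^ w = (3::nat)"
  proof -
    have "m * K < 2 ^ w" using mK small(11) unfolding MK by linarith
    moreover have "d div 2 < 2 ^ w" "d div 2 + s < 2 ^ w" "?q < 2 ^ w" "?q + 1 < 2 ^ w" using ds pds q word(2) by linarith+
    moreover have "(?q + 1) * pw < 2 ^ w" using word(2) unfolding cap_eq .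
    moreover have "M ^ K + pw * K * M < 2 ^ w" "M ^ K + pw * K * M + n < 2 ^ w" "M ^ K + pw * K * M + n + 3 < 2 ^ w"
      using Big word(1) by linarith+
    moreover have "Big + Big < 2 ^ w" "2 * Big + Big < 2 ^ w" "3 * Big + Big < 2 ^ w" "4 * Big + Big < 2 ^ w" using word(1) by linarith+
    moreover have "Big + Big = 2 * Big" "2 * Big + Big = 3 * Big" "3 * Big + Big = 4 * Big" "4 * Big + Big = 5 * Big" by linarith+
    ultimately show "d div 2 mod 2 ^ w = d div 2" "(d div 2 + s) mod 2 ^ w = d div 2 + s" "2 ^ (d div 2 + s) mod 2 ^ w = (2::nat) ^ (d div 2 + s)"
    "?q mod 2 ^ w = ?q" "(?q + 1) mod 2 ^ w = ?q + 1" "(?q + 1) * pw mod 2 ^ w = cap"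
    "pw * K mod 2 ^ w = pw * K" "pw * K * M mod 2 ^ w = pw * K * M" "m * K mod 2 ^ w = m * K" "2 ^ (m * K) mod 2 ^ w = M ^ K"
    "(M ^ K + pw * K * M) mod 2 ^ w = M ^ K + pw * K * M" "(M ^ K + pw * K * M + n) mod 2 ^ w = M ^ K + pw * K * M + n"
    "(M ^ K + pw * K * M + n + 3) mod 2 ^ w = Big" "(Big + Big) mod 2 ^ w = 2 * Big" "(2 * Big + Big) mod 2 ^ w = 3 * Big"
    "(3 * Big + Big) mod 2 ^ w = 4 * Big" "(4 * Big + Big) mod 2 ^ w = 5 * Big" "2 mod 2 ^ w = (2::nat)" "3 mod 2 ^ w = (3::nat)"
      using pds small Big[symmetric] cap_eq[symmetric] MK by (simp_all only: mod_less)
  qed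
  have mq: "(pw + ?q * pw) mod 2 ^ w = cap" "3 * Big mod 2 ^ w = 3 * Big" "4 * Big mod 2 ^ w = 4 * Big" "5 * Big mod 2 ^ w = 5 * Big"
    using mods(6) word(1) by simp_all
  note mods' = mods[unfolded One_nat_def add_Suc_right add_0_right]
  have regs': "regs t' 17 = cap" "regs t' 18 = Big" "regs t' 19 = 2 * Big" "regs t' 20 = 3 * Big" "regs t' 21 = 4 * Big"
      "regs t' 22 = 5 * Big" "regs t' 24 = pw * K * M"
      "\<And>r. r \<notin> {17, 18, 19, 20, 21, 22, 24, 55, 56} \<Longrightarrow> regs t' r = regs t r"
    and mem': "mem t' = mem t" and sp': "space_used t' = space_used t"
    unfolding t'_def layout_code_def
    by (simp_all add: r mods mods' mq one_mod push_bit_eq_mult)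
  have "params t'" using B by (simp add: params_def regs' r sp')
  moreover have "mem t' a = 0" if "a \<ge> n + 3" for a
    using that inp(1) by (simp add: mem' mt init_state_def)
  moreover have "mem t' (3 + j) = xs ! j" if "j < n" for j
    using that inp(1,5) by (simp add: mem' mt init_state_def)
  ultimately show "setup_inv 0 t' \<and> regs t' 14 = M"
    using B by (simp add: setup_inv_def regs' r)
qed

lemma popcount_correct: "hoare w (\<lambda>t. setup_inv 0 t \<and> regs t 14 = M) (For 38 48 14 popcount_body) (M * 19 + 6) (setup_inv M)"
proof -
  have "hoare w (\<lambda>t. setup_inv 0 t \<and> regs t 14 = M) (For 38 48 14 popcount_body) (M * (13 + 6) + 6)
     (\<lambda>t. setup_inv M t \<and> regs t 14 = M)"
  proof (rule hoare_For)
    fix u assume u: "u < M"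
    show "hoare w (\<lambda>t. setup_inv u t \<and> regs t 38 = u \<and> regs t 14 = M) popcount_body 13
        (\<lambda>t. setup_inv (Suc u) t \<and> regs t 38 = u \<and> regs t 14 = M)"
    proof (rule hoare_straight_le)
      show "straight popcount_body" "straight_time popcount_body \<le> 13" by (simp_all add: popcount_body_def)
    next
      fix t assume t: "setup_inv u t \<and> regs t 38 = u \<and> regs t 14 = M"
      define t' where "t' = eval_straight w popcount_body t"
      note B = index_bounds word(1)
      have r: "regs t 38 = u" "regs t 18 = Big" and sp: "space_used t \<le> 6 * Big"
        using t by (simp_all add: setup_inv_def params_def)
      have "u div 2 < u \<or> u = 0" by auto
      then have l: "mem t (u div 2 + Big) = popcount (u div 2)"
      proof -
        have "mem t (Big + v) = (if v < u then popcount v else 0)" if "v < M" for v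
          using t that by (simp add: setup_inv_def)
        from this[of "u div 2"] show ?thesis using \<open>u div 2 < u \<or> u = 0\<close> u by (auto simp: add.commute)
      qed
      have pc: "popcount (u div 2) + u mod 2 = popcount u" using popcount_half[of u] by simp
      have "popcount u < 2 ^ w" using popcount_le[of u] u small(1) by linarith
      moreover have "u div 2 < 2 ^ w" "u div 2 + Big < 2 ^ w" "u + Big < 2 ^ w" "u mod 2 < 2 ^ w"
        using u B by linarith+
      ultimately have mods: "u div 2 mod 2 ^ w = u div 2" "(u div 2 + Big) mod 2 ^ w = u div 2 + Big" "(u + Big) mod 2 ^ w = u + Big"
        "u mod 2 mod 2 ^ w = u mod 2" "popcount u mod 2 ^ w = popcount u" "2 mod 2 ^ w = (2::nat)"
        using small(9) by (simp_all only: mod_less)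
      have regs': "\<And>r. r \<notin> {57, 58, 59} \<Longrightarrow> regs t' r = regs t r" and mem': "mem t' = (mem t)(u + Big := popcount u)"
        unfolding t'_def popcount_body_def by (simp_all add: r mods l pc)
      have sp': "space_used t' \<le> 6 * Big"
        unfolding t'_def popcount_body_def using sp u B by (simp add: r mods l pc)
      have "params t'" using t sp' by (simp add: setup_inv_def params_def regs')
      then show "setup_inv (Suc u) t' \<and> regs t' 38 = u \<and> regs t' 14 = M"
        using t u B by (auto simp: setup_inv_def regs' mem' less_Suc_eq)
    qed
  qed (use small in \<open>auto simp: setup_inv_def\<close>)
  then show ?thesis by (rule hoare_conseq) auto
qed

definition random_inv :: "nat \<Rightarrow> (nat \<Rightarrow> nat) \<Rightarrow> state \<Rightarrow> bool" where
  "random_inv x Z t \<longleftrightarrow> setup_inv M t \<and> (\<forall>y<x. mem t (3 * Big + y) = Z y)"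

lemma setup_inv_set_reg: "r \<ge> 30 \<Longrightarrow> setup_inv u (set_reg r v t) = setup_inv u t"
  by (auto simp: setup_inv_def)

lemma random_step:
  assumes x: "x < pw * K * M"
  shows "triple w (\<lambda>t. random_inv x Z t \<and> regs t 39 = x \<and> regs t 24 = pw * K * M) random_body (m * 11 + 12)
    (map_pmf (\<lambda>v. Z(x := v)) (pmf_of_set {..<M}))
    (\<lambda>Z' t. random_inv (Suc x) Z' t \<and> regs t 39 = x \<and> regs t 24 = pw * K * M)"
proof -
  note B = index_bounds word(1)
  let ?R = "\<lambda>t. random_inv x Z t \<and> regs t 39 = x \<and> regs t 24 = pw * K * M"
  \<comment> \<open>The bound on \<open>v\<close> excludes an overflow when the next bit is shifted
    in.\<close>
  let ?I = "\<lambda>i v t. ?R t \<and> regs t 60 = v \<and> v < 2 ^ i"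
  have head: "hoare w ?R (Bin 60 Add (Imm 0) (Imm 0)) 1 (\<lambda>t. ?I 0 0 t \<and> regs t 13 = m)"
    by (rule hoare_straight_le) (auto simp: random_inv_def setup_inv_set_reg setup_inv_def params_def)
  have mw: "m < 2 ^ w" using small(1) M less_exp[of m] by linarith
  let ?D = "\<lambda>_ v. map_pmf (\<lambda>b. 2 * v + of_bool b) (bernoulli_pmf (1 / 2))"
  have loop: "triple w (\<lambda>t. ?I 0 0 t \<and> regs t 13 = m) (For 78 79 13 (Flip 61;; Bin 60 Add (Reg 60) (Reg 60);; Bin 60 Add (Reg 60) (Reg 61)))
     (m * (5 + 6) + 6) (iterate_pmf ?D 0 m) (\<lambda>v t. ?I m v t \<and> regs t 13 = m)"
  proof (rule triple_For)
    fix i v assume i: "i < m"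
    have flip: "triple w (\<lambda>t. ?I i v t \<and> regs t 78 = i \<and> regs t 13 = m) (Flip 61) 1 (bernoulli_pmf (1 / 2))
       (\<lambda>b t. ?I i v t \<and> regs t 78 = i \<and> regs t 13 = m \<and> regs t 61 = of_bool b)"
      by (rule triple_Flip) (auto simp: random_inv_def setup_inv_set_reg of_bool_mod)
    have rest: "triple w (\<lambda>t. ?I i v t \<and> regs t 78 = i \<and> regs t 13 = m \<and> regs t 61 = of_bool b)
        (Bin 60 Add (Reg 60) (Reg 60);; Bin 60 Add (Reg 60) (Reg 61)) 3 (return_pmf (2 * v + of_bool b))
        (\<lambda>v t. ?I (Suc i) v t \<and> regs t 78 = i \<and> regs t 13 = m)" (is "triple w ?P ?c 3 _ _") for b
    proof -
      have "hoare w ?P ?c 3 (\<lambda>t. ?I (Suc i) (2 * v + of_bool b) t \<and> regs t 78 = i \<and> regs t 13 = m)"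
      proof (rule hoare_straight_le)
        fix t assume t: "?P t"
        have v: "v + 1 \<le> 2 ^ i" using t by simp
        have "(2::nat) ^ Suc i \<le> M" unfolding M using i by (intro power_increasing) auto
        moreover have b1: "2 * v + of_bool b < 2 ^ Suc i" using v by (cases b) auto
        ultimately have "2 * v < 2 ^ w" "2 * v + of_bool b < 2 ^ w" using small(1) by linarith+
        then have mods: "2 * v mod 2 ^ w = 2 * v" "(2 * v + of_bool b) mod 2 ^ w = 2 * v + of_bool b" by (simp_all only: mod_less)
        have vv: "v + v = 2 * v" by simp
        show "?I (Suc i) (2 * v + of_bool b) (eval_straight w ?c t) \<and> regs (eval_straight w ?c t) 78 = i \<and> regs (eval_straight w ?c t) 13 = m"
          using t b1 by (simp add: mods vv random_inv_def setup_inv_set_reg del: power_Suc)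
      qed simp_all
      then show ?thesis by (rule triple_conseq[OF triple_return]) auto
    qed
    have "triple w (\<lambda>t. ?I i v t \<and> regs t 78 = i \<and> regs t 13 = m) (Flip 61;; (Bin 60 Add (Reg 60) (Reg 60);; Bin 60 Add (Reg 60) (Reg 61)))
       (1 + 3 + 1) (bind_pmf (bernoulli_pmf (1 / 2)) (\<lambda>b. return_pmf (2 * v + of_bool b)))
       (\<lambda>v t. ?I (Suc i) v t \<and> regs t 78 = i \<and> regs t 13 = m)"
      by (rule triple_Seq[OF flip rest])
    then show "triple w (\<lambda>t. ?I i v t \<and> regs t 78 = i \<and> regs t 13 = m) (Flip 61;; Bin 60 Add (Reg 60) (Reg 60);; Bin 60 Add (Reg 60) (Reg 61))
       5 (?D i v) (\<lambda>v t. ?I (Suc i) v t \<and> regs t 78 = i \<and> regs t 13 = m)"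
      by (simp add: map_pmf_def)
  qed (use mw in \<open>auto simp: random_inv_def setup_inv_set_reg\<close>)
  have tail: "triple w (\<lambda>t. ?I m v t \<and> regs t 13 = m) (Bin 62 Add (Reg 20) (Reg 39);; Store (Reg 62) (Reg 60)) 3
     (return_pmf (Z(x := v))) (\<lambda>Z' t. random_inv (Suc x) Z' t \<and> regs t 39 = x \<and> regs t 24 = pw * K * M)" for v
  proof -
    let ?c = "Bin 62 Add (Reg 20) (Reg 39);; Store (Reg 62) (Reg 60)"
    have "hoare w (\<lambda>t. ?I m v t \<and> regs t 13 = m) ?c 3
      (\<lambda>t. random_inv (Suc x) (Z(x := v)) t \<and> regs t 39 = x \<and> regs t 24 = pw * K * M)"
    proof (rule hoare_straight_le)
      fix t assume t: "?I m v t \<and> regs t 13 = m"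
      define t' where "t' = eval_straight w ?c t"
      have r: "regs t 20 = 3 * Big" "regs t 39 = x" "regs t 60 = v" and sp: "space_used t \<le> 6 * Big"
        using t by (simp_all add: random_inv_def setup_inv_def params_def)
      have xB: "x + 3 < Big" using x B by linarith
      have mods: "(3 * Big + x) mod 2 ^ w = 3 * Big + x" using xB B by (intro mod_less) linarith
      have regs': "\<And>r. r \<noteq> 62 \<Longrightarrow> regs t' r = regs t r" and mem': "mem t' = (mem t)(3 * Big + x := v)"
        unfolding t'_def by (simp_all add: r mods)
      have sp': "space_used t' \<le> 6 * Big" unfolding t'_def using sp xB by (simp add: r mods)
      have "setup_inv M t'"
        using t sp' x B by (auto simp: random_inv_def setup_inv_def params_def regs' mem')
      then show "random_inv (Suc x) (Z(x := v)) t' \<and> regs t' 39 = x \<and> regs t' 24 = pw * K * M"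
        using t by (auto simp: random_inv_def regs' mem' less_Suc_eq)
    qed simp_all
    then show ?thesis by (rule triple_conseq[OF triple_return]) auto
  qed
  have "triple w ?R random_body (1 + ((m * (5 + 6) + 6) + 3 + 1) + 1)
    (bind_pmf (return_pmf ()) (\<lambda>_. bind_pmf (iterate_pmf ?D 0 m) (\<lambda>v. return_pmf (Z(x := v)))))
    (\<lambda>Z' t. random_inv (Suc x) Z' t \<and> regs t 39 = x \<and> regs t 24 = pw * K * M)"
    unfolding random_body_def by (rule triple_Seq[OF head triple_Seq[OF loop tail]])
  moreover have "bind_pmf (return_pmf ()) (\<lambda>_. bind_pmf (iterate_pmf ?D 0 m) (\<lambda>v. return_pmf (Z(x := v)))) =
      map_pmf (\<lambda>v. Z(x := v)) (pmf_of_set {..<M})"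
    using iterate_random_bits[of m] by (simp add: bind_return_pmf map_pmf_def M)
  ultimately have "triple w ?R random_body (1 + ((m * (5 + 6) + 6) + 3 + 1) + 1) (map_pmf (\<lambda>v. Z(x := v)) (pmf_of_set {..<M}))
      (\<lambda>Z' t. random_inv (Suc x) Z' t \<and> regs t 39 = x \<and> regs t 24 = pw * K * M)" by simp
  then show ?thesis by (rule triple_conseq) auto
qed

lemma random_correct:
  "triple w (setup_inv M) (For 39 49 24 random_body) (pw * K * M * (m * 11 + 18) + 6)
    (Pi_pmf {..<pw * K * M} 0 (\<lambda>_. pmf_of_set {..<M})) (\<lambda>Z. search_inv Z ({}, False))"
proof -
  have "triple w (\<lambda>t. random_inv 0 (\<lambda>_. 0) t \<and> regs t 24 = pw * K * M) (For 39 49 24 random_body)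
      (pw * K * M * ((m * 11 + 12) + 6) + 6)
      (iterate_pmf (\<lambda>x Z. map_pmf (\<lambda>v. Z(x := v)) (pmf_of_set {..<M})) (\<lambda>_. 0) (pw * K * M))
      (\<lambda>Z t. random_inv (pw * K * M) Z t \<and> regs t 24 = pw * K * M)"
    by (rule triple_For[OF random_step]) (use small in \<open>auto simp: random_inv_def setup_inv_set_reg\<close>)
  then show ?thesis unfolding iterate_random_words
  proof (rule triple_conseq)
    fix t assume "setup_inv M t"
    then show "random_inv 0 (\<lambda>_. 0) t \<and> regs t 24 = pw * K * M" by (simp add: random_inv_def setup_inv_def)
  next
    fix Z t assume "random_inv (pw * K * M) Z t \<and> regs t 24 = pw * K * M"
    then show "search_inv Z ({}, False) t"
      using index_bounds by (auto simp: random_inv_def setup_inv_def search_inv_def tables_def marks_def)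
  qed simp
qed

definition total_time :: nat where
  "total_time = e * 7 + d * 13 + M * 19 + pw * K * M * (m * 11 + 18) + pw * (n * (set_time + 6) + 12) + 104"

text \<open>The logical value is the table \<open>Z\<close>. It is complete before the search starts
  and everything later is deterministic, so only events about \<open>Z\<close> remain to be
  estimated.\<close>

lemma program_correct:
  "triple w (\<lambda>t. t = init_state inp) (program K e p q) total_time
    (Pi_pmf {..<pw * K * M} 0 (\<lambda>_. pmf_of_set {..<M})) (\<lambda>Z. search_inv Z (search Z pw))"
proof -
  let ?D = "Pi_pmf {..<pw * K * M} 0 (\<lambda>_. pmf_of_set {..<M})"
  have search': "triple w (search_inv Z ({}, False)) search_code (pw * (n * (set_time + 6) + 12) + 6) (return_pmf Z)
     (\<lambda>Z. search_inv Z (search Z pw))" for Z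
    by (rule triple_conseq[OF triple_return[OF search_correct[of Z]]]) auto
  have rand: "triple w (setup_inv M) (For 39 49 24 random_body;; search_code)
     ((pw * K * M * (m * 11 + 18) + 6) + (pw * (n * (set_time + 6) + 12) + 6) + 1) (bind_pmf ?D return_pmf)
     (\<lambda>Z. search_inv Z (search Z pw))"
    by (rule triple_Seq[OF random_correct search'])
  note C = triple_Seq[OF read_correct triple_Seq[OF power_correct triple_Seq[OF size_correct triple_Seq[OF binomial_correct
     triple_Seq[OF layout_correct triple_Seq[OF popcount_correct rand]]]]]]
  have "triple w (\<lambda>t. t = init_state inp) (program K e p q)
    (21 + (e * 7 + 6 + (7 + (d * 13 + 6 + (33 + (M * 19 + 6 + ((pw * K * M * (m * 11 + 18) + 6) + (pw * (n * (set_time + 6) + 12) + 6) + 1) + 1) + 1) + 1) + 1) + 1) + 1)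
    ?D (\<lambda>Z. search_inv Z (search Z pw))"
    using C by (simp add: program_def bind_return_pmf bind_return_pmf')
  then show ?thesis by (rule triple_conseq) (auto simp: total_time_def)
qed

end

section \<open>Random families\<close>

text \<open>Entries from \<open>M\<close> on get the default, because the functions drawn from
  \<open>Pi_pmf {..<M} z\<close> take the value \<open>z\<close> outside their index set.\<close>

definition chunk :: "nat \<Rightarrow> 'a \<Rightarrow> (nat \<Rightarrow> 'a) \<Rightarrow> nat \<Rightarrow> nat \<Rightarrow> 'a" where
  "chunk M z f e = (\<lambda>u. if u < M then f (e * M + u) else z)"

text \<open>Disjoint index sets are independent: the induction splits off the last chunk with
  \<open>Pi_pmf_union\<close> and shifts its index set to \<open>{..<M}\<close>.\<close>

lemma Pi_pmf_chunk:
  "map_pmf (\<lambda>f e. if e < N then chunk M z f e else (\<lambda>_. z)) (Pi_pmf {..<N * M} z (\<lambda>_. p)) =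
   Pi_pmf {..<N} (\<lambda>_. z) (\<lambda>_. Pi_pmf {..<M} z (\<lambda>_. p))"
proof (induction N)
  case 0
  then show ?case by simp
next
  case (Suc N)
  let ?B = "{N * M..<N * M + M}"
  let ?c = "\<lambda>N f e. if e < N then chunk M z f e else (\<lambda>_. z)"
  have U: "{..<Suc N * M} = {..<N * M} \<union> ?B" by auto
  have shift: "Pi_pmf {..<M} z (\<lambda>_. p) = map_pmf (\<lambda>g u. g (N * M + u)) (Pi_pmf ?B z (\<lambda>_. p))"
  proof -
    have "bij_betw (\<lambda>u. N * M + u) {..<M} ?B"
      by (intro bij_betwI[where g = "\<lambda>u. u - N * M"]) auto
    then show ?thesis
      using Pi_pmf_bij_betw[of "{..<M}" "\<lambda>u. N * M + u" ?B z p] by (simp add: o_def)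
  qed
  have shift': "map_pmf (\<lambda>g. chunk M z g N) (Pi_pmf ?B z (\<lambda>_. p)) = Pi_pmf {..<M} z (\<lambda>_. p)"
  proof -
    have "map_pmf (\<lambda>g. chunk M z g N) (Pi_pmf ?B z (\<lambda>_. p)) =
        map_pmf (\<lambda>g u. g (N * M + u)) (Pi_pmf ?B z (\<lambda>_. p))"
    proof (rule map_pmf_cong)
      fix g assume "g \<in> set_pmf (Pi_pmf ?B z (\<lambda>_. p))"
      then have "g (N * M + u) = z" if "u \<ge> M" for u
        using set_Pi_pmf_subset[of ?B z "\<lambda>_. p"] that by auto
      then show "chunk M z g N = (\<lambda>u. g (N * M + u))" by (auto simp: chunk_def fun_eq_iff)
    qed simp
    then show ?thesis using shift by simp
  qed
  have "map_pmf (?c (Suc N)) (Pi_pmf {..<Suc N * M} z (\<lambda>_. p)) =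
      map_pmf (\<lambda>(f, g). (?c N f)(N := chunk M z g N))
        (pair_pmf (Pi_pmf {..<N * M} z (\<lambda>_. p)) (Pi_pmf ?B z (\<lambda>_. p)))"
  proof -
    have "?c (Suc N) (\<lambda>x. if x \<in> {..<N * M} then f x else g x) = (?c N f)(N := chunk M z g N)" for f g :: "nat \<Rightarrow> 'a"
    proof -
      have lt: "e * M + u < N * M" if "e < N" "u < M" for e u
      proof -
        have "e * M + u < Suc e * M" using that by simp
        also have "\<dots> \<le> N * M" using that by (intro mult_right_mono) auto
        finally show ?thesis .
      qed
      show ?thesis by (auto simp: fun_eq_iff chunk_def less_Suc_eq lt)
    qed
    note eq = this
    show ?thesis
      unfolding U by (subst Pi_pmf_union, simp, simp, force) (simp only: pmf.map_comp o_def case_prod_unfold eq)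
  qed
  also have "\<dots> = map_pmf (\<lambda>(f, y). f(N := y))
      (pair_pmf (map_pmf (?c N) (Pi_pmf {..<N * M} z (\<lambda>_. p))) (map_pmf (\<lambda>g. chunk M z g N) (Pi_pmf ?B z (\<lambda>_. p))))"
    by (simp add: pair_map_pmf1 pair_map_pmf2 pmf.map_comp o_def case_prod_unfold)
  also have "\<dots> = map_pmf (\<lambda>(f, y). f(N := y))
      (pair_pmf (Pi_pmf {..<N} (\<lambda>_. z) (\<lambda>_. Pi_pmf {..<M} z (\<lambda>_. p))) (Pi_pmf {..<M} z (\<lambda>_. p)))"
    unfolding Suc.IH shift' ..
  also have "\<dots> = Pi_pmf (insert N {..<N}) (\<lambda>_. z) (\<lambda>_. Pi_pmf {..<M} z (\<lambda>_. p))"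
    by (subst Pi_pmf_insert, simp, simp, subst pair_commute_pmf) (simp add: pmf.map_comp o_def case_prod_unfold)
  also have "insert N {..<N} = {..<Suc N}" by auto
  finally show ?case .
qed

lemma prob_Pi_pmf_some:
  assumes "finite A" "S \<subseteq> A" "\<And>x. x \<in> S \<Longrightarrow> measure_pmf.prob (p x) (E x) \<ge> a" "0 \<le> a" "a \<le> 1"
  shows "measure_pmf.prob (Pi_pmf A z p) {f. \<exists>x\<in>S. f x \<in> E x} \<ge> 1 - (1 - a) ^ card S"
proof -
  have "measure_pmf.prob (Pi_pmf A z p) {f. \<forall>x\<in>S. f x \<notin> E x} =
      measure_pmf.prob (Pi_pmf A z p) (Pi A (\<lambda>x. if x \<in> S then - E x else UNIV))"
    using assms(2) by (intro arg_cong[where f = "measure_pmf.prob (Pi_pmf A z p)"]) (auto simp: Pi_def)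
  also have "\<dots> = (\<Prod>x\<in>A. measure_pmf.prob (p x) (if x \<in> S then - E x else UNIV))"
    by (rule measure_Pi_pmf_Pi[OF assms(1)])
  also have "\<dots> = (\<Prod>x\<in>S. measure_pmf.prob (p x) (- E x))"
    using assms(1,2) by (intro prod.mono_neutral_cong_right) auto
  also have "\<dots> \<le> (\<Prod>x\<in>S. 1 - a)"
  proof (intro prod_mono)
    fix x assume "x \<in> S"
    then show "0 \<le> measure_pmf.prob (p x) (- E x) \<and> measure_pmf.prob (p x) (- E x) \<le> 1 - a"
      using assms(3)[of x] measure_pmf.prob_compl[of "E x" "p x"] by (simp add: Compl_eq_Diff_UNIV)
  qed
  finally have "measure_pmf.prob (Pi_pmf A z p) {f. \<forall>x\<in>S. f x \<notin> E x} \<le> (1 - a) ^ card S" by simp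
  moreover have "{f. \<exists>x\<in>S. f x \<in> E x} = UNIV - {f. \<forall>x\<in>S. f x \<notin> E x}" by auto
  ultimately show ?thesis
    using measure_pmf.prob_compl[of "{f. \<forall>x\<in>S. f x \<notin> E x}" "Pi_pmf A z p"] by simp
qed

lemma prob_Pi_pmf_all:
  assumes "finite A" "\<And>x. x \<in> A \<Longrightarrow> measure_pmf.prob (p x) (E x) \<ge> a" "0 \<le> a"
  shows "measure_pmf.prob (Pi_pmf A z p) {f. \<forall>x\<in>A. f x \<in> E x} \<ge> a ^ card A"
proof -
  have "{f. \<forall>x\<in>A. f x \<in> E x} = Pi A E" by (auto simp: Pi_def)
  then have "measure_pmf.prob (Pi_pmf A z p) {f. \<forall>x\<in>A. f x \<in> E x} = (\<Prod>x\<in>A. measure_pmf.prob (p x) (E x))"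
    using measure_Pi_pmf_Pi[OF assms(1)] by simp
  moreover have "(\<Prod>x\<in>A. a) \<le> (\<Prod>x\<in>A. measure_pmf.prob (p x) (E x))"
    using assms by (intro prod_mono) auto
  ultimately show ?thesis by simp
qed

text \<open>The flat table is regrouped twice, into rounds and each round into blocks. Independent
  blocks make a round good with probability at least \<open>a ^ K\<close>; independent rounds
  multiply the failure probabilities over \<open>S\<close>.\<close>

lemma chunk_success:
  fixes E :: "nat \<Rightarrow> nat \<Rightarrow> (nat \<Rightarrow> 'a) set" and N K M :: nat
  assumes E: "\<And>t i. t \<in> S \<Longrightarrow> i < K \<Longrightarrow> measure_pmf.prob (Pi_pmf {..<M} z (\<lambda>_. p)) (E t i) \<ge> a"
    and a: "0 \<le> a" "a \<le> 1" and S: "S \<subseteq> {..<N}"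
  shows "measure_pmf.prob (Pi_pmf {..<N * K * M} z (\<lambda>_. p))
    {f. \<exists>t\<in>S. \<forall>i<K. chunk M z f (t * K + i) \<in> E t i} \<ge> 1 - (1 - a ^ K) ^ card S"
proof -
  let ?D = "Pi_pmf {..<M} z (\<lambda>_. p)"
  let ?c = "\<lambda>f e. if e < N * K then chunk M z f e else (\<lambda>_. z)"
  let ?c2 = "\<lambda>g t. if t < N then chunk K (\<lambda>_. z) g t else (\<lambda>_ _. z)"
  have "1 - (1 - a ^ K) ^ card S \<le>
     measure_pmf.prob (Pi_pmf {..<N} (\<lambda>_ _. z) (\<lambda>_. Pi_pmf {..<K} (\<lambda>_. z) (\<lambda>_. ?D)))
       {h. \<exists>t\<in>S. h t \<in> {g. \<forall>i\<in>{..<K}. g i \<in> E t i}}"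
  proof (rule prob_Pi_pmf_some)
    fix t assume "t \<in> S"
    then show "a ^ K \<le> measure_pmf.prob (Pi_pmf {..<K} (\<lambda>_. z) (\<lambda>_. ?D)) {g. \<forall>i\<in>{..<K}. g i \<in> E t i}"
      using prob_Pi_pmf_all[of "{..<K}" a "\<lambda>_. ?D" "E t" "\<lambda>_. z"] E a by simp
  qed (use a S in \<open>auto simp: power_le_one\<close>)
  also have "\<dots> = measure_pmf.prob (Pi_pmf {..<N * K} (\<lambda>_. z) (\<lambda>_. ?D))
       (?c2 -` {h. \<exists>t\<in>S. h t \<in> {g. \<forall>i\<in>{..<K}. g i \<in> E t i}})"
    unfolding Pi_pmf_chunk[symmetric, of N "\<lambda>_. z" K] by simp
  also have "\<dots> = measure_pmf.prob (Pi_pmf {..<N * K * M} z (\<lambda>_. p))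
       (?c -` (?c2 -` {h. \<exists>t\<in>S. h t \<in> {g. \<forall>i\<in>{..<K}. g i \<in> E t i}}))"
    unfolding Pi_pmf_chunk[symmetric, of "N * K" z M] by simp
  also have "?c -` (?c2 -` {h. \<exists>t\<in>S. h t \<in> {g. \<forall>i\<in>{..<K}. g i \<in> E t i}}) =
     {f. \<exists>t\<in>S. \<forall>i<K. chunk M z f (t * K + i) \<in> E t i}"
  proof -
    have lt: "t * K + i < N * K" if "t \<in> S" "i < K" for t i
    proof -
      have "t * K + i < Suc t * K" using that by simp
      also have "\<dots> \<le> N * K" using that S by (intro mult_right_mono) auto
      finally show ?thesis .
    qed
    have "(\<forall>i\<in>{..<K}. ?c2 (?c f) t i \<in> E t i) = (\<forall>i<K. chunk M z f (t * K + i) \<in> E t i)" if "t \<in> S" for f t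
    proof -
      have "?c2 (?c f) t i = chunk M z f (t * K + i)" if "i < K" for i
        using lt[OF \<open>t \<in> S\<close> that] \<open>t \<in> S\<close> S that by (auto simp: chunk_def[of K])
      then show ?thesis by auto
    qed
    then show ?thesis unfolding vimage_def mem_Collect_eq by (intro Collect_cong bex_cong refl)
  qed
  finally show ?thesis .
qed

text \<open>\<open>U\<close> stands for the words covering the pair in one block, \<open>V\<close>
  and \<open>W\<close> for those compatible with one of its members. The expected number of hits in
  \<open>U\<close> is at least 1, so all are missed with probability at most 1/2; by Markov's
  inequality each of the other counts exceeds 8 times its mean with probability at most 1/8.\<close>

lemma cell_success:
  fixes M \<theta> :: nat and U V W :: "nat set"
  assumes M: "M > 0" and \<theta>: "\<theta> \<le> M" and sub: "U \<subseteq> {..<M}" "V \<subseteq> {..<M}" "W \<subseteq> {..<M}"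
    and U: "real M \<le> real (card U) * real \<theta>"
    and V: "card V > 0" and W: "card W > 0"
  defines "D \<equiv> Pi_pmf {..<M} 0 (\<lambda>_. pmf_of_set {..<M})"
  shows "measure_pmf.prob D {Z. (\<exists>u\<in>U. Z u < \<theta>) \<and>
     real (card {u\<in>V. Z u < \<theta>}) \<le> 8 * real (card V) * real \<theta> / real M \<and>
     real (card {u\<in>W. Z u < \<theta>}) \<le> 8 * real (card W) * real \<theta> / real M} \<ge> 1 / 4"
proof -
  define x where "x = real \<theta> / real M"
  have one: "measure_pmf.prob (pmf_of_set {..<M}) {..<\<theta>} = x"
    using M \<theta> by (subst measure_pmf_of_set) (auto simp: x_def min_def Int_absorb1)
  have x: "0 < x" "x \<le> 1" using one U M unfolding x_def by (auto intro!: divide_pos_pos) (use \<theta> in \<open>auto intro: Nat.gr0I\<close>)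
  have fin: "finite U" "finite V" "finite W" using sub finite_subset by blast+
  have "measure_pmf.prob D {Z. \<exists>u\<in>U. Z u \<in> {..<\<theta>}} \<ge> 1 - (1 - x) ^ card U"
    unfolding D_def using one x sub by (intro prob_Pi_pmf_some) auto
  moreover have "(1 - x) ^ card U \<le> 1 / 2"
  proof -
    have "(1 - x) ^ card U \<le> exp (- x) ^ card U"
      using exp_ge_add_one_self[of "- x"] x by (intro power_mono) auto
    also have "\<dots> = exp (- (card U * x))" by (simp flip: exp_of_nat_mult)
    also have "\<dots> \<le> exp (- 1)" using U M by (simp add: x_def field_simps)
    also have "\<dots> \<le> 1 / 2" using exp_ge_add_one_self[of 1] by (simp add: exp_minus field_simps)
    finally show ?thesis .
  qed
  ultimately have A: "measure_pmf.prob D {Z. \<exists>u\<in>U. Z u < \<theta>} \<ge> 1 / 2" by simp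
  have markov: "measure_pmf.prob D {Z. real (card {u\<in>V. Z u < \<theta>}) > 8 * real (card V) * x} \<le> 1 / 8"
    if V: "V \<subseteq> {..<M}" "card V > 0" for V
  proof -
    define f where "f Z = (\<Sum>u\<in>V. of_bool (Z u < \<theta>) :: real)" for Z :: "nat \<Rightarrow> nat"
    have fV: "finite V" using V finite_subset by blast
    have f: "f Z = real (card {u\<in>V. Z u < \<theta>})" for Z
    proof -
      have "f Z = (\<Sum>u\<in>{u\<in>V. Z u < \<theta>}. 1)" unfolding f_def using fV
        by (intro sum.mono_neutral_cong_right) auto
      then show ?thesis by simp
    qed
    have int: "integrable (measure_pmf D) (\<lambda>Z. of_bool (Z u < \<theta>) :: real)" for u
      by (rule measure_pmf.integrable_const_bound[where B = 1]) auto
    have "measure_pmf.expectation D (\<lambda>Z. of_bool (Z u < \<theta>) :: real) = x" if "u \<in> V" for u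
    proof -
      have "measure_pmf.expectation D (\<lambda>Z. of_bool (Z u < \<theta>) :: real) =
          measure_pmf.expectation D (indicator ((\<lambda>Z. Z u) -` {..<\<theta>}))"
        by (intro Bochner_Integration.integral_cong) (auto simp: indicator_def)
      also have "\<dots> = measure_pmf.prob (map_pmf (\<lambda>Z. Z u) D) {..<\<theta>}" by simp
      also have "map_pmf (\<lambda>Z. Z u) D = pmf_of_set {..<M}"
        unfolding D_def using that V by (subst Pi_pmf_component) auto
      finally show ?thesis using one by simp
    qed
    then have E: "measure_pmf.expectation D f = card V * x"
      unfolding f_def[abs_def] using int by (subst Bochner_Integration.integral_sum) auto
    have "integrable (measure_pmf D) f" "AE Z in measure_pmf D. 0 \<le> f Z"
      unfolding f_def[abs_def] using int by (auto intro!: sum_nonneg)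
    then have "measure_pmf.prob D {Z. 8 * real (card V) * x \<le> f Z} \<le> measure_pmf.expectation D f / (8 * real (card V) * x)"
      using integral_Markov_inequality_measure[of "measure_pmf D" f UNIV "8 * real (card V) * x"] x V by simp
    also have "\<dots> = 1 / 8" unfolding E using x V by simp
    finally have "measure_pmf.prob D {Z. 8 * real (card V) * x \<le> f Z} \<le> 1 / 8" .
    moreover have "measure_pmf.prob D {Z. real (card {u\<in>V. Z u < \<theta>}) > 8 * real (card V) * x} \<le>
        measure_pmf.prob D {Z. 8 * real (card V) * x \<le> f Z}"
      by (intro measure_pmf.finite_measure_mono) (auto simp: f)
    ultimately show ?thesis by simp
  qed
  let ?A = "{Z. \<exists>u\<in>U. Z u < \<theta>}"
  let ?B = "\<lambda>V. {Z. real (card {u\<in>V. Z u < \<theta>}) > 8 * real (card V) * x}"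
  have "measure_pmf.prob D ?A \<le> measure_pmf.prob D ((?A - ?B V - ?B W) \<union> (?B V \<union> ?B W))"
    by (intro measure_pmf.finite_measure_mono) auto
  also have "\<dots> \<le> measure_pmf.prob D (?A - ?B V - ?B W) + (measure_pmf.prob D (?B V) + measure_pmf.prob D (?B W))"
    by (intro order_trans[OF measure_subadditive] add_left_mono measure_subadditive) (auto simp: measure_pmf.emeasure_eq_measure)
  finally have "1 / 4 \<le> measure_pmf.prob D (?A - ?B V - ?B W)"
    using A markov[OF sub(2) V] markov[OF sub(3) W] by linarith
  also have "?A - ?B V - ?B W = {Z. (\<exists>u\<in>U. Z u < \<theta>) \<and>
     real (card {u\<in>V. Z u < \<theta>}) \<le> 8 * real (card V) * real \<theta> / real M \<and>
     real (card {u\<in>W. Z u < \<theta>}) \<le> 8 * real (card W) * real \<theta> / real M}"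
    by (auto simp: x_def not_less)
  finally show ?thesis .
qed

section \<open>Binomial coefficients and exponents\<close>

text \<open>One term of the binomial expansion of 1. Since \<open>p\<close> is free, this bounds
  \<open>n choose j\<close> by an expression geometric in \<open>j\<close> and \<open>n - j\<close>,
  a form that survives products over blocks of different shape.\<close>

lemma binomial_mass_le_1:
  fixes p :: real
  assumes "0 \<le> p" "p \<le> 1" "j \<le> n"
  shows "(n choose j) * p ^ j * (1 - p) ^ (n - j) \<le> 1"
proof -
  have "(n choose j) * p ^ j * (1 - p) ^ (n - j) \<le> (\<Sum>j\<le>n. (n choose j) * p ^ j * (1 - p) ^ (n - j))"
    using assms by (intro member_le_sum) auto
  also have "\<dots> = 1" by (simp flip: binomial_ring)
  finally show ?thesis .
qed

lemma binomial_mode_index_le: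
  fixes p :: real
  assumes "0 < p" "p < 1"
  shows "nat \<lfloor>p * (real n + 1)\<rfloor> \<le> n"
proof -
  have "p * (real n + 1) < real n + 1" using assms by simp
  then have "\<lfloor>p * (real n + 1)\<rfloor> \<le> int n" by linarith
  then show ?thesis by linarith
qed

text \<open>\<open>y\<close> is a mode of the binomial distribution, so its term is at least the
  average of \<open>n + 1\<close> terms with sum 1.\<close>

lemma binomial_mode_ge:
  fixes p :: real and n :: nat
  assumes p: "0 < p" "p < 1"
  defines "y \<equiv> nat \<lfloor>p * (real n + 1)\<rfloor>"
  shows "1 \<le> (real n + 1) * ((n choose y) * p ^ y * (1 - p) ^ (n - y))"
proof -
  define t where "t j = (n choose j) * p ^ j * (1 - p) ^ (n - j)" for j
  have y: "y \<le> n" unfolding y_def by (rule binomial_mode_index_le[OF p])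
  have ypos: "real y \<le> p * (real n + 1)" "p * (real n + 1) < real y + 1"
    using p unfolding y_def by (auto simp: of_nat_floor)
  have tpos: "t j \<ge> 0" for j using p by (simp add: t_def)
  have rec: "t (Suc j) * ((real j + 1) * (1 - p)) = t j * ((real n - real j) * p)" if "j < n" for j
  proof -
    have "(Suc j) * (n choose Suc j) = (n - j) * (n choose j)"
      by (simp only: binomial_absorption binomial_absorb_comp)
    then have "real (Suc j) * real (n choose Suc j) = real (n - j) * real (n choose j)"
      by (metis of_nat_mult)
    then have 1: "(real j + 1) * real (n choose Suc j) = (real n - real j) * real (n choose j)"
      using that by (simp add: of_nat_diff add.commute)
    have 2: "n - j = Suc (n - Suc j)" using that by simp
    have "t (Suc j) * ((real j + 1) * (1 - p)) =
        ((real j + 1) * real (n choose Suc j)) * p ^ Suc j * ((1 - p) ^ (n - Suc j) * (1 - p))"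
      by (simp add: t_def algebra_simps)
    also have "\<dots> = t j * ((real n - real j) * p)"
      unfolding 1 t_def 2 by (simp add: algebra_simps)
    finally show ?thesis .
  qed
  \<comment> \<open>By \<open>rec\<close> the ratio of consecutive terms crosses 1 where
    \<open>j + 1\<close> crosses \<open>p * (n + 1)\<close>.\<close>
  have up: "t j \<le> t (Suc j)" if "j < y" for j
  proof -
    have jn: "j < n" using that y by simp
    have "real j + 1 \<le> p * (real n + 1)" using that ypos by linarith
    then have "(real j + 1) * (1 - p) \<le> (real n - real j) * p" by (simp add: algebra_simps)
    then have "t j * ((real j + 1) * (1 - p)) \<le> t (Suc j) * ((real j + 1) * (1 - p))"
      unfolding rec[OF jn] using tpos by (intro mult_left_mono)
    then show ?thesis using p by (simp add: mult_le_cancel_right)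
  qed
  have down: "t (Suc j) \<le> t j" if "y \<le> j" "j < n" for j
  proof -
    have "p * (real n + 1) \<le> real j + 1" using that ypos by linarith
    then have "(real n - real j) * p \<le> (real j + 1) * (1 - p)" by (simp add: algebra_simps)
    then have "t (Suc j) * ((real j + 1) * (1 - p)) \<le> t j * ((real j + 1) * (1 - p))"
      unfolding rec[OF that(2)] using tpos by (intro mult_left_mono)
    then show ?thesis using p by (simp add: mult_le_cancel_right)
  qed
  have "t j \<le> t y" if "j \<le> n" for j
  proof (cases "j \<le> y")
    case True
    then show ?thesis
    proof (induction rule: inc_induct)
      case (step i)
      then show ?case using up[of i] by simp
    qed simp
  next
    case False
    then have "y \<le> j" by simp
    then show ?thesis using that
    proof (induction rule: dec_induct)
      case (step i)
      then show ?case using down[of i] by simp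
    qed simp
  qed
  then have "(\<Sum>j\<le>n. t j) \<le> (\<Sum>j\<le>n. t y)" by (intro sum_mono) auto
  moreover have "(\<Sum>j\<le>n. t j) = 1" by (simp add: t_def flip: binomial_ring)
  ultimately show ?thesis by (simp add: t_def add.commute)
qed

text \<open>\<open>max r (1 / r)\<close> is at least 1 on either side of \<open>r = 1\<close>; its
  power pays for rounding an exponent in either direction.\<close>

lemma powr_perturb:
  fixes r :: real
  assumes "0 < r" "\<bar>x - y\<bar> \<le> e"
  shows "r powr x \<le> max r (1 / r) powr e * r powr y"
proof -
  have "r powr (x - y) \<le> max r (1 / r) powr \<bar>x - y\<bar>"
  proof (cases "x - y \<ge> 0")
    case True
    then show ?thesis using assms by (auto intro!: powr_mono2)
  next
    case False
    have "r powr (x - y) = (1 / r) powr \<bar>x - y\<bar>"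
      using False assms by (simp add: powr_divide powr_minus divide_simps flip: powr_add)
    also have "\<dots> \<le> max r (1 / r) powr \<bar>x - y\<bar>" using assms by (intro powr_mono2) auto
    finally show ?thesis .
  qed
  also have "\<dots> \<le> max r (1 / r) powr e"
    using assms by (intro powr_mono) (auto simp: le_max_iff_disj)
  finally have "r powr (x - y) * r powr y \<le> max r (1 / r) powr e * r powr y"
    by (rule mult_right_mono) simp
  then show ?thesis using assms by (simp flip: powr_add)
qed

text \<open>The bounds on the factors are geometric in \<open>y i\<close>, \<open>c i - y i\<close>
  and \<open>g i\<close> with common bases, so their product depends only on sums. Rounding costs a
  constant per block and the slack in the sum of \<open>c\<close> one more, so \<open>Q\<close> does
  not depend on \<open>d\<close>, \<open>m\<close> or the shape of the blocks.\<close>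

lemma product_bound:
  fixes R S W \<rho> \<beta> \<gamma> :: real and K :: nat
  assumes pos: "0 < R" "0 < S" "0 < W" and \<rho>: "0 < \<rho>" "\<rho> < 1"
  shows "\<exists>Q>0. \<forall>d m c g y f.
     (\<forall>i<K. c i \<le> m) \<and>
     (\<forall>i<K. y i = nat \<lfloor>\<rho> * (real (c i) + 1)\<rfloor>) \<and>
     (\<forall>i<K. f i \<ge> 0 \<and> f i \<le> (real (c i) + 1) * R ^ y i * S ^ (c i - y i) * W ^ g i) \<and>
     \<bar>(\<Sum>i<K. real (c i)) - \<gamma> * real d\<bar> \<le> real K \<and>
     (\<Sum>i<K. real (g i)) = \<beta> * real d \<longrightarrow>
     (\<Prod>i<K. f i) \<le> Q * (real m + 1) ^ K *
        exp (real d * (\<rho> * \<gamma> * ln R + (1 - \<rho>) * \<gamma> * ln S + \<beta> * ln W))"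
proof -
  define MR where "MR = max R (1 / R)"
  define MS where "MS = max S (1 / S)"
  have MRS: "MR > 0" "MS > 0" using pos by (auto simp: MR_def MS_def max_def)
  define Q where "Q = MR ^ K * MS ^ K * (MR powr (\<rho> * K) * MS powr ((1 - \<rho>) * K))"
  have Q: "Q > 0" using MRS by (simp add: Q_def)
  show ?thesis
  proof (intro exI[of _ Q] conjI Q allI impI, elim conjE)
    fix d m :: nat and c g y :: "nat \<Rightarrow> nat" and f :: "nat \<Rightarrow> real"
    assume cm: "\<forall>i<K. c i \<le> m" and y: "\<forall>i<K. y i = nat \<lfloor>\<rho> * (real (c i) + 1)\<rfloor>"
      and f: "\<forall>i<K. f i \<ge> 0 \<and> f i \<le> (real (c i) + 1) * R ^ y i * S ^ (c i - y i) * W ^ g i"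
      and sc: "\<bar>(\<Sum>i<K. real (c i)) - \<gamma> * real d\<bar> \<le> real K"
      and sg: "(\<Sum>i<K. real (g i)) = \<beta> * real d"
    define C where "C = (\<Sum>i<K. real (c i))"
    have fi: "f i \<le> (real m + 1) * (MR * R powr (\<rho> * c i)) * (MS * S powr ((1 - \<rho>) * c i)) * W powr g i"
      if "i < K" for i
    proof -
      have yc: "y i \<le> c i" using y that binomial_mode_index_le[OF \<rho>] by simp
      have "real (y i) \<le> \<rho> * (real (c i) + 1)" "\<rho> * (real (c i) + 1) < real (y i) + 1"
        using y that \<rho> by (auto simp: of_nat_floor)
      then have "\<rho> * real (c i) + \<rho> - 1 \<le> real (y i)" "real (y i) \<le> \<rho> * real (c i) + \<rho>"
        by (auto simp: algebra_simps)
      then have d: "\<bar>real (y i) - \<rho> * c i\<bar> \<le> 1" "\<bar>real (c i - y i) - (1 - \<rho>) * c i\<bar> \<le> 1"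
        using yc \<rho> by (auto simp: of_nat_diff algebra_simps abs_le_iff)
      have 1: "R ^ y i \<le> MR * R powr (\<rho> * c i)"
        using powr_perturb[OF pos(1) d(1)] pos MRS by (simp add: powr_realpow MR_def)
      have 2: "S ^ (c i - y i) \<le> MS * S powr ((1 - \<rho>) * c i)"
        using powr_perturb[OF pos(2) d(2)] pos MRS by (simp add: powr_realpow MS_def)
      have "f i \<le> (real (c i) + 1) * R ^ y i * S ^ (c i - y i) * W ^ g i" using f that by simp
      also have "\<dots> \<le> (real m + 1) * (MR * R powr (\<rho> * c i)) * (MS * S powr ((1 - \<rho>) * c i)) * W ^ g i"
        using 1 2 cm that pos MRS by (intro mult_mono mult_nonneg_nonneg) auto
      finally show ?thesis using pos by (simp add: powr_realpow)
    qed
    have R: "R powr (\<rho> * C) \<le> MR powr (\<rho> * K) * R powr (\<rho> * \<gamma> * d)"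
    proof -
      have "\<bar>\<rho> * C - \<rho> * \<gamma> * d\<bar> = \<rho> * \<bar>C - \<gamma> * d\<bar>"
        using \<rho> abs_mult[of \<rho> "C - \<gamma> * d"] by (simp add: algebra_simps)
      also have "\<dots> \<le> \<rho> * K" using sc \<rho> by (intro mult_left_mono) (auto simp: C_def)
      finally show ?thesis using powr_perturb[OF pos(1)] by (simp add: MR_def)
    qed
    have S: "S powr ((1 - \<rho>) * C) \<le> MS powr ((1 - \<rho>) * K) * S powr ((1 - \<rho>) * \<gamma> * d)"
    proof -
      have "\<bar>(1 - \<rho>) * C - (1 - \<rho>) * \<gamma> * d\<bar> = (1 - \<rho>) * \<bar>C - \<gamma> * d\<bar>"
        using \<rho> abs_mult[of "1 - \<rho>" "C - \<gamma> * d"] by (simp add: algebra_simps)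
      also have "\<dots> \<le> (1 - \<rho>) * K" using sc \<rho> by (intro mult_left_mono) (auto simp: C_def)
      finally show ?thesis using powr_perturb[OF pos(2)] by (simp add: MS_def)
    qed
    have E: "R powr (\<rho> * \<gamma> * d) * S powr ((1 - \<rho>) * \<gamma> * d) * W powr (\<beta> * d) =
       exp (real d * (\<rho> * \<gamma> * ln R + (1 - \<rho>) * \<gamma> * ln S + \<beta> * ln W))"
    proof -
      have "real d * (\<rho> * \<gamma> * ln R + (1 - \<rho>) * \<gamma> * ln S + \<beta> * ln W) =
          \<rho> * \<gamma> * d * ln R + (1 - \<rho>) * \<gamma> * d * ln S + \<beta> * d * ln W" by (simp add: distrib_left mult_ac)
      then show ?thesis using pos by (simp add: powr_def exp_add)
    qed
    have "(\<Prod>i<K. f i) \<le> (\<Prod>i<K. (real m + 1) * (MR * R powr (\<rho> * c i)) * (MS * S powr ((1 - \<rho>) * c i)) * W powr g i)"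
      by (intro prod_mono) (use f fi in auto)
    also have "\<dots> = (real m + 1) ^ K * (MR ^ K * R powr (\<rho> * C)) * (MS ^ K * S powr ((1 - \<rho>) * C)) * W powr (\<beta> * d)"
    proof -
      have "(\<Prod>i<K. R powr (\<rho> * c i)) = R powr (\<rho> * C)" "(\<Prod>i<K. S powr ((1 - \<rho>) * c i)) = S powr ((1 - \<rho>) * C)"
        using pos unfolding C_def sum_distrib_left by (simp_all add: powr_sum)
      moreover have "(\<Prod>i<K. W powr g i) = W powr (\<beta> * d)"
        using pos unfolding sg[symmetric] by (simp add: powr_sum)
      ultimately show ?thesis unfolding prod.distrib prod_constant by simp
    qed
    also have "\<dots> \<le> (real m + 1) ^ K * (MR ^ K * (MR powr (\<rho> * K) * R powr (\<rho> * \<gamma> * d))) *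
         (MS ^ K * (MS powr ((1 - \<rho>) * K) * S powr ((1 - \<rho>) * \<gamma> * d))) * W powr (\<beta> * d)"
      using R S MRS by (intro mult_right_mono mult_mono mult_left_mono) auto
    also have "\<dots> =
        Q * (real m + 1) ^ K * (R powr (\<rho> * \<gamma> * d) * S powr ((1 - \<rho>) * \<gamma> * d) * W powr (\<beta> * d))"
      by (simp add: Q_def mult_ac)
    also have "\<dots> = Q * (real m + 1) ^ K *
        exp (real d * (\<rho> * \<gamma> * ln R + (1 - \<rho>) * \<gamma> * ln S + \<beta> * ln W))"
      using E by simp
    finally show "(\<Prod>i<K. f i) \<le> Q * (real m + 1) ^ K *
        exp (real d * (\<rho> * \<gamma> * ln R + (1 - \<rho>) * \<gamma> * ln S + \<beta> * ln W))" .
  qed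
qed

section \<open>Numerical analysis of the exponent\<close>

lemma minus_ln_one_minus_ge:
  fixes x :: real
  assumes "0 \<le> x" "x < 1"
  shows "x + x^2 / 2 + x^3 / 3 \<le> - ln (1 - x)"
proof -
  let ?f = "\<lambda>x::real. - ln (1 - x) - (x + x^2 / 2 + x^3 / 3)"
  have "?f 0 \<le> ?f x"
  proof (rule DERIV_nonneg_imp_nondecreasing[OF assms(1)])
    fix t :: real assume t: "0 \<le> t" "t \<le> x"
    then have t1: "t < 1" using assms by simp
    have "(?f has_real_derivative t^3 / (1 - t)) (at t)"
      using t1 by (auto intro!: derivative_eq_intros simp: field_simps power2_eq_square power3_eq_cube)
    then show "\<exists>y. DERIV ?f t :> y \<and> 0 \<le> y" using t t1 by (intro exI[of _ "t^3 / (1 - t)"]) auto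
  qed
  then show ?thesis by simp
qed

text \<open>In the logarithm series the terms from the fourth on are dominated by a geometric series
  with sum \<open>x^4 / (4 * (1 - x))\<close>. The difference of the two sides has derivative
  \<open>t^4 / (4 * (1 - t)^2)\<close>.\<close>

lemma minus_ln_one_minus_le:
  fixes x :: real
  assumes "0 \<le> x" "x < 1"
  shows "- ln (1 - x) \<le> x + x^2 / 2 + x^3 / 3 + x^4 / (4 * (1 - x))"
proof -
  let ?f = "\<lambda>x::real. x + x^2 / 2 + x^3 / 3 + x^4 / (4 * (1 - x)) + ln (1 - x)"
  have "?f 0 \<le> ?f x"
  proof (rule DERIV_nonneg_imp_nondecreasing[OF assms(1)])
    fix t :: real assume t: "0 \<le> t" "t \<le> x"
    then have t1: "t < 1" using assms by simp
    have "(?f has_real_derivative 1 + t + t^2 + (4 * t^3 * (4 * (1 - t)) + t^4 * 4) / (4 * (1 - t))^2 - 1 / (1 - t)) (at t)"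
    proof -
      have 1: "((\<lambda>x::real. x^4 / (4 * (1 - x))) has_real_derivative (4 * t^3 * (4 * (1 - t)) + t^4 * 4) / (4 * (1 - t))^2) (at t)"
      proof -
        have "((\<lambda>x::real. x^4) has_real_derivative 4 * t^3) (at t)"
          by (auto intro!: derivative_eq_intros)
        moreover have "((\<lambda>x::real. 4 * (1 - x)) has_real_derivative -4) (at t)"
          by (auto intro!: derivative_eq_intros)
        ultimately show ?thesis using DERIV_divide[of "\<lambda>x. x^4" "4 * t^3" t UNIV "\<lambda>x. 4 * (1 - x)" "-4"] t1
          by (simp add: power2_eq_square)
      qed
      have 2: "((\<lambda>x::real. x + x^2 / 2 + x^3 / 3) has_real_derivative 1 + t + t^2) (at t)"
        by (auto intro!: derivative_eq_intros)
      have 3: "((\<lambda>x::real. ln (1 - x)) has_real_derivative - (1 / (1 - t))) (at t)"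
        using t1 by (auto intro!: derivative_eq_intros simp: field_simps)
      show ?thesis using DERIV_add[OF DERIV_add[OF 2 1] 3] by simp
    qed
    also have "1 + t + t^2 + (4 * t^3 * (4 * (1 - t)) + t^4 * 4) / (4 * (1 - t))^2 - 1 / (1 - t) = t^4 / (4 * (1 - t)^2)"
    proof -
      define r where "r = 1 - t"
      have r: "r > 0" "t = 1 - r" using t1 by (auto simp: r_def)
      show ?thesis unfolding r(2) using r(1)
        by (simp add: divide_simps) algebra
    qed
    finally have "(?f has_real_derivative t^4 / (4 * (1 - t)^2)) (at t)" .
    then show "\<exists>y. DERIV ?f t :> y \<and> 0 \<le> y" using t t1 by (intro exI[of _ "t^4 / (4 * (1 - t)^2)"]) auto
  qed
  then show ?thesis by simp
qed

text \<open>
  \<open>slope \<lambda>\<close> is the rate at which the size of the cover sets must follow the imbalance of the two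
  set sizes so that the costs of both sides agree to first order.
\<close>

definition slope :: "real \<Rightarrow> real" where
  "slope l = l * ln (2 - l) / (- ln (1 - l))"

text \<open>The interval is halved because with one enclosure on [0.4, 0.5] the termwise estimates
  of the second derivative in \<open>cost_le_cost_0\<close> would be too coarse for
  concavity.\<close>

lemma slope_bounds:
  fixes l :: real
  assumes "0.4 \<le> l" "l \<le> 0.5"
  shows "l \<le> 0.45 \<Longrightarrow> 0.325 \<le> slope l \<and> slope l \<le> 0.38"
    and "0.45 \<le> l \<Longrightarrow> 0.29 \<le> slope l \<and> slope l \<le> 0.34"
proof -
  have l15: "ln (1.5::real) \<ge> 0.405" and l155: "ln (1.55::real) \<ge> 0.438" "ln (1.55::real) \<le> 0.439"
    and l16: "ln (1.6::real) \<le> 0.471"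
    using ln_approx_bounds[of "1.5" 2] ln_approx_bounds[of "1.55" 2] ln_approx_bounds[of "1.6" 2]
    by (simp_all add: eval_nat_numeral)
  \<comment> \<open>With \<open>g\<close> the slope becomes \<open>ln (2 - l) / g\<close>, and
    \<open>g\<close> is enclosed by the truncated logarithm series divided by
    \<open>l\<close>.\<close>
  define g where "g = - ln (1 - l) / l"
  have lo: "1 + l / 2 + l^2 / 3 \<le> g"
    using minus_ln_one_minus_ge[of l] assms
    by (simp add: g_def field_simps power2_eq_square power3_eq_cube)
  have hi: "g \<le> 1 + l / 2 + l^2 / 3 + l^3 / (4 * (1 - l))"
  proof -
    have "- ln (1 - l) / l \<le> (l + l^2 / 2 + l^3 / 3 + l^4 / (4 * (1 - l))) / l"
      using minus_ln_one_minus_le[of l] assms by (intro divide_right_mono) auto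
    also have "\<dots> = 1 + l / 2 + l^2 / 3 + l^3 / (4 * (1 - l))"
      using assms by (simp add: add_divide_distrib power2_eq_square power3_eq_cube power4_eq_xxxx)
    finally show ?thesis by (simp add: g_def)
  qed
  have gpos: "g > 0" using lo assms by (intro less_le_trans[OF _ lo]) (auto intro!: add_pos_pos)
  have s: "slope l = ln (2 - l) / g" using assms by (simp add: slope_def g_def)
  {
    assume u: "l \<le> 0.45"
    have "l^2 \<ge> 0.4^2" "l^2 \<le> 0.45^2" "l^3 \<le> 0.45^3" using assms u by (auto intro!: power_mono)
    moreover have "l^3 / (4 * (1 - l)) \<le> 0.45^3 / (4 * (1 - 0.45))"
      using assms u by (intro frac_le power_mono) auto
    ultimately have "1.25 \<le> g" "g \<le> 1.335" using lo hi assms u by (simp_all add: eval_nat_numeral)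
    moreover have "ln (2 - l) \<le> ln 1.6" "ln 1.55 \<le> ln (2 - l)" using assms u by simp_all
    ultimately show "0.325 \<le> slope l \<and> slope l \<le> 0.38"
      unfolding s using l155 l16 gpos by (simp add: field_simps)
  }
  {
    assume u: "0.45 \<le> l"
    have "l^2 \<ge> 0.45^2" "l^2 \<le> 0.5^2" using assms u by (auto intro!: power_mono)
    then have l2: "l^2 \<ge> 81 / 400" "l^2 \<le> 1 / 4" by (simp_all add: power2_eq_square)
    have "l^3 / (4 * (1 - l)) \<le> 0.5^3 / (4 * (1 - 0.5))"
      using assms u by (intro frac_le power_mono) auto
    also have "\<dots> = (1 / 16::real)" by (simp add: power3_eq_cube)
    finally have l3: "l^3 / (4 * (1 - l)) \<le> 1 / 16" .
    have l1: "9 / 20 \<le> l" "l \<le> 1 / 2" using u assms by simp_all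
    have "517 / 400 \<le> g" "g \<le> 349 / 250" using l1 l2 l3 lo hi by linarith+
    moreover have "ln (2 - l) \<le> ln 1.55" "ln 1.5 \<le> ln (2 - l)" using assms u by simp_all
    ultimately show "0.29 \<le> slope l \<and> slope l \<le> 0.34"
      unfolding s using l155 l15 gpos by (simp add: field_simps)
  }
qed

text \<open>
  The cost exponent (in nats) of the side whose partner sets have density \<open>l / 2 - l * t\<close>. By symmetry
  the other side costs \<open>cost l (- t)\<close>.
\<close>

definition cost :: "real \<Rightarrow> real \<Rightarrow> real" where
  "cost l t = (let b = l / 2 - l * t; c = 1 - l; x = c / 2 - slope l * t
     in (b + c) * ln (b + c) - (b + x) * ln (b + x) + x * ln x - c * ln c)"

lemma cost_le_cost_0:
  fixes l t :: real
  assumes l: "0.4 \<le> l" "l \<le> 0.5" and t: "\<bar>t\<bar> \<le> 0.1"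
  shows "cost l t \<le> cost l 0"
proof -
  define h where "h = slope l"
  \<comment> \<open>\<open>s\<close>, \<open>v\<close> and \<open>x\<close> are the quantities
    \<open>b + c\<close>, \<open>b + x\<close> and \<open>x\<close> of \<open>cost\<close> as affine
    functions of \<open>t\<close>.\<close>
  define s where "s t = 1 - l / 2 - l * t" for t
  define v where "v t = 1 / 2 - (l + h) * t" for t
  define x where "x t = (1 - l) / 2 - h * t" for t
  have hb: "0.29 \<le> h" "h \<le> 0.38" using slope_bounds[OF l] unfolding h_def by (cases "l \<le> 0.45"; simp)+
  have cost: "cost l t = s t * ln (s t) - v t * ln (v t) + x t * ln (x t) - (1 - l) * ln (1 - l)" for t
    unfolding cost_def Let_def s_def v_def x_def h_def by (simp add: algebra_simps diff_divide_distrib)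
  have prods: "\<bar>l * t\<bar> \<le> l * 0.1" "\<bar>h * t\<bar> \<le> h * 0.1" if "\<bar>t\<bar> \<le> 0.1" for t
    using that l hb by (simp_all add: abs_mult mult_left_mono del: mult.commute)
  have pos: "s t > 0" "v t > 0" "x t > 0" if "\<bar>t\<bar> \<le> 0.1" for t
    using prods[OF that] l hb unfolding s_def v_def x_def by (simp_all add: algebra_simps abs_le_iff)
  have dsvx: "(s has_real_derivative - l) (at t)" "(v has_real_derivative - (l + h)) (at t)"
      "(x has_real_derivative - h) (at t)" for t
    unfolding s_def[abs_def] v_def[abs_def] x_def[abs_def] by (auto intro!: derivative_eq_intros)
  define d1 where "d1 t = - l * ln (s t) + (l + h) * ln (v t) - h * ln (x t)" for t
  have D1: "(cost l has_real_derivative d1 t) (at t)" if "\<bar>t\<bar> \<le> 0.1" for t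
  proof -
    have "((\<lambda>t. s t * ln (s t) - v t * ln (v t) + x t * ln (x t) - (1 - l) * ln (1 - l)) has_real_derivative d1 t) (at t)"
      using pos[OF that] by (auto intro!: derivative_eq_intros dsvx simp: d1_def field_simps)
    moreover have "cost l = (\<lambda>t. s t * ln (s t) - v t * ln (v t) + x t * ln (x t) - (1 - l) * ln (1 - l))"
      using cost by blast
    ultimately show ?thesis by simp
  qed
  \<comment> \<open>The sign of the second derivative. The decimals are extreme values over the half
    interval and \<open>\<bar>t\<bar> \<le> 0.1\<close>, for example 0.73 = 1 - 0.225 - 0.045 for
    \<open>s\<close> and 0.237 = 0.275 - 0.038 for \<open>x\<close>. The term with \<open>v\<close>
    supplies all of the negative curvature.\<close>
  have d2: "l^2 / s t + h^2 / x t \<le> (l + h)^2 / v t" if t: "\<bar>t\<bar> \<le> 0.1" for t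
  proof (cases "l \<le> 0.45")
    case True
    then have h2: "0.325 \<le> h" "h \<le> 0.38" using slope_bounds(1)[OF l] by (auto simp: h_def)
    have "s t \<ge> 0.73" "x t \<ge> 0.237" "v t \<le> 0.583"
      using prods[OF t] l h2 True unfolding s_def v_def x_def by (simp_all add: algebra_simps abs_le_iff)
    moreover have "l^2 \<le> 0.45^2" "h^2 \<le> 0.38^2" "0.725^2 \<le> (l + h)^2"
      using True h2 l by (auto intro!: power_mono)
    ultimately have "l^2 / s t \<le> 0.45^2 / 0.73" "h^2 / x t \<le> 0.38^2 / 0.237" "0.725^2 / 0.583 \<le> (l + h)^2 / v t"
      using pos[OF t] by (intro frac_le; simp)+
    then show ?thesis by (simp add: power2_eq_square)
  next
    case False
    then have h2: "0.29 \<le> h" "h \<le> 0.34" using slope_bounds(2)[OF l] by (auto simp: h_def)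
    have "s t \<ge> 0.7" "x t \<ge> 0.216" "v t \<le> 0.584"
      using prods[OF t] l h2 False unfolding s_def v_def x_def by (simp_all add: algebra_simps abs_le_iff)
    moreover have "l^2 \<le> 0.5^2" "h^2 \<le> 0.34^2" "0.74^2 \<le> (l + h)^2"
      using False h2 l by (auto intro!: power_mono)
    ultimately have "l^2 / s t \<le> 0.5^2 / 0.7" "h^2 / x t \<le> 0.34^2 / 0.216" "0.74^2 / 0.584 \<le> (l + h)^2 / v t"
      using pos[OF t] by (intro frac_le; simp)+
    then show ?thesis by (simp add: power2_eq_square)
  qed
  have D2: "(d1 has_real_derivative (l^2 / s t + h^2 / x t - (l + h)^2 / v t)) (at t)" if "\<bar>t\<bar> \<le> 0.1" for t
  proof -
    have "((\<lambda>t. - l * ln (s t) + (l + h) * ln (v t) - h * ln (x t)) has_real_derivative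
        (l^2 / s t + h^2 / x t - (l + h)^2 / v t)) (at t)"
      using pos[OF that] by (auto intro!: derivative_eq_intros dsvx simp: power2_eq_square field_simps)
    then show ?thesis unfolding d1_def[abs_def] .
  qed
  have mono: "d1 b \<le> d1 a" if "a \<le> b" "\<bar>a\<bar> \<le> 0.1" "\<bar>b\<bar> \<le> 0.1" for a b
  proof (rule DERIV_nonpos_imp_nonincreasing[OF that(1)])
    fix t assume "a \<le> t" "t \<le> b"
    then have "\<bar>t\<bar> \<le> 0.1" using that by auto
    then show "\<exists>y. DERIV d1 t :> y \<and> y \<le> 0" using D2 d2 by force
  qed
  \<comment> \<open>At 0 the terms with \<open>ln 2\<close> cancel, and \<open>slope\<close> is
    defined so that the rest vanishes.\<close>
  have d10: "d1 0 = 0"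
  proof -
    have ne: "ln (1 - l) \<noteq> 0" using l by simp
    have 1: "ln (1 - l / 2) = ln (2 - l) - ln 2" "ln ((1 - l) / 2) = ln (1 - l) - ln 2"
      using l ln_div[of "2 - l" 2] ln_div[of "1 - l" 2] by (simp_all add: diff_divide_distrib)
    have 2: "h * ln (1 - l) = - l * ln (2 - l)" using ne by (simp add: h_def slope_def)
    have "d1 0 = - l * ln (1 - l / 2) + (l + h) * ln (1 / 2) - h * ln ((1 - l) / 2)"
      by (simp add: d1_def s_def v_def x_def)
    also have "\<dots> = - l * ln (2 - l) - h * ln (1 - l)" unfolding 1 by (simp add: ln_div algebra_simps)
    finally show ?thesis using 2 by simp
  qed
  show ?thesis
  proof (cases "0 \<le> t")
    case True
    then show ?thesis
    proof (rule DERIV_nonpos_imp_nonincreasing)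
      fix u assume u: "0 \<le> u" "u \<le> t"
      then have "\<bar>u\<bar> \<le> 0.1" using t by auto
      then show "\<exists>y. DERIV (cost l) u :> y \<and> y \<le> 0"
        using D1 mono[OF u(1)] d10 by (intro exI[of _ "d1 u"]) auto
    qed
  next
    case False
    then have "t \<le> 0" by simp
    then show ?thesis
    proof (rule DERIV_nonneg_imp_nondecreasing)
      fix u assume u: "t \<le> u" "u \<le> 0"
      then have "\<bar>u\<bar> \<le> 0.1" using t by auto
      then show "\<exists>y. DERIV (cost l) u :> y \<and> 0 \<le> y"
        using D1 mono[OF u(2)] d10 by (intro exI[of _ "d1 u"]) auto
    qed
  qed
qed

text \<open>The exponent of the time bound to base 2; \<open>cost\<close> is measured in nats, hence
  the factor \<open>ln 2\<close> in comparisons.\<close>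

definition rate :: "real \<Rightarrow> real" where
  "rate l = 1 / 2 + l - binary_entropy (l / 2)"

lemma rate_eq:
  assumes "0 < l" "l < 1"
  shows "rate l * ln 2 = ln 2 / 2 + l / 2 * ln 2 + l / 2 * ln l + (1 - l / 2) * ln (1 - l / 2)"
  using assms unfolding rate_def binary_entropy_def log_def by (simp add: field_simps ln_div)

text \<open>Gibbs' inequality against the uniform distribution, by
  \<open>ln x \<le> x - 1\<close>.\<close>

lemma entropy_le:
  fixes p :: real
  assumes "0 < p" "p < 1"
  shows "- ln 2 \<le> p * ln p + (1 - p) * ln (1 - p)"
proof -
  have "p * ln (1 / (2 * p)) \<le> p * (1 / (2 * p) - 1)"
    using assms by (intro mult_left_mono ln_le_minus_one) auto
  moreover have "(1 - p) * ln (1 / (2 * (1 - p))) \<le> (1 - p) * (1 / (2 * (1 - p)) - 1)"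
    using assms by (intro mult_left_mono ln_le_minus_one) auto
  moreover have "p * (1 / (2 * p) - 1) = 1 / 2 - p" "(1 - p) * (1 / (2 * (1 - p)) - 1) = 1 / 2 - (1 - p)"
    using assms by (simp_all add: divide_simps) (simp_all add: algebra_simps)
  ultimately have "p * ln (1 / (2 * p)) + (1 - p) * ln (1 / (2 * (1 - p))) \<le> 0" by linarith
  moreover have "ln (1 / (2 * p)) = - ln 2 - ln p" "ln (1 / (2 * (1 - p))) = - ln 2 - ln (1 - p)"
    using assms ln_mult[of 2 "1 - p"] by (simp_all add: ln_div ln_mult)
  ultimately have "p * (- ln 2 - ln p) + (1 - p) * (- ln 2 - ln (1 - p)) \<le> 0" by (simp only:)
  then show ?thesis by (simp add: algebra_simps)
qed

text \<open>The two sides differ by half the gap of \<open>entropy_le\<close> at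
  \<open>l\<close>.\<close>

lemma cost_0_le:
  assumes l: "0.4 \<le> l" "l \<le> 0.5"
  shows "cost l 0 \<le> rate l * ln 2"
proof -
  have "cost l 0 = (1 - l / 2) * ln (1 - l / 2) + ln 2 / 2 + (1 - l) / 2 * (ln (1 - l) - ln 2) - (1 - l) * ln (1 - l)"
  proof -
    have 1: "l / 2 - l * 0 + (1 - l) = 1 - l / 2" "l / 2 - l * 0 + ((1 - l) / 2 - slope l * 0) = 1 / 2"
      by (simp_all add: field_simps)
    have 2: "ln ((1 - l) / 2) = ln (1 - l) - ln 2" "ln (1 / 2 :: real) = - ln 2" using l by (simp_all add: ln_div)
    show ?thesis unfolding cost_def Let_def 1 by (simp add: 2)
  qed
  moreover have "rate l * ln 2 = ln 2 / 2 + l / 2 * ln 2 + l / 2 * ln l + (1 - l / 2) * ln (1 - l / 2)"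
    using l by (intro rate_eq) auto
  ultimately show ?thesis using entropy_le[of l] l by (simp add: field_simps)
qed

text \<open>Gibbs' inequality against (1/4, 3/4), together with a lower bound on \<open>ln 3\<close>
  from 8 < 9, puts the entropy of \<open>p\<close> below the line \<open>1 / 2 + 3 / 2 * p\<close>.
  Hence \<open>rate l\<close> is at least \<open>l / 4\<close>.\<close>

lemma rate_ge:
  assumes l: "0.4 \<le> l" "l \<le> 0.5"
  shows "0.1 \<le> rate l"
proof -
  define p where "p = l / 2"
  have p: "0 < p" "p < 1" using l by (auto simp: p_def)
  have "p * ln (1 / (4 * p)) \<le> p * (1 / (4 * p) - 1)"
    using p by (intro mult_left_mono ln_le_minus_one) auto
  moreover have "(1 - p) * ln (3 / (4 * (1 - p))) \<le> (1 - p) * (3 / (4 * (1 - p)) - 1)"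
    using p by (intro mult_left_mono ln_le_minus_one) auto
  moreover have "p * (1 / (4 * p) - 1) = 1 / 4 - p" "(1 - p) * (3 / (4 * (1 - p)) - 1) = 3 / 4 - (1 - p)"
    using p by (simp_all add: divide_simps) (simp_all add: algebra_simps)
  ultimately have 0: "p * ln (1 / (4 * p)) + (1 - p) * ln (3 / (4 * (1 - p))) \<le> 0" by linarith
  have ln4: "ln (4::real) = 2 * ln 2" using ln_realpow[of 2 2] by simp
  have 1: "- (p * ln p) - (1 - p) * ln (1 - p) \<le> 2 * ln 2 - (1 - p) * ln 3"
  proof -
    have "ln (1 / (4 * p)) = - ln 4 - ln p" "ln (3 / (4 * (1 - p))) = ln 3 - ln 4 - ln (1 - p)"
      using p ln_mult[of 4 "1 - p"] by (simp_all add: ln_div ln_mult)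
    with 0 have "p * (- ln 4 - ln p) + (1 - p) * (ln 3 - ln 4 - ln (1 - p)) \<le> 0" by (simp only:)
    with ln4 show ?thesis by (simp add: algebra_simps)
  qed
  have "ln (8::real) \<le> ln 9" by simp
  moreover have "ln (8::real) = 3 * ln 2" "ln (9::real) = 2 * ln 3"
    using ln_realpow[of 2 3] ln_realpow[of 3 2] by simp_all
  ultimately have 2: "(1 - p) * (3 / 2 * ln 2) \<le> (1 - p) * ln 3" using p by (intro mult_left_mono) auto
  have "binary_entropy p * ln 2 \<le> (1 / 2 + 3 / 2 * p) * ln 2"
  proof -
    have 5: "binary_entropy p * ln 2 = - (p * ln p) - (1 - p) * ln (1 - p)"
      unfolding binary_entropy_def log_def by (simp add: field_simps)
    have 3: "(1 - p) * (3 / 2 * L) = 3 / 2 * L - 3 / 2 * p * L" for L :: real by (simp add: field_simps)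
    have 4: "(1 / 2 + 3 / 2 * p) * L = 1 / 2 * L + 3 / 2 * p * L" for L :: real by (simp add: algebra_simps)
    show ?thesis unfolding 5 4 using 1 2[unfolded 3] by linarith
  qed
  then have "binary_entropy p \<le> 1 / 2 + 3 / 2 * p" by simp
  then show ?thesis using l by (simp add: rate_def p_def)
qed

text \<open>\<open>p\<close> and \<open>q\<close> are the relative sizes at which the mass bound is
  sharp for the two numerators, \<rho> the one for the common denominator. With these values the
  left sides are exactly \<open>cost l t\<close> and \<open>cost l (- t)\<close> for
  \<open>t = \<sigma> - 1 / 2\<close>.\<close>

lemma cover_parameters:
  fixes l \<sigma> :: real
  assumes l: "0.4 \<le> l" "l \<le> 0.5" and \<sigma>: "0.4 \<le> \<sigma>" "\<sigma> \<le> 0.6"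
  shows "\<exists>\<rho> p q. 0 < \<rho> \<and> \<rho> < 1 \<and> 0 < p \<and> p < 1 \<and> 0 < q \<and> q < 1 \<and>
    \<rho> * (1 - l) * ln (\<rho> / p) + (1 - \<rho>) * (1 - l) * ln ((1 - \<rho>) / (1 - p)) + (1 - \<sigma>) * l * ln (1 / (1 - p))
      \<le> rate l * ln 2 \<and>
    \<rho> * (1 - l) * ln (\<rho> / q) + (1 - \<rho>) * (1 - l) * ln ((1 - \<rho>) / (1 - q)) + \<sigma> * l * ln (1 / q)
      \<le> rate l * ln 2"
proof -
  define t where "t = \<sigma> - 1 / 2"
  define h where "h = slope l"
  have t: "\<bar>t\<bar> \<le> 0.1" unfolding t_def abs_le_iff using \<sigma> by simp
  have hb: "0.29 \<le> h" "h \<le> 0.38" using slope_bounds[OF l] unfolding h_def by (cases "l \<le> 0.45"; simp)+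
  have ht: "\<bar>h * t\<bar> \<le> 0.038"
    using mult_mono[of "\<bar>h\<bar>" "0.38" "\<bar>t\<bar>" "0.1"] t hb by (simp add: abs_mult)
  then have ht': "h * t \<le> 0.038" "- (h * t) \<le> 0.038" by (simp_all only: abs_le_iff)
  define c where "c = 1 - l"
  define x where "x = c / 2 - h * t"
  define y where "y = c / 2 + h * t"
  define a where "a = \<sigma> * l"
  define b where "b = (1 - \<sigma>) * l"
  have "c \<ge> 1 / 2" using l by (simp add: c_def)
  then have "x > 0" "y > 0" using ht' unfolding x_def y_def by (simp_all add: field_simps)
  then have pos: "a > 0" "b > 0" "c > 0" "x > 0" "y > 0" "x + y = c"
    using l \<sigma> by (auto simp: a_def b_def c_def x_def y_def)
  have ab: "a = l / 2 + l * t" "b = l / 2 - l * t" by (auto simp: a_def b_def t_def algebra_simps)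
  have A: "cost l t = (b + c) * ln (b + c) - (b + x) * ln (b + x) + x * ln x - c * ln c"
    unfolding cost_def Let_def by (simp add: ab c_def x_def h_def)
  have B: "cost l (- t) = (a + c) * ln (a + c) - (a + y) * ln (a + y) + y * ln y - c * ln c"
    unfolding cost_def Let_def by (simp add: ab c_def y_def h_def)
  have le: "cost l t \<le> rate l * ln 2" "cost l (- t) \<le> rate l * ln 2"
    using cost_le_cost_0[OF l, of t] cost_le_cost_0[OF l, of "- t"] cost_0_le[OF l] t by auto
  define \<rho> where "\<rho> = y / c"
  define p where "p = y / (b + c)"
  define q where "q = (a + y) / (a + c)"
  have e: "\<rho> * c = y" "(1 - \<rho>) * c = x" "1 - \<rho> = x / c" using pos by (auto simp: \<rho>_def field_simps)
  have p1: "1 - p = (b + x) / (b + c)" and q1: "1 - q = x / (a + c)"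
    using pos by (auto simp: p_def q_def field_simps)
  have "y * ln (\<rho> / p) + x * ln ((1 - \<rho>) / (1 - p)) + b * ln (1 / (1 - p)) = cost l t"
  proof -
    have 1: "ln (\<rho> / p) = ln (b + c) - ln c" using pos by (simp add: \<rho>_def p_def ln_div)
    have 2: "ln ((1 - \<rho>) / (1 - p)) = ln x - ln c + ln (b + c) - ln (b + x)"
      unfolding e(3) p1 using pos by (simp add: ln_div ln_mult)
    have 3: "ln (1 / (1 - p)) = ln (b + c) - ln (b + x)"
      unfolding p1 using pos by (simp add: ln_div)
    have 4: "y = c - x" using pos by simp
    show ?thesis unfolding A 1 2 3 unfolding 4 by (simp add: algebra_simps)
  qed
  moreover have "y * ln (\<rho> / q) + x * ln ((1 - \<rho>) / (1 - q)) + a * ln (1 / q) = cost l (- t)"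
  proof -
    have 1: "ln (\<rho> / q) = ln y - ln c + ln (a + c) - ln (a + y)"
      using pos by (simp add: \<rho>_def q_def ln_div ln_mult)
    have 2: "ln ((1 - \<rho>) / (1 - q)) = ln (a + c) - ln c"
      unfolding e(3) q1 using pos by (simp add: ln_div ln_mult)
    have 3: "ln (1 / q) = ln (a + c) - ln (a + y)"
      unfolding q_def using pos by (simp add: ln_div)
    have 4: "x = c - y" using pos by simp
    show ?thesis unfolding B 1 2 3 unfolding 4 by (simp add: algebra_simps)
  qed
  moreover have "0 < \<rho>" "\<rho> < 1" "0 < p" "p < 1" "0 < q" "q < 1"
    using pos by (auto simp: \<rho>_def p_def q_def)
  ultimately show ?thesis
    using le e(1,2) unfolding c_def a_def b_def by (intro exI[of _ \<rho>] exI[of _ p] exI[of _ q]) auto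
qed

text \<open>The numerator is bounded above by the mass bound at \<open>p\<close>, the denominator
  below by the mode bound at \<rho>. As \<open>y\<close> is a mode, the latter loses only the factor
  \<open>c + 1\<close>.\<close>

lemma choose_ratio_le:
  fixes \<rho> p :: real and b c :: nat
  assumes \<rho>: "0 < \<rho>" "\<rho> < 1" and p: "0 < p" "p < 1"
  defines "y \<equiv> nat \<lfloor>\<rho> * (real c + 1)\<rfloor>"
  shows "real ((b + c) choose y) / real (c choose y)
      \<le> (real c + 1) * (\<rho> / p) ^ y * ((1 - \<rho>) / (1 - p)) ^ (c - y) * (1 / (1 - p)) ^ b"
proof -
  have y: "y \<le> c" unfolding y_def by (rule binomial_mode_index_le[OF \<rho>])
  have pos: "real (c choose y) > 0" using y by simp
  have "1 / real (c choose y) \<le> (real c + 1) * (\<rho> ^ y * (1 - \<rho>) ^ (c - y))"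
    using binomial_mode_ge[OF \<rho>, of c, folded y_def] pos by (simp add: divide_simps mult_ac)
  moreover have "real ((b + c) choose y) \<le> 1 / (p ^ y * (1 - p) ^ (b + (c - y)))"
    using binomial_mass_le_1[of p y "b + c"] p y by (simp add: divide_simps mult_ac)
  ultimately have "real ((b + c) choose y) * (1 / real (c choose y))
     \<le> (1 / (p ^ y * (1 - p) ^ (b + (c - y)))) * ((real c + 1) * (\<rho> ^ y * (1 - \<rho>) ^ (c - y)))"
    using p by (intro mult_mono) auto
  then show ?thesis by (simp add: power_add power_divide mult_ac)
qed

text \<open>A cover has \<open>a + y\<close> elements, so the numerator is also
  \<open>(a + c) choose (a + y)\<close>, and the mass bound at \<open>q\<close> is applied in this
  form.\<close>

lemma choose_ratio_le':
  fixes \<rho> q :: real and a c :: nat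
  assumes \<rho>: "0 < \<rho>" "\<rho> < 1" and q: "0 < q" "q < 1"
  defines "y \<equiv> nat \<lfloor>\<rho> * (real c + 1)\<rfloor>"
  shows "real ((a + c) choose (c - y)) / real (c choose y)
      \<le> (real c + 1) * (\<rho> / q) ^ y * ((1 - \<rho>) / (1 - q)) ^ (c - y) * (1 / q) ^ a"
proof -
  have y: "y \<le> c" unfolding y_def by (rule binomial_mode_index_le[OF \<rho>])
  have pos: "real (c choose y) > 0" using y by simp
  have "1 / real (c choose y) \<le> (real c + 1) * (\<rho> ^ y * (1 - \<rho>) ^ (c - y))"
    using binomial_mode_ge[OF \<rho>, of c, folded y_def] pos by (simp add: divide_simps mult_ac)
  moreover have "(a + c) choose (c - y) = (a + c) choose (a + y)"
    using binomial_symmetric[of "c - y" "a + c"] y by simp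
  moreover have "real ((a + c) choose (a + y)) \<le> 1 / (q ^ (a + y) * (1 - q) ^ (c - y))"
    using binomial_mass_le_1[of q "a + y" "a + c"] q y by (simp add: divide_simps mult_ac)
  ultimately have "real ((a + c) choose (c - y)) * (1 / real (c choose y))
     \<le> (1 / (q ^ (a + y) * (1 - q) ^ (c - y))) * ((real c + 1) * (\<rho> ^ y * (1 - \<rho>) ^ (c - y)))"
    using q by (intro mult_mono) auto
  then show ?thesis by (simp add: power_add power_divide mult_ac)
qed

text \<open>The bases supplied by \<open>cover_parameters\<close> depend only on \<open>l\<close>
  and \<sigma>, so a single \<rho> and a single \<open>Q\<close> serve all inputs and all
  distributions of the pair over the blocks.\<close>

lemma work_bound:
  fixes l \<sigma> :: real and K :: nat
  assumes l: "0.4 \<le> l" "l \<le> 0.5" and \<sigma>: "0.4 \<le> \<sigma>" "\<sigma> \<le> 0.6"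
  shows "\<exists>\<rho> Q. 0 < \<rho> \<and> \<rho> < 1 \<and> 0 < Q \<and> (\<forall>d m a b c y.
     (\<forall>i<K. a i + b i + c i = m) \<and> d \<le> K * m \<and> K * m \<le> d + K \<and>
     (\<forall>i<K. y i = nat \<lfloor>\<rho> * (real (c i) + 1)\<rfloor>) \<and>
     (\<Sum>i<K. real (a i)) = \<sigma> * l * real d \<and> (\<Sum>i<K. real (b i)) = (1 - \<sigma>) * l * real d \<longrightarrow>
     (\<Prod>i<K. real ((b i + c i) choose y i) / real (c i choose y i)) \<le> Q * (real m + 1) ^ K * 2 powr (real d * rate l) \<and>
     (\<Prod>i<K. real ((a i + c i) choose (c i - y i)) / real (c i choose y i)) \<le> Q * (real m + 1) ^ K * 2 powr (real d * rate l))"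
proof -
  obtain \<rho> p q where \<rho>: "0 < \<rho>" "\<rho> < 1" and p: "0 < p" "p < 1" and q: "0 < q" "q < 1" and
    A: "\<rho> * (1 - l) * ln (\<rho> / p) + (1 - \<rho>) * (1 - l) * ln ((1 - \<rho>) / (1 - p)) + (1 - \<sigma>) * l * ln (1 / (1 - p))
      \<le> rate l * ln 2" and
    B: "\<rho> * (1 - l) * ln (\<rho> / q) + (1 - \<rho>) * (1 - l) * ln ((1 - \<rho>) / (1 - q)) + \<sigma> * l * ln (1 / q)
      \<le> rate l * ln 2"
    using cover_parameters[OF l \<sigma>] by blast
  obtain Q1 where Q1: "Q1 > 0" "\<And>d m c g y f.
     (\<forall>i<K. c i \<le> m) \<and>
     (\<forall>i<K. y i = nat \<lfloor>\<rho> * (real (c i) + 1)\<rfloor>) \<and>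
     (\<forall>i<K. f i \<ge> 0 \<and> f i \<le> (real (c i) + 1) * (\<rho> / p) ^ y i * ((1 - \<rho>) / (1 - p)) ^ (c i - y i) * (1 / (1 - p)) ^ g i) \<and>
     \<bar>(\<Sum>i<K. real (c i)) - (1 - l) * real d\<bar> \<le> real K \<and>
     (\<Sum>i<K. real (g i)) = (1 - \<sigma>) * l * real d \<Longrightarrow>
     (\<Prod>i<K. f i) \<le> Q1 * (real m + 1) ^ K *
        exp (real d * (\<rho> * (1 - l) * ln (\<rho> / p) + (1 - \<rho>) * (1 - l) * ln ((1 - \<rho>) / (1 - p)) + (1 - \<sigma>) * l * ln (1 / (1 - p))))"
    using product_bound[of "\<rho> / p" "(1 - \<rho>) / (1 - p)" "1 / (1 - p)" \<rho> K "1 - l" "(1 - \<sigma>) * l"] \<rho> p by auto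
  obtain Q2 where Q2: "Q2 > 0" "\<And>d m c g y f.
     (\<forall>i<K. c i \<le> m) \<and>
     (\<forall>i<K. y i = nat \<lfloor>\<rho> * (real (c i) + 1)\<rfloor>) \<and>
     (\<forall>i<K. f i \<ge> 0 \<and> f i \<le> (real (c i) + 1) * (\<rho> / q) ^ y i * ((1 - \<rho>) / (1 - q)) ^ (c i - y i) * (1 / q) ^ g i) \<and>
     \<bar>(\<Sum>i<K. real (c i)) - (1 - l) * real d\<bar> \<le> real K \<and>
     (\<Sum>i<K. real (g i)) = \<sigma> * l * real d \<Longrightarrow>
     (\<Prod>i<K. f i) \<le> Q2 * (real m + 1) ^ K *
        exp (real d * (\<rho> * (1 - l) * ln (\<rho> / q) + (1 - \<rho>) * (1 - l) * ln ((1 - \<rho>) / (1 - q)) + \<sigma> * l * ln (1 / q)))"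
    using product_bound[of "\<rho> / q" "(1 - \<rho>) / (1 - q)" "1 / q" \<rho> K "1 - l" "\<sigma> * l"] \<rho> q by auto
  define Q where "Q = max Q1 Q2"
  have fin: "Q' * (real m + 1) ^ K * exp (real d * z) \<le> Q * (real m + 1) ^ K * 2 powr (real d * rate l)"
    if "Q' \<le> Q" "z \<le> rate l * ln 2" "Q' > 0" for Q' m d z
  proof -
    have "exp (real d * z) \<le> exp (real d * (rate l * ln 2))" using that by (simp add: mult_left_mono)
    also have "\<dots> = 2 powr (real d * rate l)" by (simp add: powr_def mult_ac)
    finally show ?thesis using that by (intro mult_mono) auto
  qed
  show ?thesis
  proof (rule exI[of _ \<rho>], rule exI[of _ Q], intro conjI \<rho>)
    show "0 < Q" using Q1 by (simp add: Q_def)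
  next
    show "\<forall>d m a b c y.
     (\<forall>i<K. a i + b i + c i = m) \<and> d \<le> K * m \<and> K * m \<le> d + K \<and>
     (\<forall>i<K. y i = nat \<lfloor>\<rho> * (real (c i) + 1)\<rfloor>) \<and>
     (\<Sum>i<K. real (a i)) = \<sigma> * l * real d \<and> (\<Sum>i<K. real (b i)) = (1 - \<sigma>) * l * real d \<longrightarrow>
     (\<Prod>i<K. real ((b i + c i) choose y i) / real (c i choose y i)) \<le> Q * (real m + 1) ^ K * 2 powr (real d * rate l) \<and>
     (\<Prod>i<K. real ((a i + c i) choose (c i - y i)) / real (c i choose y i)) \<le> Q * (real m + 1) ^ K * 2 powr (real d * rate l)"
    proof (intro allI impI, elim conjE, intro conjI)
    fix d m :: nat and a b c y :: "nat \<Rightarrow> nat"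
    assume abc: "\<forall>i<K. a i + b i + c i = m" and d: "d \<le> K * m" "K * m \<le> d + K"
      and y: "\<forall>i<K. y i = nat \<lfloor>\<rho> * (real (c i) + 1)\<rfloor>"
      and a: "(\<Sum>i<K. real (a i)) = \<sigma> * l * real d" and b: "(\<Sum>i<K. real (b i)) = (1 - \<sigma>) * l * real d"
    have cm: "\<forall>i<K. c i \<le> m" using abc by auto
    have "(\<Sum>i<K. real (a i) + real (b i) + real (c i)) = (\<Sum>i<K. real m)"
      using abc by (intro sum.cong) (auto simp flip: of_nat_add)
    then have "(\<Sum>i<K. real (c i)) = real K * real m - l * real d"
      using a b by (simp add: sum.distrib algebra_simps)
    moreover have "real d \<le> real K * real m" "real K * real m \<le> real d + real K"
      using d by (simp_all flip: of_nat_mult of_nat_add)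
    \<comment> \<open>The blocks have up to \<open>K\<close> more positions than the universe. These
      count as free, so the sum of \<open>c\<close> is off by at most \<open>K\<close>.\<close>
    ultimately have sc: "\<bar>(\<Sum>i<K. real (c i)) - (1 - l) * real d\<bar> \<le> real K" by (simp add: algebra_simps)
    show "(\<Prod>i<K. real ((b i + c i) choose y i) / real (c i choose y i)) \<le> Q * (real m + 1) ^ K * 2 powr (real d * rate l)"
      by (rule order_trans[OF Q1(2)[of c m y _ b d] fin])
        (use cm y b sc A Q1(1) choose_ratio_le[OF \<rho> p] in \<open>auto simp: Q_def\<close>)
    show "(\<Prod>i<K. real ((a i + c i) choose (c i - y i)) / real (c i choose y i)) \<le> Q * (real m + 1) ^ K * 2 powr (real d * rate l)"
      by (rule order_trans[OF Q2(2)[of c m y _ a d] fin])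
        (use cm y a sc B Q2(1) choose_ratio_le'[OF \<rho> q] in \<open>auto simp: Q_def\<close>)
    qed
  qed
qed

text \<open>\<open>s div 2\<close> is a mode of the binomial distribution with parameter
  \<open>l / 2\<close>, so the binomial coefficient equals the entropy power up to a factor linear
  in \<open>d\<close>. This makes the exponent accessible to exact integer arithmetic.\<close>

lemma binomial_rate_bounds:
  fixes l :: real
  assumes l: "0.4 \<le> l" "l \<le> 0.5"
  shows "\<exists>C>0. \<forall>d s::nat. real s = l * real d \<longrightarrow>
     2 powr (real d * rate l) \<le> C * (2 ^ (d div 2 + s) / real (d choose (s div 2))) \<and>
     2 ^ (d div 2 + s) / real (d choose (s div 2)) \<le> C * (real d + 1) * 2 powr (real d * rate l)"
proof -
  define p where "p = l / 2"
  have p: "0 < p" "p < 1" using l by (auto simp: p_def)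
  define C where "C = 2 * (max p (1 / p) * max (1 - p) (1 / (1 - p)))"
  have M: "max p (1 / p) > 0" "max (1 - p) (1 / (1 - p)) > 0" using p by auto
  have C: "C > 0" using M by (simp add: C_def)
  show ?thesis
  proof (intro exI[of _ C] conjI C allI impI)
    fix d s :: nat
    assume s: "real s = l * real d"
    define j where "j = nat \<lfloor>p * (real d + 1)\<rfloor>"
    \<comment> \<open>Adding \<open>l / 2 < 1 / 2\<close> to \<open>s / 2\<close> does not reach the
      next integer, even for odd \<open>s\<close>.\<close>
    have j: "j = s div 2"
    proof -
      have e: "p * (real d + 1) = real s / 2 + l / 2" using s by (simp add: p_def algebra_simps)
      have "real (s div 2) \<le> real s / 2" "real s / 2 \<le> real (s div 2) + 1 / 2" by linarith+
      then have "\<lfloor>p * (real d + 1)\<rfloor> = int (s div 2)"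
        unfolding e using l by (intro floor_unique; unfold of_int_of_nat_eq) linarith+
      then show ?thesis by (simp add: j_def)
    qed
    have jd: "j \<le> d" unfolding j_def by (rule binomial_mode_index_le[OF p])
    have "real j \<le> p * (real d + 1)" "p * (real d + 1) < real j + 1"
      using p unfolding j_def by (auto simp: of_nat_floor)
    then have dist: "\<bar>real j - p * d\<bar> \<le> 1" using p by (auto simp: algebra_simps abs_le_iff)
    then have dist2: "\<bar>real (d - j) - (1 - p) * d\<bar> \<le> 1" using jd by (auto simp: of_nat_diff algebra_simps abs_le_iff)
    define B where "B = real (d choose j)"
    have B: "B > 0" using jd by (simp add: B_def)
    define E where "E = p powr (p * d) * (1 - p) powr ((1 - p) * d)"
    have E: "E > 0" using p by (simp add: E_def)
    have up: "p ^ j * (1 - p) ^ (d - j) \<le> C / 2 * E"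
    proof -
      have "p ^ j \<le> max p (1 / p) * p powr (p * d)"
        using powr_perturb[OF p(1) dist] p M by (simp add: powr_realpow)
      moreover have "(1 - p) ^ (d - j) \<le> max (1 - p) (1 / (1 - p)) * (1 - p) powr ((1 - p) * d)"
        using powr_perturb[OF _ dist2, of "1 - p"] p M by (simp add: powr_realpow)
      ultimately have "p ^ j * (1 - p) ^ (d - j) \<le> (max p (1 / p) * p powr (p * d)) * (max (1 - p) (1 / (1 - p)) * (1 - p) powr ((1 - p) * d))"
        using p M by (intro mult_mono) auto
      then show ?thesis by (simp add: C_def E_def mult_ac)
    qed
    have low: "E \<le> C / 2 * (p ^ j * (1 - p) ^ (d - j))"
    proof -
      have "p powr (p * d) \<le> max p (1 / p) * p ^ j"
        using powr_perturb[OF p(1), of "p * d" "real j" 1] dist p M by (simp add: powr_realpow abs_minus_commute)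
      moreover have "(1 - p) powr ((1 - p) * d) \<le> max (1 - p) (1 / (1 - p)) * (1 - p) ^ (d - j)"
        using powr_perturb[of "1 - p" "(1 - p) * d" "real (d - j)" 1] dist2 p M by (simp add: powr_realpow abs_minus_commute)
      ultimately have "E \<le> (max p (1 / p) * p ^ j) * (max (1 - p) (1 / (1 - p)) * (1 - p) ^ (d - j))"
        unfolding E_def using p M by (intro mult_mono) auto
      then show ?thesis by (simp add: C_def mult_ac)
    qed
    have rate: "2 powr (real d * rate l) = 2 powr (d / 2 + s) * E"
    proof -
      have "2 powr (real d * rate l) = exp (real d * rate l * ln 2)" by (simp add: powr_def)
      also have "real d * rate l * ln 2 = (d / 2 + s) * ln 2 + p * d * ln p + (1 - p) * d * ln (1 - p)"
        unfolding rate_def binary_entropy_def log_def p_def[symmetric] using s by (simp add: field_simps)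
      also have "exp \<dots> = 2 powr (d / 2 + s) * E" using p by (simp add: E_def powr_def exp_add mult_ac)
      finally show ?thesis .
    qed
    \<comment> \<open>Rounding in \<open>d div 2\<close> loses at most a factor 2.\<close>
    have half: "(2::real) ^ (d div 2 + s) \<le> 2 powr (d / 2 + s)" "2 powr (d / 2 + s) \<le> 2 * (2::real) ^ (d div 2 + s)"
    proof -
      have e: "(2::real) ^ n = 2 powr real n" for n by (simp add: powr_realpow)
      show "(2::real) ^ (d div 2 + s) \<le> 2 powr (d / 2 + s)" unfolding e by (intro powr_mono) linarith+
      have "(2::real) powr (d / 2 + s) \<le> 2 powr (real (Suc (d div 2 + s)))" by (intro powr_mono) linarith+
      also have "\<dots> = 2 * (2::real) ^ (d div 2 + s)" unfolding e[symmetric] by simp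
      finally show "2 powr (d / 2 + s) \<le> 2 * (2::real) ^ (d div 2 + s)" .
    qed
    have "B * (p ^ j * (1 - p) ^ (d - j)) \<le> 1"
      using binomial_mass_le_1[of p j d] p jd by (simp add: B_def mult_ac)
    then have "p ^ j * (1 - p) ^ (d - j) \<le> 1 / B" using B by (simp add: field_simps)
    then have "E \<le> C / 2 * (1 / B)" using low C by (meson divide_pos_pos less_imp_le mult_left_mono order_trans zero_less_numeral)
    then have "2 powr (real d * rate l) \<le> (2 * 2 ^ (d div 2 + s)) * (C / 2 * (1 / B))"
      unfolding rate using half E by (intro mult_mono) auto
    then show "2 powr (real d * rate l) \<le> C * (2 ^ (d div 2 + s) / real (d choose (s div 2)))"
      by (simp add: B_def j mult_ac)
    have "1 / B \<le> (real d + 1) * (p ^ j * (1 - p) ^ (d - j))"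
      using binomial_mode_ge[OF p, of d, folded j_def] B by (simp add: B_def divide_simps mult_ac)
    also have "\<dots> \<le> (real d + 1) * (C / 2 * E)" using up by (intro mult_left_mono) auto
    also have "\<dots> \<le> (real d + 1) * (C * E)" using C E by (intro mult_left_mono) auto
    finally have "2 ^ (d div 2 + s) * (1 / B) \<le> 2 powr (d / 2 + s) * ((real d + 1) * (C * E))"
      using half B by (intro mult_mono) auto
    then show "2 ^ (d div 2 + s) / real (d choose (s div 2)) \<le> C * (real d + 1) * 2 powr (real d * rate l)"
      unfolding rate by (simp add: B_def j mult_ac)
  qed
qed

section \<open>Correctness of the search\<close>

lemma digit_sum: "(\<Sum>k<i. (X div M ^ k mod M) * M ^ k) = X mod M ^ i" for X M :: nat
proof (induction i)
  case (Suc i)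
  have "X mod M ^ Suc i = M ^ i * (X div M ^ i mod M) + X mod M ^ i"
    unfolding power_Suc2 by (rule mod_mult2_eq)
  then show ?case using Suc by (simp add: mult.commute)
qed simp

lemma digit_of_sum:
  fixes u :: "nat \<Rightarrow> nat"
  assumes "\<And>k. k < i \<Longrightarrow> u k < M"
  shows "(\<Sum>k<i. u k * M ^ k) < M ^ i \<and> (\<forall>k<i. (\<Sum>k<i. u k * M ^ k) div M ^ k mod M = u k)"
  using assms
proof (induction i)
  case (Suc i)
  let ?S = "\<Sum>k<i. u k * M ^ k"
  have IH: "?S < M ^ i" "\<forall>k<i. ?S div M ^ k mod M = u k" using Suc by auto
  have ui: "u i < M" using Suc by simp
  then have M: "0 < M" by simp
  have "u i * M ^ i \<le> (M - 1) * M ^ i" using ui by (intro mult_right_mono) auto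
  moreover have "(M - 1) * M ^ i + M ^ i = M ^ Suc i" using M by (cases M) auto
  ultimately have lt: "?S + u i * M ^ i < M ^ Suc i" using IH(1) by linarith
  have "(?S + u i * M ^ i) div M ^ k mod M = u k" if k: "k < Suc i" for k
  proof (cases "k = i")
    case True
    then show ?thesis using IH(1) ui M by simp
  next
    case False
    then have k: "k < i" using k by simp
    then have "M ^ i = M ^ k * (M * M ^ (i - Suc k))"
      by (metis Suc_diff_Suc add_diff_inverse_nat less_imp_le_nat not_less power_Suc power_add)
    then have e: "?S + u i * M ^ i = ?S + M ^ k * (M * (u i * M ^ (i - Suc k)))" by (simp add: mult_ac)
    have "(?S + u i * M ^ i) div M ^ k = M * (u i * M ^ (i - Suc k)) + ?S div M ^ k"
      unfolding e by (rule div_mult_self2) (use M in simp)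
    then show ?thesis using IH(2) k by simp
  qed
  then show ?case using lt by simp
qed simp

lemma land_part: "land X F div (2 ^ m) ^ k mod 2 ^ m = land (X div (2 ^ m) ^ k mod 2 ^ m) (F div (2 ^ m) ^ k mod 2 ^ m)"
  by (simp flip: power_mult take_bit_eq_mod drop_bit_eq_div)

lemma land_le: "land x y \<le> x" for x y :: nat
proof -
  have "x < 2 ^ x" by (rule less_exp)
  have "set_decode (land x y) \<subseteq> set_decode x"
    by (auto simp: set_decode_def bit_iff_odd[symmetric] bit_and_iff)
  then show ?thesis by (rule subset_decode_imp_le)
qed

lemma set_decode_bit: "set_decode x = {k. bit x k}"
  by (simp add: set_decode_def bit_iff_odd)

lemma land_eq_iff_subset: "land x y = x \<longleftrightarrow> set_decode x \<subseteq> set_decode y"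
  by (auto simp: set_decode_bit bit_eq_iff bit_and_iff)

lemma land_eq_0_iff: "land x y = 0 \<longleftrightarrow> set_decode x \<inter> set_decode y = {}"
  by (auto simp: set_decode_bit bit_eq_iff bit_and_iff)

context layout begin

lemma xs_eq: "j < n \<Longrightarrow> xs ! j = (\<Sum>k<K. part j k * M ^ k)"
  unfolding part_def using digit_sum[where i = K and X = "xs ! j" and M = M] xs[of j] by simp

text \<open>Containment and disjointness are both decided block by block; \<open>b\<close> selects
  which of them is carried over to the whole words.\<close>

lemma land_cover:
  assumes j: "j < n" and u: "\<And>k. k < K \<Longrightarrow> u k < M" "\<And>k. k < K \<Longrightarrow> land (part j k) (u k) = part j k * of_bool b"
  shows "land (xs ! j) (\<Sum>k<K. u k * M ^ k) = xs ! j * of_bool b"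
proof -
  let ?F = "\<Sum>k<K. u k * M ^ k"
  have F: "?F div M ^ k mod M = u k" if "k < K" for k using digit_of_sum[of K u M] u(1) that by blast
  have l: "land (xs ! j) ?F < M ^ K" using land_le[of "xs ! j" ?F] xs[OF j] by linarith
  have "land (xs ! j) ?F = land (xs ! j) ?F mod M ^ K" using l by simp
  also have "\<dots> = (\<Sum>k<K. (land (xs ! j) ?F div M ^ k mod M) * M ^ k)" by (rule digit_sum[symmetric])
  also have "\<dots> = (\<Sum>k<K. (part j k * of_bool b) * M ^ k)"
  proof (rule sum.cong)
    fix k assume "k \<in> {..<K}"
    then have k: "k < K" by simp
    have "land (xs ! j) ?F div M ^ k mod M = land (xs ! j div M ^ k mod M) (?F div M ^ k mod M)"
      unfolding M by (rule land_part)
    also have "\<dots> = land (part j k) (u k)" unfolding F[OF k] part_def ..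
    finally show "(land (xs ! j) ?F div M ^ k mod M) * M ^ k = (part j k * of_bool b) * M ^ k" using u(2)[OF k] by simp
  qed simp
  also have "\<dots> = xs ! j * of_bool b" using xs_eq[OF j] by (cases b) simp_all
  finally show ?thesis .
qed

lemma covers_sound:
  assumes j: "j < n" and F: "F \<in> covers Z it j (limit Z it j)"
  shows "land (xs ! j) F = xs ! j * of_bool (j < na)"
proof -
  obtain t where t: "t < limit Z it j" and Ft: "F = cover Z it j t K" using F by (auto simp: covers_def)
  have t': "t < tuples Z it j K" using t by (simp add: limit_def)
  define u where "u k = cands Z it j k ! ((t div tuples Z it j k) mod length (cands Z it j k))" for k
  have mem: "u k \<in> set (cands Z it j k)" if "k < K" for k
    unfolding u_def using cands_nonempty[OF t' that] by (intro nth_mem) simp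
  show ?thesis unfolding Ft cover_def u_def[symmetric]
    by (rule land_cover[OF j]) (use mem in \<open>auto simp: cands_def sel_def\<close>)
qed

definition disjoint_pair :: bool where
  "disjoint_pair \<longleftrightarrow> (\<exists>i<na. \<exists>j. na \<le> j \<and> j < n \<and> land (xs ! i) (xs ! j) = 0)"

lemma visit_sound:
  assumes "j < n" "\<forall>F\<in>S. \<exists>i<na. land (xs ! i) F = xs ! i" "f \<longrightarrow> disjoint_pair" "visit Z it j (S, f) = (S', f')"
  shows "(\<forall>F\<in>S'. \<exists>i<na. land (xs ! i) F = xs ! i) \<and> (f' \<longrightarrow> disjoint_pair)"
proof (cases "j < na")
  case True
  then show ?thesis using assms covers_sound[OF assms(1), of _ Z it] by (fastforce simp: visit_def Let_def)
next
  case False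
  have "disjoint_pair" if F: "F \<in> S" "F \<in> covers Z it j (limit Z it j)" for F
  proof -
    obtain i where i: "i < na" "land (xs ! i) F = xs ! i" using assms(2) F by blast
    have "land (xs ! j) F = 0" using covers_sound[OF assms(1) F(2)] False by simp
    then have "land (xs ! i) (xs ! j) = 0"
      using i(2) by (auto simp: land_eq_0_iff land_eq_iff_subset)
    then show ?thesis using i(1) False assms(1) unfolding disjoint_pair_def by (meson not_le)
  qed
  then show ?thesis using assms False by (auto simp: visit_def Let_def)
qed

text \<open>Valid for every table \<open>Z\<close>: a lookup may meet a mark of an earlier round and
  the hit is still genuine. Hence the error of the algorithm is one-sided.\<close>

lemma search_sound:
  "(\<forall>F\<in>fst (search Z it). \<exists>i<na. land (xs ! i) F = xs ! i) \<and> (snd (search Z it) \<longrightarrow> disjoint_pair)"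
proof (induction it)
  case IH: (Suc it)
  have "(\<forall>F\<in>fst (visit_all Z it (search Z it) j). \<exists>i<na. land (xs ! i) F = xs ! i) \<and>
      (snd (visit_all Z it (search Z it) j) \<longrightarrow> disjoint_pair)" if "j \<le> n" for j
    using that
  proof (induction j)
    case 0
    then show ?case using IH by simp
  next
    case (Suc j)
    show ?case
      using visit_sound[of j "fst (visit_all Z it (search Z it) j)" "snd (visit_all Z it (search Z it) j)" Z it
        "fst (visit_all Z it (search Z it) (Suc j))" "snd (visit_all Z it (search Z it) (Suc j))"] Suc by simp
  qed
  from this[of n] show ?case by simp
qed simp

lemma visit_mono: "fst Sf \<subseteq> fst (visit Z it j Sf)" "snd Sf \<Longrightarrow> snd (visit Z it j Sf)"
  by (cases Sf; auto simp: visit_def Let_def)+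

lemma visit_all_mono:
  assumes "j \<le> j'"
  shows "fst (visit_all Z it Sf j) \<subseteq> fst (visit_all Z it Sf j') \<and> (snd (visit_all Z it Sf j) \<longrightarrow> snd (visit_all Z it Sf j'))"
  using assms
proof (induction rule: dec_induct)
  case (step i)
  then show ?case using visit_mono[of "visit_all Z it Sf i" Z it i] by auto
qed simp

lemma search_mono:
  assumes "it \<le> it'" "snd (search Z it)"
  shows "snd (search Z it')"
  using assms
proof (induction rule: dec_induct)
  case (step i)
  then show ?case using visit_all_mono[of 0 n Z i "search Z i"] by simp
qed simp

text \<open>In each round the first family precedes the second, and marks and answer only grow, so
  the common cover is already marked when it is looked up.\<close>

lemma search_complete:
  assumes "i < na" "na \<le> j" "j < n" "it < pw"
    and F: "F \<in> covers Z it i (limit Z it i)" "F \<in> covers Z it j (limit Z it j)"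
  shows "snd (search Z pw)"
proof -
  let ?V = "visit_all Z it (search Z it)"
  have "F \<in> fst (?V (Suc i))" using F(1) assms(1) by (simp add: visit_def Let_def case_prod_unfold)
  then have "F \<in> fst (?V j)" using visit_all_mono[of "Suc i" j Z it "search Z it"] assms(1,2) by auto
  then have "snd (?V (Suc j))" using F(2) assms(2) by (auto simp: visit_def Let_def case_prod_unfold)
  then have "snd (?V n)" using visit_all_mono[of "Suc j" n Z it "search Z it"] assms(3) by auto
  then have "snd (search Z (Suc it))" by simp
  then show ?thesis using search_mono[of "Suc it" pw Z] assms(4) by simp
qed

text \<open>The induction adds the new top digit as a multiple of \<open>tuples Z it j i\<close>.
  Lower digits are not disturbed, because \<open>tuples Z it j (Suc k)\<close> divides this number
  for \<open>k < i\<close>.\<close>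

lemma tuple_index:
  assumes "\<And>k. k < i \<Longrightarrow> p k < length (cands Z it j k)"
  shows "\<exists>t<tuples Z it j i. \<forall>k<i. (t div tuples Z it j k) mod length (cands Z it j k) = p k"
  using assms
proof (induction i)
  case 0
  then show ?case by (simp add: tuples_def)
next
  case (Suc i)
  let ?T = "tuples Z it j"
  let ?l = "\<lambda>k. length (cands Z it j k)"
  obtain t where t: "t < ?T i" "\<forall>k<i. (t div ?T k) mod ?l k = p k" using Suc by auto
  have pi: "p i < ?l i" using Suc by simp
  have TS: "?T (Suc k) = ?T k * ?l k" for k by (simp add: tuples_def)
  have "(p i + 1) * ?T i \<le> ?l i * ?T i" using pi by (intro mult_right_mono) auto
  then have lt: "t + p i * ?T i < ?T (Suc i)" using t(1) unfolding TS by (simp add: algebra_simps)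
  have "((t + p i * ?T i) div ?T k) mod ?l k = p k" if k: "k < Suc i" for k
  proof (cases "k = i")
    case True
    then show ?thesis using t(1) pi by simp
  next
    case False
    then have k: "k < i" using k by simp
    have "?T (Suc k) dvd ?T i"
      unfolding tuples_def using k by (intro prod_dvd_prod_subset) auto
    then obtain r where r: "?T i = ?T k * ?l k * r" unfolding TS by (auto simp: dvd_def)
    have "0 < ?T k" using t(1) r by (intro Nat.gr0I) auto
    have e: "t + p i * ?T i = t + ?T k * (?l k * (r * p i))" unfolding r by (simp add: mult_ac)
    have "(t + p i * ?T i) div ?T k = ?l k * (r * p i) + t div ?T k"
      unfolding e by (rule div_mult_self2) (use \<open>0 < ?T k\<close> in simp)
    then show ?thesis using t(2) k by simp
  qed
  then show ?case using lt by blast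
qed

lemma covers_complete:
  assumes u: "\<And>k. k < K \<Longrightarrow> u k < M \<and> sel Z it j k (u k)" and cap: "tuples Z it j K \<le> cap"
  shows "(\<Sum>k<K. u k * M ^ k) \<in> covers Z it j (limit Z it j)"
proof -
  have "\<exists>p<length (cands Z it j k). cands Z it j k ! p = u k" if "k < K" for k
  proof -
    have "u k \<in> set (cands Z it j k)" using u[OF that] by (simp add: cands_def)
    then show ?thesis by (simp add: in_set_conv_nth)
  qed
  then obtain p where p: "\<And>k. k < K \<Longrightarrow> p k < length (cands Z it j k) \<and> cands Z it j k ! p k = u k"
    by metis
  then obtain t where t: "t < tuples Z it j K" "\<forall>k<K. (t div tuples Z it j k) mod length (cands Z it j k) = p k"
    using tuple_index[of K p Z it j] by blast
  have "cover Z it j t K = (\<Sum>k<K. u k * M ^ k)"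
    unfolding cover_def using t(2) p by (intro sum.cong) auto
  then show ?thesis using t(1) cap unfolding covers_def limit_def by (metis image_eqI lessThan_iff min.absorb1)
qed

end

section \<open>Counting the covers of one block, and the rounds with the right guesses\<close>

lemma popcount_split: "popcount x = popcount (x div 2 ^ m) + popcount (x mod 2 ^ m)"
proof -
  have "set_decode x = (\<lambda>k. k + m) ` set_decode (x div 2 ^ m) \<union> set_decode (x mod 2 ^ m)"
  proof (intro set_eqI)
    fix k
    show "k \<in> set_decode x \<longleftrightarrow> k \<in> (\<lambda>k. k + m) ` set_decode (x div 2 ^ m) \<union> set_decode (x mod 2 ^ m)"
    proof (cases "k < m")
      case True
      then show ?thesis by (auto simp: set_decode_bit bit_take_bit_iff simp flip: take_bit_eq_mod)
    next
      case False
      then obtain j where j: "k = j + m" by (metis add.commute le_Suc_ex not_less)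
      have "k \<in> (\<lambda>k. k + m) ` set_decode (x div 2 ^ m) \<longleftrightarrow> j \<in> set_decode (x div 2 ^ m)"
        unfolding j by auto
      moreover have "j \<in> set_decode (x div 2 ^ m) \<longleftrightarrow> k \<in> set_decode x"
        by (simp add: set_decode_bit bit_drop_bit_eq j add.commute flip: drop_bit_eq_div)
      moreover have "k \<notin> set_decode (x mod 2 ^ m)"
        using False by (simp add: set_decode_bit bit_take_bit_iff flip: take_bit_eq_mod)
      ultimately show ?thesis by blast
    qed
  qed
  then have "popcount x = card ((\<lambda>k. k + m) ` set_decode (x div 2 ^ m) \<union> set_decode (x mod 2 ^ m))"
    unfolding popcount_def by simp
  also have "\<dots> = card ((\<lambda>k. k + m) ` set_decode (x div 2 ^ m)) + card (set_decode (x mod 2 ^ m))"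
    by (intro card_Un_disjoint finite_imageI finite_set_decode)
      (auto simp: set_decode_bit bit_take_bit_iff simp flip: take_bit_eq_mod)
  finally show ?thesis by (simp add: popcount_def card_image)
qed

lemma popcount_digits: "x < (2 ^ m) ^ K \<Longrightarrow> popcount x = (\<Sum>k<K. popcount (x div (2 ^ m) ^ k mod 2 ^ m))"
proof (induction K arbitrary: x)
  case (Suc K)
  have "x div 2 ^ m < (2 ^ m) ^ K" using Suc.prems by (simp add: less_mult_imp_div_less mult.commute)
  then have "popcount (x div 2 ^ m) = (\<Sum>k<K. popcount (x div 2 ^ m div (2 ^ m) ^ k mod 2 ^ m))" by (rule Suc.IH)
  also have "\<dots> = (\<Sum>k<K. popcount (x div (2 ^ m) ^ Suc k mod 2 ^ m))"
    by (simp add: div_mult2_eq)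
  finally show ?case using popcount_split[of x m] unfolding sum.lessThan_Suc_shift by simp
qed simp

text \<open>Removing \<open>A\<close> is a bijection onto the \<open>y\<close>-element subsets of
  the positions outside both sets.\<close>

lemma card_between:
  fixes A B :: "nat set"
  assumes "A \<subseteq> {..<m}" "B \<subseteq> {..<m}" "A \<inter> B = {}"
  shows "card {T. A \<subseteq> T \<and> T \<inter> B = {} \<and> T \<subseteq> {..<m} \<and> card T = card A + y} = (m - card A - card B) choose y"
proof -
  have fin: "finite A" "finite B" using assms finite_subset by blast+
  let ?R = "{..<m} - A - B"
  have "bij_betw (\<lambda>T. T - A) {T. A \<subseteq> T \<and> T \<inter> B = {} \<and> T \<subseteq> {..<m} \<and> card T = card A + y} {T. T \<subseteq> ?R \<and> card T = y}"
  proof (intro bij_betwI[where g = "\<lambda>T. T \<union> A"])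
    show "(\<lambda>T. T - A) \<in> {T. A \<subseteq> T \<and> T \<inter> B = {} \<and> T \<subseteq> {..<m} \<and> card T = card A + y} \<rightarrow> {T. T \<subseteq> ?R \<and> card T = y}"
      using fin by (auto simp: card_Diff_subset)
    show "(\<lambda>T. T \<union> A) \<in> {T. T \<subseteq> ?R \<and> card T = y} \<rightarrow> {T. A \<subseteq> T \<and> T \<inter> B = {} \<and> T \<subseteq> {..<m} \<and> card T = card A + y}"
    proof
      fix T assume T: "T \<in> {T. T \<subseteq> ?R \<and> card T = y}"
      then have "finite T" by (auto intro: finite_subset)
      then have "card (T \<union> A) = card T + card A" using T fin by (intro card_Un_disjoint) auto
      then show "T \<union> A \<in> {T. A \<subseteq> T \<and> T \<inter> B = {} \<and> T \<subseteq> {..<m} \<and> card T = card A + y}"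
        using T assms by auto
    qed
  qed auto
  then have "card {T. A \<subseteq> T \<and> T \<inter> B = {} \<and> T \<subseteq> {..<m} \<and> card T = card A + y} = card {T. T \<subseteq> ?R \<and> card T = y}"
    by (rule bij_betw_same_card)
  also have "\<dots> = card ?R choose y" by (intro n_subsets) auto
  also have "card ?R = m - card A - card B"
    using assms fin by (subst card_Diff_subset, simp, blast, subst card_Diff_subset) auto
  finally show ?thesis .
qed

lemma set_decode_subset_iff: "set_decode u \<subseteq> {..<m} \<longleftrightarrow> u < 2 ^ m"
proof
  assume "set_decode u \<subseteq> {..<m}"
  then have "take_bit m u = u" by (auto simp: set_decode_bit bit_eq_iff bit_take_bit_iff)
  then show "u < 2 ^ m" by (metis take_bit_nat_less_exp)
next
  assume "u < 2 ^ m"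
  then have "take_bit m u = u" by (simp add: take_bit_nat_eq_self)
  then have "bit u k \<Longrightarrow> k < m" for k using bit_take_bit_iff[of m u k] by simp
  then show "set_decode u \<subseteq> {..<m}" by (auto simp: set_decode_bit)
qed

text \<open>Taking 0 for one of the words drops its constraint, so one formula counts the covers of
  the pair as well as those compatible with only one member.\<close>

lemma card_words_between:
  assumes "x < 2 ^ m" "y < 2 ^ m" "land x y = 0"
  shows "card {u. u < 2 ^ m \<and> land x u = x \<and> land y u = 0 \<and> popcount u = popcount x + k} =
    (m - popcount x - popcount y) choose k"
proof -
  let ?A = "set_decode x" and ?B = "set_decode y"
  have "bij_betw set_decode {u. u < 2 ^ m \<and> land x u = x \<and> land y u = 0 \<and> popcount u = popcount x + k}
     {T. ?A \<subseteq> T \<and> T \<inter> ?B = {} \<and> T \<subseteq> {..<m} \<and> card T = card ?A + k}"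
  proof (intro bij_betwI[where g = set_encode])
    show "set_encode \<in> {T. ?A \<subseteq> T \<and> T \<inter> ?B = {} \<and> T \<subseteq> {..<m} \<and> card T = card ?A + k} \<rightarrow>
      {u. u < 2 ^ m \<and> land x u = x \<and> land y u = 0 \<and> popcount u = popcount x + k}"
    proof
      fix T assume T: "T \<in> {T. ?A \<subseteq> T \<and> T \<inter> ?B = {} \<and> T \<subseteq> {..<m} \<and> card T = card ?A + k}"
      then have "finite T" by (auto intro: finite_subset)
      then show "set_encode T \<in> {u. u < 2 ^ m \<and> land x u = x \<and> land y u = 0 \<and> popcount u = popcount x + k}"
        using T by (auto simp: land_eq_iff_subset land_eq_0_iff popcount_def simp flip: set_decode_subset_iff)
    qed
    show "set_decode (set_encode T) = T" if "T \<in> {T. ?A \<subseteq> T \<and> T \<inter> ?B = {} \<and> T \<subseteq> {..<m} \<and> card T = card ?A + k}" for T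
      using that by (auto intro!: set_encode_inverse intro: finite_subset)
    show "set_decode \<in> {u. u < 2 ^ m \<and> land x u = x \<and> land y u = 0 \<and> popcount u = popcount x + k} \<rightarrow>
      {T. ?A \<subseteq> T \<and> T \<inter> ?B = {} \<and> T \<subseteq> {..<m} \<and> card T = card ?A + k}"
    proof
      fix u assume u: "u \<in> {u. u < 2 ^ m \<and> land x u = x \<and> land y u = 0 \<and> popcount u = popcount x + k}"
      then have "set_decode u \<subseteq> {..<m}" by (simp add: set_decode_subset_iff)
      then show "set_decode u \<in> {T. ?A \<subseteq> T \<and> T \<inter> ?B = {} \<and> T \<subseteq> {..<m} \<and> card T = card ?A + k}"
        using u by (simp add: land_eq_iff_subset land_eq_0_iff popcount_def Int_commute)
    qed
  qed simp
  then have "card {u. u < 2 ^ m \<and> land x u = x \<and> land y u = 0 \<and> popcount u = popcount x + k} =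
     card {T. ?A \<subseteq> T \<and> T \<inter> ?B = {} \<and> T \<subseteq> {..<m} \<and> card T = card ?A + k}"
    by (rule bij_betw_same_card)
  also have "\<dots> = (m - card ?A - card ?B) choose k"
    by (rule card_between) (use assms in \<open>simp_all add: land_eq_0_iff set_decode_subset_iff\<close>)
  finally show ?thesis by (simp add: popcount_def)
qed

text \<open>Thresholds that are powers of two leave only \<open>m + 1\<close> guesses for the
  density, at the price of a factor 2. The least sufficient exponent works.\<close>

lemma threshold_exists:
  fixes x m :: nat
  assumes "1 \<le> x" "x \<le> 2 ^ m"
  shows "\<exists>q\<le>m. 2 ^ m \<le> x * 2 ^ q \<and> x * 2 ^ q \<le> 2 * 2 ^ m"
proof -
  define q where "q = (LEAST q. 2 ^ m \<le> x * 2 ^ q)"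
  have P: "2 ^ m \<le> x * 2 ^ m" using assms by simp
  have q: "2 ^ m \<le> x * 2 ^ q" "q \<le> m" unfolding q_def using P by (rule LeastI, rule Least_le)
  have "x * 2 ^ q \<le> 2 * 2 ^ m"
  proof (cases q)
    case 0
    then show ?thesis using assms by simp
  next
    case (Suc r)
    then have "\<not> 2 ^ m \<le> x * 2 ^ r" unfolding q_def using not_less_Least by (metis lessI)
    then show ?thesis using Suc by simp
  qed
  then show ?thesis using q by blast
qed

text \<open>Only the lowest \<open>L\<close> digits are prescribed; the free upper digits number the
  repetitions of one guess.\<close>

lemma (in layout) digit_indices:
  fixes v :: "nat \<Rightarrow> nat"
  assumes v: "\<And>i. i < L \<Longrightarrow> v i < d + 2" and pw: "pw = (d + 2) ^ e" and L: "L \<le> e"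
  shows "(d + 2) ^ (e - L) \<le> card {it. it < pw \<and> (\<forall>i<L. digit it i = v i)}"
proof -
  let ?B = "d + 2"
  define g where "g = (\<Sum>i<L. v i * ?B ^ i)"
  have g: "g < ?B ^ L" "\<And>i. i < L \<Longrightarrow> g div ?B ^ i mod ?B = v i"
    using digit_of_sum[of L v ?B] v unfolding g_def by blast+
  have eL: "?B ^ e = ?B ^ L * ?B ^ (e - L)" using L by (simp flip: power_add)
  have "(\<lambda>r. g + ?B ^ L * r) ` {..<?B ^ (e - L)} \<subseteq> {it. it < pw \<and> (\<forall>i<L. digit it i = v i)}"
  proof
    fix it assume "it \<in> (\<lambda>r. g + ?B ^ L * r) ` {..<?B ^ (e - L)}"
    then obtain r where r: "r < ?B ^ (e - L)" "it = g + ?B ^ L * r" by auto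
    have "?B ^ L * (r + 1) \<le> ?B ^ L * ?B ^ (e - L)" using r by (intro mult_left_mono) auto
    then have "it < pw" unfolding pw eL r(2) using g(1) by (simp only: distrib_left mult_1_right)
    moreover have "digit it i = v i" if i: "i < L" for i
    proof -
      have "?B ^ L = ?B ^ i * (?B * ?B ^ (L - Suc i))"
        using i by (metis Suc_diff_Suc add_diff_inverse_nat less_imp_le_nat not_less power_Suc power_add)
      then have e: "it = g + ?B ^ i * (?B * (?B ^ (L - Suc i) * r))" unfolding r(2) by (simp add: mult_ac)
      have "it div ?B ^ i = ?B * (?B ^ (L - Suc i) * r) + g div ?B ^ i"
        unfolding e by (rule div_mult_self2) simp
      then show ?thesis unfolding digit_def using g(2)[OF i] by (simp only: mod_mult_self4)
    qed
    ultimately show "it \<in> {it. it < pw \<and> (\<forall>i<L. digit it i = v i)}" by blast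
  qed
  then have "card ((\<lambda>r. g + ?B ^ L * r) ` {..<?B ^ (e - L)}) \<le> card {it. it < pw \<and> (\<forall>i<L. digit it i = v i)}"
    by (intro card_mono) auto
  moreover have "inj_on (\<lambda>r. g + ?B ^ L * r) {..<?B ^ (e - L)}" by (auto intro!: inj_onI)
  ultimately show ?thesis by (simp add: card_image)
qed

lemma (in layout) popcount_parts_le:
  assumes "land (xs ! i) (xs ! j) = 0"
  shows "popcount (part i k) + popcount (part j k) \<le> m"
proof -
  have disj: "land (part i k) (part j k) = 0"
    using land_part[of "xs ! i" "xs ! j" m k] assms unfolding part_def unfolding M by simp
  have "popcount (part i k) + popcount (part j k) = card (set_decode (part i k) \<union> set_decode (part j k))"
    using disj unfolding popcount_def land_eq_0_iff by (simp add: card_Un_disjoint)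
  also have "\<dots> \<le> card {..<m}"
    using part_less[of i k] part_less[of j k] unfolding M by (intro card_mono) (simp_all add: set_decode_subset_iff)
  finally show ?thesis by simp
qed

section \<open>Success probability of the whole run\<close>

context program_layout begin

lemma search_success:
  fixes \<rho> :: real and i0 j0 :: nat
  defines "a \<equiv> \<lambda>k. popcount (part i0 k)" and "b \<equiv> \<lambda>k. popcount (part j0 k)"
  defines "c \<equiv> \<lambda>k. m - a k - b k"
  defines "y \<equiv> \<lambda>k. nat \<lfloor>\<rho> * (real (c k) + 1)\<rfloor>"
  assumes pair: "i0 < na" "na \<le> j0" "j0 < n" "land (xs ! i0) (xs ! j0) = 0" and \<rho>: "0 < \<rho>" "\<rho> < 1"
    and capA: "16 ^ K * (\<Prod>k<K. real ((b k + c k) choose y k) / real (c k choose y k)) \<le> real cap"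
    and capB: "16 ^ K * (\<Prod>k<K. real ((a k + c k) choose (c k - y k)) / real (c k choose y k)) \<le> real cap"
    and e: "2 * K \<le> e" "(1 - (1 / 4) ^ K) ^ ((d + 2) ^ (e - 2 * K)) \<le> (1 / 3 :: real)"
  shows "measure_pmf.prob (Pi_pmf {..<pw * K * M} 0 (\<lambda>_. pmf_of_set {..<M})) {Z. snd (search Z pw)} \<ge> 2 / 3"
proof -
  have disj: "land (part i0 k) (part j0 k) = 0" for k
    using land_part[of "xs ! i0" "xs ! j0" m k] pair(4) unfolding part_def unfolding M by simp
  have pl: "part j k < 2 ^ m" for j k using part_less[of j k] by (simp add: M)
  have abm: "a k + b k \<le> m" for k
    unfolding a_def b_def by (rule popcount_parts_le[OF pair(4)])
  have yc: "y k \<le> c k" for k unfolding y_def by (rule binomial_mode_index_le[OF \<rho>])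
  define U where "U k = {u. u < M \<and> land (part i0 k) u = part i0 k \<and> land (part j0 k) u = 0 \<and> popcount u = a k + y k}" for k
  define V where "V k = {u. u < M \<and> land (part i0 k) u = part i0 k \<and> popcount u = a k + y k}" for k
  define W where "W k = {u. u < M \<and> land (part j0 k) u = 0 \<and> popcount u = a k + y k}" for k
  have cU: "card (U k) = c k choose y k" for k
    unfolding U_def a_def using card_words_between[OF pl pl disj, folded M] by (simp add: c_def a_def b_def)
  have cV: "card (V k) = (b k + c k) choose y k" for k
    using card_words_between[OF pl[of i0 k], of 0 "y k", folded M] Mpos abm[of k] by (simp add: V_def a_def b_def c_def)
  have cW: "card (W k) = (a k + c k) choose (c k - y k)" for k
  proof -
    have "card (W k) = (m - b k) choose (a k + y k)"
      using card_words_between[OF _ pl[of j0 k], of 0 "a k + y k", folded M] Mpos by (simp add: W_def b_def)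
    also have "m - b k = a k + c k" using abm[of k] by (simp add: c_def)
    also have "(a k + c k) choose (a k + y k) = (a k + c k) choose (c k - y k)"
      using binomial_symmetric[of "a k + y k" "a k + c k"] yc[of k] by simp
    finally show ?thesis .
  qed
  have U1: "1 \<le> card (U k)" for k unfolding cU using yc[of k] by (simp add: Suc_le_eq)
  have sub: "U k \<subseteq> {..<M}" "V k \<subseteq> {..<M}" "W k \<subseteq> {..<M}" "U k \<subseteq> V k" "U k \<subseteq> W k" for k
    by (auto simp: U_def V_def W_def)
  have fin: "finite (V k)" "finite (W k)" for k using finite_subset[OF sub(2)[of k]] finite_subset[OF sub(3)[of k]] by simp_all
  have "card (U k) \<le> 2 ^ m" for k using card_mono[OF _ sub(1)[of k]] by (simp add: M)
  then have "\<forall>k. \<exists>q. q \<le> m \<and> 2 ^ m \<le> card (U k) * 2 ^ q \<and> card (U k) * 2 ^ q \<le> 2 * 2 ^ m"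
    using threshold_exists[OF U1] by blast
  from choice[OF this] obtain q where q: "\<And>k. q k \<le> m" "\<And>k. 2 ^ m \<le> card (U k) * 2 ^ q k" "\<And>k. card (U k) * 2 ^ q k \<le> 2 * 2 ^ m"
    by blast
  define S where "S = {it. it < pw \<and> (\<forall>i<2 * K. digit it i = (if even i then a (i div 2) + y (i div 2) else q (i div 2)))}"
  \<comment> \<open>Both kinds of guesses are at most \<open>m\<close>, hence digits in base
    \<open>d + 2\<close>.\<close>
  have mlt: "m < d + 2" using m_eq div_le_dividend[of d K] by linarith
  have S: "(d + 2) ^ (e - 2 * K) \<le> card S"
    unfolding S_def
  proof (rule digit_indices)
    fix i
    have "a (i div 2) + y (i div 2) \<le> m" using abm[of "i div 2"] yc[of "i div 2"] by (simp add: c_def)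
    then show "(if even i then a (i div 2) + y (i div 2) else q (i div 2)) < d + 2"
      using q(1)[of "i div 2"] mlt by auto
  qed (use e pw_eq in auto)
  have Sd: "digit it (2 * k) = a k + y k" "digit it (2 * k + 1) = q k" "it < pw" if "it \<in> S" "k < K" for it k
    using that unfolding S_def by auto
  define E where "E k = {Z :: nat \<Rightarrow> nat. (\<exists>u\<in>U k. Z u < 2 ^ q k) \<and>
     real (card {u\<in>V k. Z u < 2 ^ q k}) \<le> 8 * real (card (V k)) * real (2 ^ q k) / real M \<and>
     real (card {u\<in>W k. Z u < 2 ^ q k}) \<le> 8 * real (card (W k)) * real (2 ^ q k) / real M}" for k
  have "measure_pmf.prob (Pi_pmf {..<M} 0 (\<lambda>_. pmf_of_set {..<M})) (E k) \<ge> 1 / 4" for k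
    unfolding E_def
  proof (rule cell_success)
    show "2 ^ q k \<le> M" unfolding M using q(1) by (intro power_increasing) auto
    show "real M \<le> real (card (U k)) * real (2 ^ q k)"
      using of_nat_mono[OF q(2)[of k], where 'a = real] unfolding M by simp
    show "0 < card (V k)" "0 < card (W k)"
      using U1[of k] card_mono[OF fin(1) sub(4)[of k]] card_mono[OF fin(2) sub(5)[of k]] by linarith+
  qed (use sub Mpos in auto)
  then have "1 - (1 - (1 / 4) ^ K) ^ card S \<le>
     measure_pmf.prob (Pi_pmf {..<pw * K * M} 0 (\<lambda>_. pmf_of_set {..<M})) {f. \<exists>t\<in>S. \<forall>i<K. chunk M 0 f (t * K + i) \<in> E i}"
    by (intro chunk_success) (auto simp: S_def)
  also have "\<dots> \<le> measure_pmf.prob (Pi_pmf {..<pw * K * M} 0 (\<lambda>_. pmf_of_set {..<M})) {Z. snd (search Z pw)}"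
  proof (intro measure_pmf.finite_measure_mono subsetI CollectI)
    fix Z assume "Z \<in> {f. \<exists>t\<in>S. \<forall>i<K. chunk M 0 f (t * K + i) \<in> E i}"
    then obtain it where it: "it \<in> S" "\<And>k. k < K \<Longrightarrow> chunk M 0 Z (it * K + k) \<in> E k" by blast
    have itpw: "it < pw" using it(1) by (simp add: S_def)
    define X where "X k = chunk M 0 Z (it * K + k)" for k
    have XE: "\<And>k. k < K \<Longrightarrow> X k \<in> E k" using it(2) by (simp add: X_def)
    have Xu: "X k u = Z ((it * K + k) * M + u)" if "u < M" for k u using that by (simp add: X_def chunk_def)
    obtain u where u: "\<And>k. k < K \<Longrightarrow> u k \<in> U k \<and> X k (u k) < 2 ^ q k"
      using XE unfolding E_def mem_Collect_eq by metis
    have lenA: "length (cands Z it i0 k) = card {u\<in>V k. X k u < 2 ^ q k}" if k: "k < K" for k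
    proof -
      have "length (cands Z it i0 k) = card ({u. sel Z it i0 k u} \<inter> set [0..<M])"
        unfolding cands_def by (rule distinct_length_filter) simp
      also have "{u. sel Z it i0 k u} \<inter> set [0..<M] = {u\<in>V k. X k u < 2 ^ q k}"
        using Sd[OF it(1) k] pair(1) Xu by (auto simp: sel_def V_def)
      finally show ?thesis .
    qed
    have lenB: "length (cands Z it j0 k) = card {u\<in>W k. X k u < 2 ^ q k}" if k: "k < K" for k
    proof -
      have "length (cands Z it j0 k) = card ({u. sel Z it j0 k u} \<inter> set [0..<M])"
        unfolding cands_def by (rule distinct_length_filter) simp
      also have "{u. sel Z it j0 k u} \<inter> set [0..<M] = {u\<in>W k. X k u < 2 ^ q k}"
        using Sd[OF it(1) k] pair(2) Xu by (auto simp: sel_def W_def)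
      finally show ?thesis .
    qed
    \<comment> \<open>The factor 8 comes from Markov's inequality, another 2 from rounding the
      threshold to a power of two; over all blocks this is the \<open>16 ^ K\<close> in the
      assumptions on the cap.\<close>
    have ratio: "8 * real v * real (2 ^ q k) / real M \<le> 16 * (real v / real (c k choose y k))" for v k
    proof -
      have "real (c k choose y k) * real (2 ^ q k) \<le> 2 * real M"
        using of_nat_mono[OF q(3)[of k], where 'a = real] unfolding M cU by simp
      moreover have "0 < real (c k choose y k)" "0 < real M" using yc[of k] Mpos by simp_all
      ultimately have "real (2 ^ q k) / real M \<le> 2 / real (c k choose y k)" by (simp add: field_simps)
      then have "8 * real v * (real (2 ^ q k) / real M) \<le> 8 * real v * (2 / real (c k choose y k))"
        by (intro mult_left_mono) auto
      then show ?thesis by simp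
    qed
    have "tuples Z it i0 K \<le> cap"
    proof -
      have "real (tuples Z it i0 K) = (\<Prod>k<K. real (length (cands Z it i0 k)))" by (simp add: tuples_def)
      also have "\<dots> \<le> (\<Prod>k<K. 16 * (real ((b k + c k) choose y k) / real (c k choose y k)))"
      proof (intro prod_mono conjI)
        fix k assume "k \<in> {..<K}"
        then have k: "k < K" by simp
        have "real (length (cands Z it i0 k)) \<le> 8 * real (card (V k)) * real (2 ^ q k) / real M"
          using XE[OF k] lenA[OF k] by (simp add: E_def)
        then show "real (length (cands Z it i0 k)) \<le> 16 * (real ((b k + c k) choose y k) / real (c k choose y k))"
          using ratio[of "card (V k)" k] unfolding cV by linarith
      qed simp
      also have "\<dots> = 16 ^ K * (\<Prod>k<K. real ((b k + c k) choose y k) / real (c k choose y k))"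
        unfolding prod.distrib by simp
      finally show ?thesis using capA by linarith
    qed
    moreover have "tuples Z it j0 K \<le> cap"
    proof -
      have "real (tuples Z it j0 K) = (\<Prod>k<K. real (length (cands Z it j0 k)))" by (simp add: tuples_def)
      also have "\<dots> \<le> (\<Prod>k<K. 16 * (real ((a k + c k) choose (c k - y k)) / real (c k choose y k)))"
      proof (intro prod_mono conjI)
        fix k assume "k \<in> {..<K}"
        then have k: "k < K" by simp
        have "real (length (cands Z it j0 k)) \<le> 8 * real (card (W k)) * real (2 ^ q k) / real M"
          using XE[OF k] lenB[OF k] by (simp add: E_def)
        then show "real (length (cands Z it j0 k)) \<le> 16 * (real ((a k + c k) choose (c k - y k)) / real (c k choose y k))"
          using ratio[of "card (W k)" k] unfolding cW by linarith
      qed simp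
      also have "\<dots> = 16 ^ K * (\<Prod>k<K. real ((a k + c k) choose (c k - y k)) / real (c k choose y k))"
        unfolding prod.distrib by simp
      finally show ?thesis using capB by linarith
    qed
    moreover have "u k < M \<and> sel Z it i0 k (u k)" "u k < M \<and> sel Z it j0 k (u k)" if k: "k < K" for k
      using u[OF k] Sd[OF it(1) k] pair(1,2) Xu[of "u k" k] by (auto simp: U_def sel_def)
    ultimately have "(\<Sum>k<K. u k * M ^ k) \<in> covers Z it i0 (limit Z it i0)" "(\<Sum>k<K. u k * M ^ k) \<in> covers Z it j0 (limit Z it j0)"
      by (intro covers_complete; blast)+
    then show "snd (search Z pw)" using search_complete[OF pair(1-3) itpw] by blast
  qed simp
  finally have "1 - (1 - (1 / 4) ^ K) ^ card S \<le>
    measure_pmf.prob (Pi_pmf {..<pw * K * M} 0 (\<lambda>_. pmf_of_set {..<M})) {Z. snd (search Z pw)}" .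
  moreover have "(1 - (1 / 4) ^ K) ^ card S \<le> (1 - (1 / 4) ^ K :: real) ^ ((d + 2) ^ (e - 2 * K))"
    using S by (intro power_decreasing) (auto simp: power_le_one)
  ultimately show ?thesis using e(2) by linarith
qed

lemma monte_carlo_program:
  assumes time: "real total_time \<le> tb" and space: "real (6 * Big) \<le> sb"
    and success: "disjoint_pair \<Longrightarrow> measure_pmf.prob (Pi_pmf {..<pw * K * M} 0 (\<lambda>_. pmf_of_set {..<M})) {Z. snd (search Z pw)} \<ge> 2 / 3"
  shows "monte_carlo_decides w (program K e p q) inp disjoint_pair tb sb"
proof -
  let ?D = "Pi_pmf {..<pw * K * M} 0 (\<lambda>_. pmf_of_set {..<M})"
  obtain r where r: "map_pmf fst r = ?D" "\<forall>x\<in>set_pmf r. search_inv (fst x) (search (fst x) pw) (snd x)"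
    "run w total_time (program K e p q, init_state inp) = map_pmf (\<lambda>x. (Skip, snd x)) r"
    using program_correct unfolding triple_def by blast
  have "c = Skip \<and> real (space_used t) \<le> sb"
    if ct: "(c, t) \<in> set_pmf (run w total_time (program K e p q, init_state inp))" for c t
  proof -
    obtain z where "z \<in> set_pmf r" "c = Skip" "t = snd z"
      using ct unfolding r(3) set_map_pmf by blast
    then have "space_used t \<le> 6 * Big" using r(2) by (auto simp: search_inv_def params_def)
    then have "real (space_used t) \<le> real (6 * Big)" by (simp only: of_nat_le_iff)
    then show ?thesis using \<open>c = Skip\<close> space by linarith
  qed
  moreover have "2 / 3 \<le> measure_pmf.prob (run w total_time (program K e p q, init_state inp))
        {(c, s). (regs s 0 \<noteq> 0) = disjoint_pair}"
  proof -
    let ?G = "{Z. snd (search Z pw) = disjoint_pair}"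
    have "2 / 3 \<le> measure_pmf.prob ?D ?G"
    proof (cases disjoint_pair)
      case True
      then show ?thesis using success by simp
    next
      case False
      then have "?G = UNIV" using search_sound by auto
      then show ?thesis by simp
    qed
    also have "\<dots> = measure_pmf.prob r (fst -` ?G)" unfolding r(1)[symmetric] by simp
    \<comment> \<open>Here the coupling pays off: an event about \<open>Z\<close> becomes one about
      the final state.\<close>
    also have "\<dots> \<le> measure_pmf.prob r {x. (regs (snd x) 0 \<noteq> 0) = disjoint_pair}"
    proof (rule measure_pmf.finite_measure_mono_AE)
      show "AE x in measure_pmf r. x \<in> fst -` ?G \<longrightarrow> x \<in> {x. (regs (snd x) 0 \<noteq> 0) = disjoint_pair}"
        using r(2) by (intro AE_pmfI) (auto simp: search_inv_def)
    qed simp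
    also have "\<dots> = measure_pmf.prob (run w total_time (program K e p q, init_state inp))
        {(c, s). (regs s 0 \<noteq> 0) = disjoint_pair}"
      unfolding r(3) by (simp add: vimage_def)
    finally show ?thesis .
  qed
  ultimately show ?thesis unfolding monte_carlo_decides_def using time by blast
qed

end

section \<open>Time, space and the main theorem\<close>

text \<open>Every quantity is at most \<open>2 ^ (a * (d + 1))\<close> with \<open>a\<close>
  independent of the input, so words of \<open>\<kappa> * (d + 1)\<close> bits suffice. For the
  number of sets this uses that a universe of size \<open>d\<close> has only \<open>2 ^ d\<close>
  subsets.\<close>

lemma program_layout_intro:
  fixes d K e p q s na nb :: nat and xs :: "nat list"
  assumes K: "0 < K" and s: "s = d * p div q" "s \<le> d" and len: "length xs = na + nb" "na \<le> 2 ^ d" "nb \<le> 2 ^ d"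
    and xs: "\<And>x. x \<in> set xs \<Longrightarrow> x < 2 ^ (d + 1)" and \<kappa>: "e + 2 * K + p + q + 20 \<le> \<kappa>"
  shows "program_layout (\<kappa> * (d + 1)) d na (na + nb) (d div K + 1) (2 ^ (d div K + 1)) ((d + 2) ^ e)
    ((2 ^ (d div 2 + s) div (d choose (s div 2)) + 1) * (d + 2) ^ e)
    ((2 ^ (d div K + 1)) ^ K + (d + 2) ^ e * K * 2 ^ (d div K + 1) + (na + nb) + 3) K xs nb s e p q"
proof -
  define D where "D = d + 1"
  let ?m = "d div K + 1"
  let ?M = "2 ^ ?m :: nat"
  let ?pw = "(d + 2) ^ e"
  let ?cap = "(2 ^ (d div 2 + s) div (d choose (s div 2)) + 1) * ?pw"
  have D: "1 \<le> D" by (simp add: D_def)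
  have up: "x < 2 ^ (\<kappa> * D)" if "x \<le> 2 ^ (a * D)" "a < \<kappa>" for x a :: nat
  proof -
    have "(2::nat) ^ (a * D) < 2 ^ (\<kappa> * D)" using that(2) D by (intro power_strict_increasing) auto
    then show ?thesis using that(1) by linarith
  qed
  have mono: "(2::nat) ^ (a * D) \<le> 2 ^ (b * D)" if "a \<le> b" for a b using that by (intro power_increasing) auto
  have le_pow: "x \<le> 2 ^ (x * D)" for x :: nat
  proof -
    have "x < 2 ^ x" by (rule less_exp)
    also have "(2::nat) ^ x \<le> 2 ^ (x * D)" using D by (intro power_increasing) auto
    finally show ?thesis by simp
  qed
  have d2: "d + 2 \<le> 2 ^ D" using less_exp[of D] by (simp add: D_def)
  have pw: "?pw \<le> 2 ^ (e * D)"
  proof -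
    have "?pw \<le> (2 ^ D) ^ e" using d2 by (intro power_mono) auto
    then show ?thesis by (simp add: mult.commute flip: power_mult)
  qed
  have mK: "d + 1 \<le> ?m * K" "?m * K \<le> d + K"
  proof -
    have "?m * K = d div K * K + K" by simp
    moreover have "d div K * K + d mod K = d" "d mod K < K" using K by (simp_all only: div_mult_mod_eq mod_less_divisor)
    ultimately show "d + 1 \<le> ?m * K" "?m * K \<le> d + K" by linarith+
  qed
  have MK: "?M ^ K = 2 ^ (?m * K)" by (simp only: power_mult)
  have dK: "d + K \<le> K * D" using K by (cases K) (simp_all add: D_def)
  have MKle: "?M ^ K \<le> 2 ^ (K * D)" unfolding MK by (rule power_increasing[OF order_trans[OF mK(2) dK]]) simp
  have "?m \<le> D" unfolding D_def using div_le_dividend[of d K] by linarith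
  then have Mle: "?M \<le> 2 ^ (1 * D)" by (intro power_increasing) auto
  have nle: "na + nb \<le> 2 ^ (1 * D)" using len by (simp add: D_def)
  have "?pw * K * ?M \<le> 2 ^ (e * D) * 2 ^ (K * D) * 2 ^ (1 * D)" using pw le_pow[of K] Mle by (intro mult_mono) auto
  also have "\<dots> = 2 ^ ((e + K + 1) * D)" by (simp add: algebra_simps flip: power_add)
  finally have NR: "?pw * K * ?M \<le> 2 ^ ((e + K + 1) * D)" .
  have "?M ^ K \<le> 2 ^ ((e + K + 2) * D)" "?pw * K * ?M \<le> 2 ^ ((e + K + 2) * D)" "na + nb \<le> 2 ^ ((e + K + 2) * D)"
    using MKle NR nle mono[of K "e + K + 2"] mono[of "e + K + 1" "e + K + 2"] mono[of 1 "e + K + 2"] by linarith+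
  moreover have "(3::nat) \<le> 2 ^ ((e + K + 2) * D)"
  proof -
    have "(2::nat) ^ 2 \<le> 2 ^ (2 * D)" using D by (intro power_increasing) auto
    then have "(4::nat) \<le> 2 ^ (2 * D)" by simp
    then show ?thesis using mono[of 2 "e + K + 2"] by linarith
  qed
  ultimately have "8 * (?M ^ K + ?pw * K * ?M + (na + nb) + 3) \<le> 2 ^ 5 * 2 ^ ((e + K + 2) * D)" by simp
  also have "(2::nat) ^ 5 * 2 ^ ((e + K + 2) * D) \<le> 2 ^ (5 * D) * 2 ^ ((e + K + 2) * D)"
    using D by (intro mult_right_mono power_increasing) auto
  also have "\<dots> = 2 ^ ((e + K + 7) * D)" by (simp add: algebra_simps flip: power_add)
  finally have Big: "8 * (?M ^ K + ?pw * K * ?M + (na + nb) + 3) < 2 ^ (\<kappa> * D)"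
    by (rule up) (use \<kappa> in simp)
  have ds: "(2::nat) ^ (d + s) + 1 \<le> 2 ^ (2 * D)"
  proof -
    have "(2::nat) ^ (d + s) \<le> 2 ^ (2 * D - 1)" using s(2) D by (intro power_increasing) (auto simp: D_def)
    moreover have "(2::nat) ^ (2 * D) = 2 * 2 ^ (2 * D - 1)" using D by (simp flip: power_Suc)
    moreover have "(1::nat) \<le> 2 ^ (2 * D - 1)" by simp
    ultimately show ?thesis by linarith
  qed
  have "2 ^ (d div 2 + s) div (d choose (s div 2)) \<le> (2::nat) ^ (d div 2 + s)" by (rule div_le_dividend)
  also have "\<dots> \<le> 2 ^ (d + s)" by (intro power_increasing) auto
  finally have "?cap \<le> 2 ^ (2 * D) * 2 ^ (e * D)" using ds pw by (intro mult_mono) auto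
  also have "\<dots> = 2 ^ ((e + 2) * D)" by (simp add: algebra_simps flip: power_add)
  finally have cap: "?cap < 2 ^ (\<kappa> * D)" by (rule up) (use \<kappa> in simp)
  have "(2::nat) ^ (d + 2) \<le> 2 ^ (2 * D)" by (intro power_increasing) (auto simp: D_def)
  then have w2: "(2::nat) ^ (d + 2) < 2 ^ (\<kappa> * D)" by (rule up) (use \<kappa> in simp)
  have "d * p \<le> 2 ^ (1 * D) * 2 ^ (p * D)" using d2 le_pow[of p] by (intro mult_mono) auto
  also have "\<dots> = 2 ^ ((p + 1) * D)" by (simp add: algebra_simps flip: power_add)
  finally have dp: "d * p < 2 ^ (\<kappa> * D)" by (rule up) (use \<kappa> in simp)
  have "(2::nat) ^ (d + s) \<le> 2 ^ (2 * D)" "d + 1 \<le> 2 ^ (1 * D)" using ds d2 unfolding mult_1 by linarith+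
  then have "2 ^ (d + s) * (d + 1) \<le> 2 ^ (2 * D) * 2 ^ (1 * D)" by (rule mult_mono) simp_all
  also have "\<dots> = (2::nat) ^ (3 * D)" by (simp add: algebra_simps flip: power_add)
  finally have dsd: "2 ^ (d + s) * (d + 1) < 2 ^ (\<kappa> * D)" by (rule up) (use \<kappa> in simp)
  have small: "e < 2 ^ (\<kappa> * D)" "p < 2 ^ (\<kappa> * D)" "q < 2 ^ (\<kappa> * D)"
    using up[OF le_pow[of e]] up[OF le_pow[of p]] up[OF le_pow[of q]] \<kappa> by simp_all
  have xsj: "xs ! j < ?M ^ K" if "j < na + nb" for j
  proof -
    have "xs ! j < 2 ^ (d + 1)" using that len by (intro xs nth_mem) simp
    also have "(2::nat) ^ (d + 1) \<le> 2 ^ (?m * K)" using mK by (intro power_increasing) auto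
    finally show ?thesis unfolding MK .
  qed
  show ?thesis
    using K len xsj Big cap w2 dp dsd small s
    unfolding D_def by unfold_locales simp_all
qed

text \<open>The dominant term treats \<open>n\<close> sets in \<open>pw\<close> rounds with up to
  \<open>cap\<close> covers each, and \<open>cap\<close> contains another factor \<open>pw\<close>;
  this is the source of \<open>2 * e\<close>. The maximum with 1 accounts for tables that are built
  even for empty families.\<close>

lemma (in program_layout) total_time_le:
  fixes X C :: real
  assumes X: "1 \<le> X" and M_le: "real M \<le> 2 * X" and C: "0 \<le> C"
    and cap_le: "real cap \<le> real pw * (C * (real d + 1) * X + 1)"
  shows "real total_time \<le> (7 * e + 13 + 38 + 58 * K + 12 + (102 * K + (C + 1) * (25 * K + 34) + 47) + 104) *
    (real d + 2) ^ (2 * e + 2) * (max 1 (real n) * X)"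
proof -
  define Y where "Y = real d + 2"
  define N where "N = max 1 (real n)"
  define G where "G = Y ^ (2 * e + 2) * (N * X)"
  have Y: "2 \<le> Y" and N: "1 \<le> N" "real n \<le> N" by (auto simp: Y_def N_def)
  have G: "Y ^ i * (a * b) \<le> G" if "i \<le> 2 * e + 2" "0 \<le> a" "a \<le> N" "0 \<le> b" "b \<le> X" for i a b
    unfolding G_def using that Y by (intro mult_mono power_increasing mult_nonneg_nonneg) auto
  have pw: "real pw = Y ^ e" unfolding pw_eq Y_def by (simp add: add.commute)
  have "m \<le> d + 2" unfolding m_eq using div_le_dividend[of d K] by linarith
  then have m: "real m \<le> Y" unfolding Y_def by linarith
  have G1: "1 \<le> G" using G[of 0 1 1] X N by simp
  have t1: "real (e * 7) \<le> 7 * e * G" using mult_left_mono[OF G1, of "7 * real e"] by (simp add: mult.commute)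
  have t2: "real (d * 13) \<le> 13 * G" using G[of 1 1 1] X N by (simp add: Y_def)
  have t3: "real (M * 19) \<le> 38 * G" using G[of 0 1 X] M_le X N by simp
  have t4: "real (pw * K * M * (m * 11 + 18)) \<le> 58 * K * G"
  proof -
    have "real (m * 11 + 18) \<le> 29 * Y" using m Y by simp
    then have "real (pw * K * M * (m * 11 + 18)) \<le> (Y ^ e * K * (2 * X)) * (29 * Y)"
      unfolding of_nat_mult pw using M_le Y X by (intro mult_mono) auto
    also have "\<dots> = 58 * K * (Y ^ (e + 1) * (1 * X))" by simp
    also have "\<dots> \<le> 58 * K * G" using X N by (intro mult_left_mono G) auto
    finally show ?thesis .
  qed
  have t5: "real (pw * 12) \<le> 12 * G" using G[of e 1 1] X N by (simp add: pw)
  have t6: "real (pw * (n * (set_time + 6))) \<le> (102 * K + (C + 1) * (25 * K + 34) + 47) * G"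
  proof -
    have c: "real cap \<le> Y ^ e * ((C + 1) * (Y * X))"
    proof -
      have "1 \<le> Y * X" using mult_mono[of 1 Y 1 X] X Y by simp
      moreover have "C * (real d + 1) * X \<le> C * Y * X" using C X by (intro mult_right_mono mult_left_mono) (auto simp: Y_def)
      ultimately have "C * (real d + 1) * X + 1 \<le> (C + 1) * (Y * X)" by (simp add: algebra_simps)
      then have "real pw * (C * (real d + 1) * X + 1) \<le> Y ^ e * ((C + 1) * (Y * X))"
        unfolding pw using Y by (intro mult_left_mono) auto
      then show ?thesis using cap_le by linarith
    qed
    have Y1: "1 \<le> Y ^ i" for i using Y by (intro one_le_power) auto
    have "real (set_time + 6) = real K * (31 * real M + 40) + real cap * real (25 * K + 34) + 47"
      by (simp add: set_time_def algebra_simps)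
    also have "\<dots> \<le> real K * (102 * X) + (Y ^ e * ((C + 1) * (Y * X))) * real (25 * K + 34) + 47 * X"
      using c X M_le by (intro add_mono mult_right_mono mult_left_mono) auto
    also have "\<dots> \<le> (102 * K + (C + 1) * (25 * K + 34) + 47) * (Y ^ (e + 1) * X)"
    proof -
      have "X \<le> Y ^ (e + 1) * X" using mult_right_mono[OF Y1[of "e + 1"], of X] X by simp
      then have "real K * (102 * X) \<le> 102 * real K * (Y ^ (e + 1) * X)" "47 * X \<le> 47 * (Y ^ (e + 1) * X)"
        using mult_left_mono[of X "Y ^ (e + 1) * X" "102 * real K"] by (simp_all add: mult_ac)
      then show ?thesis by (simp add: algebra_simps)
    qed
    finally have st: "real (set_time + 6) \<le> (102 * K + (C + 1) * (25 * K + 34) + 47) * (Y ^ (e + 1) * X)" .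
    have "real (pw * (n * (set_time + 6))) = Y ^ e * (real n * real (set_time + 6))" by (simp add: pw)
    also have "\<dots> \<le> Y ^ e * (N * ((102 * K + (C + 1) * (25 * K + 34) + 47) * (Y ^ (e + 1) * X)))"
      using st N Y by (intro mult_left_mono mult_mono) auto
    also have "\<dots> = (102 * K + (C + 1) * (25 * K + 34) + 47) * (Y ^ (2 * e + 1) * (N * X))"
    proof -
      have "Y ^ (2 * e + 1) = Y ^ e * Y ^ (e + 1)" by (simp add: mult_2 flip: power_add)
      then show ?thesis by (simp only: mult_ac)
    qed
    also have "\<dots> \<le> (102 * K + (C + 1) * (25 * K + 34) + 47) * G"
      using X N C by (intro mult_left_mono G) auto
    finally show ?thesis .
  qed
  have t7: "104 \<le> 104 * G" using G1 by simp
  have "real total_time = real (e * 7) + real (d * 13) + real (M * 19) + real (pw * K * M * (m * 11 + 18)) +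
      real (pw * 12) + real (pw * (n * (set_time + 6))) + 104"
    unfolding total_time_def by (simp add: algebra_simps)
  also have "\<dots> \<le> 7 * e * G + 13 * G + 38 * G + 58 * K * G + 12 * G + (102 * K + (C + 1) * (25 * K + 34) + 47) * G + 104 * G"
    using t1 t2 t3 t4 t5 t6 t7 by linarith
  also have "\<dots> = (7 * e + 13 + 38 + 58 * K + 12 + (102 * K + (C + 1) * (25 * K + 34) + 47) + 104) * G"
    by (simp add: distrib_right)
  finally show ?thesis by (simp only: G_def Y_def N_def mult.assoc)
qed

lemma (in program_layout) Big_le:
  "real (6 * Big) \<le> 6 * (2 ^ K + 2 * K + 4) * (real d + 2) ^ (2 * e + 2) * (real n + 2 ^ d)"
proof -
  define Y where "Y = (real d + 2) ^ (2 * e + 2)"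
  define G where "G = Y * (real n + 2 ^ d)"
  have Y1: "1 \<le> Y" unfolding Y_def by (intro one_le_power) auto
  have G: "2 ^ d \<le> G" "real n \<le> G"
  proof -
    have g: "real n + 2 ^ d \<le> G"
      unfolding G_def using mult_right_mono[OF Y1, of "real n + 2 ^ d"] by simp
    show "2 ^ d \<le> G" "real n \<le> G" by (rule order_trans[OF _ g], simp)+
  qed
  \<comment> \<open>Rounding up the block length adds at most \<open>K\<close> positions to the
    universe, which enlarges the table of marks by at most \<open>2 ^ K\<close>.\<close>
  have "real (M ^ K) \<le> 2 ^ K * 2 ^ d"
  proof -
    have "m * K \<le> d + K" unfolding m_eq using div_mult_mod_eq[of d K] by (simp add: algebra_simps)
    then have "(2::real) ^ (m * K) \<le> 2 ^ (d + K)" by (intro power_increasing) auto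
    moreover have "real (M ^ K) = 2 ^ (m * K)" unfolding M by (simp add: power_mult)
    moreover have "(2::real) ^ (d + K) = 2 ^ K * 2 ^ d" by (simp add: power_add)
    ultimately show ?thesis by linarith
  qed
  also have "\<dots> \<le> 2 ^ K * G" using G by (intro mult_left_mono) auto
  finally have 1: "real (M ^ K) \<le> 2 ^ K * G" .
  have M2: "real M \<le> 2 * 2 ^ d"
  proof -
    have "m \<le> Suc d" unfolding m_eq using div_le_dividend[of d K] by simp
    then have "(2::real) ^ m \<le> 2 ^ Suc d" by (intro power_increasing) auto
    then show ?thesis by (simp add: M)
  qed
  have "(real d + 2) ^ e \<le> Y" unfolding Y_def by (intro power_increasing) auto
  moreover have "real pw = (real d + 2) ^ e" unfolding pw_eq by (simp add: add.commute)
  ultimately have "real pw \<le> Y" by simp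
  then have "real (pw * K * M) \<le> Y * K * (2 * 2 ^ d)" unfolding of_nat_mult using M2 Y1 by (intro mult_mono) auto
  also have "\<dots> = 2 * K * (Y * 2 ^ d)" by simp
  also have "\<dots> \<le> 2 * K * G" unfolding G_def using Y1 by (intro mult_left_mono) auto
  finally have 2: "real (pw * K * M) \<le> 2 * K * G" .
  have 3: "(3::real) \<le> 3 * G" using G(1) one_le_power[of "2::real" d] by linarith
  have "real (6 * Big) = 6 * (real (M ^ K) + real (pw * K * M) + real n + 3)" unfolding Big by simp
  also have "\<dots> \<le> 6 * (2 ^ K * G + 2 * K * G + G + 3 * G)" using 1 2 3 G by (intro mult_left_mono add_mono) auto
  also have "\<dots> = 6 * (2 ^ K + 2 * K + 4) * G" by (simp add: algebra_simps)
  finally show ?thesis unfolding G_def Y_def by (simp only: mult.assoc)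
qed

text \<open>The shift in \<open>polylog_factor\<close> makes its logarithm at least 1, so
  \<open>d + 2\<close> is at most twice its base.\<close>

lemma polylog_ge:
  assumes "0 \<le> C" "0 \<le> R"
  shows "C * (real d + 2) ^ c * R \<le> polylog_factor (C * 2 ^ c) c d n * R"
proof -
  define L where "L = real d + log 2 (real n + 2)"
  have "1 \<le> log 2 (real n + 2)" by simp
  then have "real d + 2 \<le> 2 * L" unfolding L_def using of_nat_0_le_iff[of d, where 'a = real] by argo
  then have "(real d + 2) ^ c \<le> (2 * L) ^ c" by (intro power_mono) auto
  then have "C * (real d + 2) ^ c \<le> C * (2 * L) ^ c" using assms by (intro mult_left_mono)
  then show ?thesis using assms unfolding polylog_factor_def L_def[symmetric]
    by (intro mult_right_mono) (simp_all add: power_mult_distrib mult.assoc)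
qed

lemma polylog_mono:
  assumes "C \<le> C'"
  shows "polylog_factor C c d n \<le> polylog_factor C' c d n"
proof -
  have "1 \<le> log 2 (real n + 2)" by simp
  then show ?thesis unfolding polylog_factor_def using assms by (intro mult_right_mono zero_le_power) auto
qed

theorem theorem5:
  fixes lambda sigma :: real
  assumes "0.4 \<le> lambda" "lambda \<le> 0.5"
    and "0.4 \<le> sigma" "sigma \<le> 0.6"
  shows "\<exists>(P :: com) (\<kappa> :: nat) (C :: real) (c :: nat). \<kappa> > 0 \<and> C > 0 \<and>
    (\<forall>(d :: nat) (k :: nat) (l :: nat) (\<A> :: nat set set) (\<B> :: nat set set)
        (As :: nat set list) (Bs :: nat set list).
      real k = sigma * lambda * real d \<longrightarrow>
      real l = (1 - sigma) * lambda * real d \<longrightarrow>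
      \<A> \<subseteq> nsets {1..d} k \<longrightarrow>
      \<B> \<subseteq> nsets {1..d} l \<longrightarrow>
      distinct As \<longrightarrow> set As = \<A> \<longrightarrow>
      distinct Bs \<longrightarrow> set Bs = \<B> \<longrightarrow>
      monte_carlo_decides (\<kappa> * (d + 1)) P (families_input d As Bs)
        (\<exists>A\<in>\<A>. \<exists>B\<in>\<B>. A \<inter> B = {})
        (polylog_factor C c d (card \<A> + card \<B>) *
          (max 1 (real (card \<A> + card \<B>)) *
            2 powr (real d * (1 / 2 + lambda - binary_entropy (lambda / 2)))))
        (polylog_factor C c d (card \<A> + card \<B>) *
          (real (card \<A> + card \<B>) + 2 ^ d)))"
proof -
  \<comment> \<open>Matches the lower bound 0.1 of \<open>rate_ge\<close>:
    \<open>2 ^ (d div K)\<close> then stays within the claimed exponential factor.\<close>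
  define K :: nat where "K = 10"
  have K: "0 < K" by (simp add: K_def)
  obtain p q :: nat where pq: "\<And>d s. real s = lambda * real d \<Longrightarrow> s = d * p div q"
  proof (cases "lambda \<in> \<rat>")
    case True
    then obtain p q where pq: "q \<noteq> 0" "\<bar>lambda\<bar> = real p / real q" using Rats_abs_nat_div_natE by metis
    then have l: "lambda = real p / real q" using assms by simp
    have "s = d * p div q" if "real s = lambda * real d" for d s :: nat
    proof -
      have "real (s * q) = real (d * p)" using that pq(1) by (simp add: l field_simps)
      then have "s * q = d * p" by (simp only: of_nat_eq_iff)
      then show ?thesis using pq(1) by (metis nonzero_mult_div_cancel_right)
    qed
    then show ?thesis using that by blast
  next
    case False
    have "d = 0" if "real s = lambda * real d" for d s :: nat
    proof (rule ccontr)
      assume "d \<noteq> 0"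
      then have "lambda = real s / real d" using that by simp
      then show False using False by simp
    qed
    \<comment> \<open>For irrational \<lambda> integrality forces \<open>d = 0\<close>, so any
      constants serve.\<close>
    then have "s = d * 0 div 1" if "real s = lambda * real d" for d s :: nat using that by fastforce
    then show ?thesis using that by blast
  qed
  obtain \<rho> Q where \<rho>: "0 < \<rho>" "\<rho> < 1" and Q: "0 < Q" and work: "\<And>d m a b c y.
     (\<forall>i<K. a i + b i + c i = m) \<and> d \<le> K * m \<and> K * m \<le> d + K \<and>
     (\<forall>i<K. y i = nat \<lfloor>\<rho> * (real (c i) + 1)\<rfloor>) \<and>
     (\<Sum>i<K. real (a i)) = sigma * lambda * real d \<and> (\<Sum>i<K. real (b i)) = (1 - sigma) * lambda * real d \<Longrightarrow>
     (\<Prod>i<K. real ((b i + c i) choose y i) / real (c i choose y i)) \<le> Q * (real m + 1) ^ K * 2 powr (real d * rate lambda) \<and>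
     (\<Prod>i<K. real ((a i + c i) choose (c i - y i)) / real (c i choose y i)) \<le> Q * (real m + 1) ^ K * 2 powr (real d * rate lambda)"
    using work_bound[OF assms, of K] by blast
  obtain C0 where C0: "0 < C0" and binom: "\<And>d s::nat. real s = lambda * real d \<Longrightarrow>
     2 powr (real d * rate lambda) \<le> C0 * (2 ^ (d div 2 + s) / real (d choose (s div 2))) \<and>
     2 ^ (d div 2 + s) / real (d choose (s div 2)) \<le> C0 * (real d + 1) * 2 powr (real d * rate lambda)"
    using binomial_rate_bounds[OF assms(1,2)] by blast
  \<comment> \<open>\<open>e1\<close> rounds with the right guesses push the failure probability
    below 1/3.\<close>
  obtain e1 where e1: "(1 - (1 / 4) ^ K :: real) ^ e1 < 1 / 3"
    using real_arch_pow_inv[of "1 / 3" "1 - (1 / 4) ^ K :: real"] by auto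
  \<comment> \<open>\<open>e2\<close> factors \<open>d + 2\<close>, each at least 2, absorb the
    constants in the lower bound for the cap.\<close>
  obtain e2 where e2: "16 ^ K * Q * C0 < 2 ^ e2"
    using real_arch_pow[of 2 "16 ^ K * Q * C0"] by auto
  \<comment> \<open>\<open>2 * K\<close> digits hold the guesses and \<open>e1\<close> secures the
    repetitions. In the cap the same power of \<open>d + 2\<close> also swallows
    \<open>(m + 1) ^ K\<close>, for which the summand \<open>2 * K\<close> leaves room.\<close>
  define e where "e = 2 * K + e1 + e2"
  define \<kappa> where "\<kappa> = e + 2 * K + p + q + 20"
  define c where "c = 2 * e + 2"
  define T0 where "T0 = 7 * e + 13 + 38 + 58 * K + 12 + (102 * K + (C0 + 1) * (25 * K + 34) + 47) + 104"
  define S0 where "S0 = (6 * (2 ^ K + 2 * K + 4) :: real)"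
  define C where "C = max (T0 * 2 ^ c) (S0 * 2 ^ c)"
  have S0: "0 < S0" by (simp add: S0_def add_pos_nonneg)
  have T0: "0 \<le> T0" using C0 by (simp add: T0_def)
  show ?thesis
  proof (rule exI[of _ "program K e p q"], rule exI[of _ \<kappa>], rule exI[of _ C], rule exI[of _ c], intro conjI allI impI)
    show "0 < \<kappa>" by (simp add: \<kappa>_def)
    show "0 < C" using S0 by (simp add: C_def less_max_iff_disj)
  next
    fix d k l :: nat and \<A> \<B> :: "nat set set" and As Bs :: "nat set list"
    assume k: "real k = sigma * lambda * real d" and l: "real l = (1 - sigma) * lambda * real d"
      and \<A>: "\<A> \<subseteq> nsets {1..d} k" and \<B>: "\<B> \<subseteq> nsets {1..d} l"
      and As: "distinct As" "set As = \<A>" and Bs: "distinct Bs" "set Bs = \<B>"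
    define s where "s = k + l"
    have s: "real s = lambda * real d" unfolding s_def of_nat_add k l by (simp add: algebra_simps)
    have sd: "s \<le> d"
    proof -
      have "lambda * real d \<le> 1 * real d" using assms by (intro mult_right_mono) auto
      then show ?thesis using s by simp
    qed
    define na where "na = length As"
    define nb where "nb = length Bs"
    define xs where "xs = map set_encode As @ map set_encode Bs"
    have card: "card \<A> = na" "card \<B> = nb" using As Bs distinct_card unfolding na_def nb_def by metis+
    have fin: "finite X" "X \<subseteq> {1..d}" if "X \<in> set As \<union> set Bs" for X
      using that \<A> \<B> As(2) Bs(2) by (auto simp: nsets_def)
    have cards: "card X = k" if "X \<in> set As" for X using that \<A> As(2) by (auto simp: nsets_def)
    have cards': "card X = l" if "X \<in> set Bs" for X using that \<B> Bs(2) by (auto simp: nsets_def)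
    have nle: "na \<le> 2 ^ d" "nb \<le> 2 ^ d"
    proof -
      have "\<A> \<subseteq> Pow {1..d}" "\<B> \<subseteq> Pow {1..d}" using \<A> \<B> by (auto simp: nsets_def)
      then have "card \<A> \<le> card (Pow {1..d})" "card \<B> \<le> card (Pow {1..d})" by (intro card_mono; simp)+
      then show "na \<le> 2 ^ d" "nb \<le> 2 ^ d" by (simp_all add: card card_Pow)
    qed
    let ?m = "d div K + 1"
    let ?pw = "(d + 2) ^ e"
    let ?cap = "(2 ^ (d div 2 + s) div (d choose (s div 2)) + 1) * ?pw"
    let ?Big = "(2 ^ ?m) ^ K + ?pw * K * 2 ^ ?m + (na + nb) + 3"
    interpret program_layout "\<kappa> * (d + 1)" d na "na + nb" ?m "2 ^ ?m" ?pw ?cap ?Big K xs nb s e p q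
    proof (rule program_layout_intro[OF K pq[OF s] sd _ nle])
      show "length xs = na + nb" by (simp add: xs_def na_def nb_def)
      show "e + 2 * K + p + q + 20 \<le> \<kappa>" by (simp add: \<kappa>_def)
      show "x < 2 ^ (d + 1)" if x: "x \<in> set xs" for x
      proof -
        obtain X where X: "X \<in> set As \<union> set Bs" "x = set_encode X" using x by (auto simp: xs_def)
        have "set_decode x \<subseteq> {..<d + 1}" using fin[OF X(1)] X(2) by auto
        then show ?thesis by (simp only: set_decode_subset_iff)
      qed
    qed
    have inp_eq: "families_input d As Bs = inp"
    proof -
      have "families_input d As Bs = [d, na, nb] @ xs" by (simp add: families_input_def na_def nb_def xs_def)
      then show ?thesis unfolding inp_def .
    qed
    have xsA: "xs ! i = set_encode (As ! i)" if "i < na" for i using that by (simp add: xs_def na_def nth_append)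
    have xsB: "xs ! (na + i) = set_encode (Bs ! i)" if "i < nb" for i using that by (simp add: xs_def na_def nb_def nth_append)
    have dec: "set_decode (set_encode X) = X" if "X \<in> set As \<union> set Bs" for X using fin[OF that] by simp
    have answer: "disjoint_pair \<longleftrightarrow> (\<exists>A\<in>\<A>. \<exists>B\<in>\<B>. A \<inter> B = {})"
    proof
      assume disjoint_pair
      then obtain i j where ij: "i < na" "na \<le> j" "j < na + nb" "land (xs ! i) (xs ! j) = 0"
        unfolding disjoint_pair_def by blast
      define j' where "j' = j - na"
      have j': "j = na + j'" "j' < nb" using ij by (auto simp: j'_def)
      have mem: "As ! i \<in> set As" "Bs ! j' \<in> set Bs" using ij(1) j'(2) by (simp_all add: na_def nb_def)
      have "As ! i \<inter> Bs ! j' = {}"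
        using ij(4) unfolding j'(1) xsA[OF ij(1)] xsB[OF j'(2)] land_eq_0_iff using dec mem by simp
      then show "\<exists>A\<in>\<A>. \<exists>B\<in>\<B>. A \<inter> B = {}" using mem As(2) Bs(2) by blast
    next
      assume "\<exists>A\<in>\<A>. \<exists>B\<in>\<B>. A \<inter> B = {}"
      then obtain A B where AB: "A \<in> set As" "B \<in> set Bs" "A \<inter> B = {}" using As(2) Bs(2) by blast
      then obtain i j where ij: "i < na" "As ! i = A" "j < nb" "Bs ! j = B"
        unfolding na_def nb_def in_set_conv_nth by blast
      have "land (xs ! i) (xs ! (na + j)) = 0"
        unfolding xsA[OF ij(1)] xsB[OF ij(3)] ij land_eq_0_iff using dec AB by simp
      then show disjoint_pair unfolding disjoint_pair_def using ij by (meson add_less_cancel_left le_add1)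
    qed
    define X where "X = 2 powr (real d * rate lambda)"
    have rate01: "0.1 \<le> rate lambda" by (rule rate_ge[OF assms(1,2)])
    have X1: "1 \<le> X" unfolding X_def using rate01 by (intro ge_one_powr_ge_zero) auto
    have Mle: "real (2 ^ ?m) \<le> 2 * X"
    proof -
      have "real (d div K) \<le> real d / real K" by (rule of_nat_div_le_of_nat)
      also have "\<dots> = real d * 0.1" by (simp add: K_def)
      also have "\<dots> \<le> real d * rate lambda" using rate01 by (intro mult_left_mono) auto
      finally have "(2::real) powr real (d div K) \<le> X" unfolding X_def by (intro powr_mono) auto
      then show ?thesis by (simp add: powr_realpow)
    qed
    define R where "R = 2 ^ (d div 2 + s) / real (d choose (s div 2))"
    let ?f = "2 ^ (d div 2 + s) div (d choose (s div 2)) :: nat"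
    have "s div 2 \<le> d" using sd by linarith
    then have chpos: "0 < d choose (s div 2)" by simp
    \<comment> \<open>The quotient in the cap is rounded down; the added 1 compensates for
      this.\<close>
    have R: "real ?f \<le> R" "R \<le> real ?f + 1"
    proof -
      show "real ?f \<le> R" unfolding R_def using of_nat_div_le_of_nat[of "2 ^ (d div 2 + s)" "d choose (s div 2)"] by simp
      have "2 ^ (d div 2 + s) \<le> (?f + 1) * (d choose (s div 2))"
        using dividend_less_div_times[OF chpos, of "2 ^ (d div 2 + s)"] by simp
      then have "real (2 ^ (d div 2 + s)) \<le> real ((?f + 1) * (d choose (s div 2)))" by (simp only: of_nat_le_iff)
      then show "R \<le> real ?f + 1" unfolding R_def using chpos by (simp add: divide_le_eq distrib_right)
    qed
    have XR: "X \<le> C0 * R" "R \<le> C0 * (real d + 1) * X" using binom[OF s] unfolding X_def R_def by auto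
    have cap_eq': "real ?cap = real ?pw * (real ?f + 1)"
      by (simp only: of_nat_mult of_nat_add of_nat_1 mult.commute)
    have pw_eq': "real ?pw = (real d + 2) ^ e" by (simp add: add.commute)
    have cap_le: "real ?cap \<le> real ?pw * (C0 * (real d + 1) * X + 1)"
    proof -
      have "real ?cap = real ?pw * (real ?f + 1)" by (rule cap_eq')
      also have "\<dots> \<le> real ?pw * (C0 * (real d + 1) * X + 1)" using R XR by (intro mult_left_mono) auto
      finally show ?thesis .
    qed
    have cap_ge: "16 ^ K * (Q * (real ?m + 1) ^ K * X) \<le> real ?cap"
    proof -
      have "real ?m + 1 \<le> real d + 2" using div_le_dividend[of d K] by simp
      then have mY: "(real ?m + 1) ^ K \<le> (real d + 2) ^ K" by (intro power_mono) auto
      have "16 ^ K * (Q * (real ?m + 1) ^ K * X) \<le> 16 ^ K * (Q * (real d + 2) ^ K * (C0 * (real ?f + 1)))"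
      proof -
        have "X \<le> C0 * (real ?f + 1)" using XR(1) mult_left_mono[OF R(2), of C0] C0 by linarith
        then show ?thesis using mY Q X1 by (intro mult_left_mono mult_mono) auto
      qed
      also have "\<dots> = (16 ^ K * Q * C0) * ((real d + 2) ^ K * (real ?f + 1))" by simp
      also have "\<dots> \<le> 2 ^ e2 * ((real d + 2) ^ K * (real ?f + 1))" using e2 by (intro mult_right_mono) auto
      also have "\<dots> \<le> (real d + 2) ^ e2 * ((real d + 2) ^ K * (real ?f + 1))"
        by (intro mult_right_mono power_mono) auto
      also have "\<dots> = (real d + 2) ^ (e2 + K) * (real ?f + 1)" by (simp add: power_add)
      also have "\<dots> \<le> (real d + 2) ^ e * (real ?f + 1)"
        by (intro mult_right_mono power_increasing) (auto simp: e_def)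
      also have "\<dots> = real ?cap" unfolding cap_eq' pw_eq' ..
      finally show ?thesis .
    qed
    have mK: "d \<le> K * ?m" "K * ?m \<le> d + K"
    proof -
      have "K * ?m = d div K * K + K" by simp
      moreover have "d div K * K + d mod K = d" "d mod K < K" using K by (simp_all only: div_mult_mod_eq mod_less_divisor)
      ultimately show "d \<le> K * ?m" "K * ?m \<le> d + K" by linarith+
    qed
    have success: "2 / 3 \<le> measure_pmf.prob (Pi_pmf {..<?pw * K * 2 ^ ?m} 0 (\<lambda>_. pmf_of_set {..<2 ^ ?m})) {Z. snd (search Z ?pw)}"
      if dp: disjoint_pair
    proof -
      obtain i j where ij: "i < na" "na \<le> j" "j < na + nb" "land (xs ! i) (xs ! j) = 0"
        using dp unfolding disjoint_pair_def by blast
      let ?a = "\<lambda>k. popcount (part i k)"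
      let ?b = "\<lambda>k. popcount (part j k)"
      let ?c = "\<lambda>k. ?m - ?a k - ?b k"
      let ?y = "\<lambda>k. nat \<lfloor>\<rho> * (real (?c k) + 1)\<rfloor>"
      have sum: "(\<Sum>t<K. real (popcount (part j t))) = real (popcount (xs ! j))" if "j < na + nb" for j
      proof -
        have "popcount (xs ! j) = (\<Sum>t<K. popcount (part j t))"
          unfolding part_def by (rule popcount_digits[OF xs[OF that]])
        then show ?thesis by (simp only: of_nat_sum)
      qed
      have pA: "popcount (xs ! i) = k"
        unfolding xsA[OF ij(1)] popcount_def using dec cards ij(1) by (simp add: na_def)
      have pB: "popcount (xs ! j) = l"
      proof -
        define j' where "j' = j - na"
        have j': "j = na + j'" "j' < nb" using ij by (auto simp: j'_def)
        show ?thesis unfolding j'(1) xsB[OF j'(2)] popcount_def using dec cards' j'(2) by (simp add: nb_def)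
      qed
      have W: "(\<Prod>t<K. real ((?b t + ?c t) choose ?y t) / real (?c t choose ?y t)) \<le> Q * (real ?m + 1) ^ K * X \<and>
        (\<Prod>t<K. real ((?a t + ?c t) choose (?c t - ?y t)) / real (?c t choose ?y t)) \<le> Q * (real ?m + 1) ^ K * X"
        unfolding X_def
      proof (rule work, intro conjI allI impI refl mK)
        show "?a t + ?b t + ?c t = ?m" for t using popcount_parts_le[OF ij(4), of t] by linarith
        show "(\<Sum>t<K. real (?a t)) = sigma * lambda * real d" using sum[of i] ij(1) pA k by simp
        show "(\<Sum>t<K. real (?b t)) = (1 - sigma) * lambda * real d" using sum[of j] ij(3) pB l by simp
      qed
      show ?thesis
      proof (rule search_success[OF ij \<rho>])
        show "16 ^ K * (\<Prod>t<K. real ((?b t + ?c t) choose ?y t) / real (?c t choose ?y t)) \<le> real ?cap"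
          by (rule order_trans[OF mult_left_mono[OF conjunct1[OF W]] cap_ge]) simp
        show "16 ^ K * (\<Prod>t<K. real ((?a t + ?c t) choose (?c t - ?y t)) / real (?c t choose ?y t)) \<le> real ?cap"
          by (rule order_trans[OF mult_left_mono[OF conjunct2[OF W]] cap_ge]) simp
        show "2 * K \<le> e" by (simp add: e_def)
        \<comment> \<open>The number of right rounds is a power of \<open>d + 2\<close>, which is at
          least \<open>2 ^ e1\<close> even for \<open>d = 0\<close>.\<close>
        have "e1 \<le> 2 ^ e1" using less_exp[of e1] by simp
        also have "(2::nat) ^ e1 \<le> (d + 2) ^ e1" by (intro power_mono) auto
        also have "\<dots> \<le> (d + 2) ^ (e - 2 * K)" by (intro power_increasing) (auto simp: e_def)
        finally have "(1 - (1 / 4) ^ K :: real) ^ ((d + 2) ^ (e - 2 * K)) \<le> (1 - (1 / 4) ^ K) ^ e1"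
          by (intro power_decreasing) (auto simp: power_le_one)
        then show "(1 - (1 / 4) ^ K :: real) ^ ((d + 2) ^ (e - 2 * K)) \<le> 1 / 3" using e1 by linarith
      qed
    qed
    have n: "card \<A> + card \<B> = na + nb" by (simp add: card)
    have "real total_time \<le> T0 * (real d + 2) ^ c * (max 1 (real (na + nb)) * X)"
      unfolding T0_def c_def by (rule total_time_le[OF X1 Mle _ cap_le]) (use C0 in simp)
    also have "\<dots> \<le> polylog_factor (T0 * 2 ^ c) c d (na + nb) * (max 1 (real (na + nb)) * X)"
      using T0 X1 by (intro polylog_ge) auto
    also have "\<dots> \<le> polylog_factor C c d (na + nb) * (max 1 (real (na + nb)) * X)"
      using X1 by (intro mult_right_mono polylog_mono) (auto simp: C_def)
    finally have time: "real total_time \<le> polylog_factor C c d (card \<A> + card \<B>) *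
          (max 1 (real (card \<A> + card \<B>)) * 2 powr (real d * (1 / 2 + lambda - binary_entropy (lambda / 2))))"
      unfolding n X_def rate_def .
    have "real (6 * ?Big) \<le> S0 * (real d + 2) ^ c * (real (na + nb) + 2 ^ d)"
      unfolding S0_def c_def by (rule Big_le)
    also have "\<dots> \<le> polylog_factor (S0 * 2 ^ c) c d (na + nb) * (real (na + nb) + 2 ^ d)"
      using S0 by (intro polylog_ge) auto
    also have "\<dots> \<le> polylog_factor C c d (na + nb) * (real (na + nb) + 2 ^ d)"
      by (intro mult_right_mono polylog_mono) (auto simp: C_def)
    finally have space: "real (6 * ?Big) \<le> polylog_factor C c d (card \<A> + card \<B>) * (real (card \<A> + card \<B>) + 2 ^ d)"
      unfolding n .
    show "monte_carlo_decides (\<kappa> * (d + 1)) (program K e p q) (families_input d As Bs)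
        (\<exists>A\<in>\<A>. \<exists>B\<in>\<B>. A \<inter> B = {})
        (polylog_factor C c d (card \<A> + card \<B>) *
          (max 1 (real (card \<A> + card \<B>)) *
            2 powr (real d * (1 / 2 + lambda - binary_entropy (lambda / 2)))))
        (polylog_factor C c d (card \<A> + card \<B>) *
          (real (card \<A> + card \<B>) + 2 ^ d))"
      unfolding inp_eq answer[symmetric] by (rule monte_carlo_program[OF time space success])
  qed
qed

end
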